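(* Let $\mathbf z_k\in V^M$, $0\le k\le |V^M|-1$, be an indexing of the vertices of the macro-mesh $\tau_h^M$ such that $\mathbf z_0\in V^M_{ext}$ (that is, $\mathbf z_0$ lies on $\partial\Omega$). For each $k$ let $\boldsymbol\Phi^{(k)}_i$, $1\le i\le 3$, be the three basis functions of $\mathbf V_{\mathbf z_k}$ described in the context (for $\mathbf z=\mathbf z_k$). Define $$\mathcal B=\left\{\boldsymbol\Phi^{(k)}_i \;:\; 1\le i\le 3,\ 0\le k\le |V^M|-1\right\}\setminus\left\{\boldsymbol\Phi^{(0)}_3\right\},\qquad \mathcal B^0=\left\{\boldsymbol\Phi^{(k)}_i\in\mathcal B \;:\; \mathbf z_k\in V^M_{int}\right\}.$$ Then $\mathcal B$ is a basis of $\mathbf V_h$ and $\mathcal B^0$ is a basis of $\mathbf V_h^0$.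
   Context: Domain and macro-mesh: $\Omega\subset\mathbb R^2$ is a simply connected polygonal domain (the interior of a simple closed polygon), and $\tau_h^M$ is a conforming triangulation of $\Omega$ (the macro-mesh; two distinct closed triangles meet in the empty set, a common vertex, or a common full edge). An edge or vertex is exterior if it lies on $\partial\Omega$, otherwise interior. $E^M=E^M_{int}\cup E^M_{ext}$ and $V^M=V^M_{int}\cup V^M_{ext}$ are the sets of (interior and exterior) edges and vertices of $\tau_h^M$. $|S|$ denotes the cardinality of a countable set $S$. Powell-Sabin split $\tau_h$: each triangle of $\tau_h^M$ is subdivided into six triangles as follows. Connect the incenter of each macro-triangle by line segments to its three vertices. For any two macro-triangles sharing an edge, connect their incenters by a line segment, which necessarily intersects the shared edge. For each exterior edge of a macro-triangle, connect the midpoint of that edge to the incenter by a line segment. The resulting triangulation is $\tau_h$. Its vertices are those of $V^M$, the incenters, and exactly one further vertex on each edge of $\tau_h^M$ (called a singular vertex). Spaces: $\mathbf X_h$ is the space of continuous functions $\mathbf v_h:\overline\Omega\to\mathbb R^2$ whose restriction to each $T\in\tau_h$ is a vector of polynomials of degree at most $1$. $\mathbf X_h^0=\{\mathbf v_h\in\mathbf X_h: \mathbf v_h=\mathbf 0 \text{ on }\partial\Omega\}$. $\mathbf V_h=\{\mathbf v_h\in\mathbf X_h:\nabla\cdot\mathbf v_h=0 \text{ on } \Omega\}$, with $\nabla\cdot\mathbf v_h$ the (piecewise constant) weak divergence, and $\mathbf V_h^0=\mathbf V_h\cap\mathbf X_h^0$. Local spaces and basis functions: for $\mathbf z\in V^M$,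 let $\tau^M_{\mathbf z}$ be the set of triangles of $\tau_h^M$ having $\mathbf z$ as a vertex, and let $\mathbf V_{\mathbf z}$ be the space of all $\mathbf v_h\in\mathbf V_h$ that vanish identically on every triangle of $\tau_h^M\setminus\tau^M_{\mathbf z}$ and that vanish on the edge opposite $\mathbf z$ of every triangle of $\tau^M_{\mathbf z}$. The space $\mathbf V_{\mathbf z}$ has dimension $3$, with basis $\{\boldsymbol\Phi_1,\boldsymbol\Phi_2,\boldsymbol\Phi_3\}$ characterized as follows: with $(\alpha_1,\beta_1,\delta_1)=(1,0,0)$, $(\alpha_2,\beta_2,\delta_2)=(0,1,0)$, $(\alpha_3,\beta_3,\delta_3)=(0,0,1)$, the function $\boldsymbol\Phi_i\in\mathbf V_{\mathbf z}$ satisfies $\boldsymbol\Phi_i(\mathbf z)=(\alpha_i,\beta_i)$ and $\int_{e}\boldsymbol\Phi_i\cdot\mathbf n_e\,ds=\delta_i$ for every edge $e\in E^M$ having $\mathbf z$ as an endpoint, where $\mathbf n_e$ is the unit normal on $e$ pointing in the direction of counter-clockwise rotation around $\mathbf z$. *)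

theory Defs
  imports "HOL-Analysis.Analysis" "HOL-Library.Function_Algebras"
begin

instantiation "fun" :: (type, real_vector) real_vector
begin

definition scaleR_fun :: "real \<Rightarrow> ('a \<Rightarrow> 'b) \<Rightarrow> 'a \<Rightarrow> 'b"
  where "scaleR_fun c f = (\<lambda>x. c *\<^sub>R f x)"

instance
  by standard (simp_all add: scaleR_fun_def fun_eq_iff scaleR_add_right scaleR_add_left)

end

type_synonym plane = "real^2"

fun polyline :: "plane list \<Rightarrow> real \<Rightarrow> plane" where
  "polyline [] = linepath 0 0"
| "polyline [a] = linepath a a"
| "polyline [a, b] = linepath a b"
| "polyline (a # b # c # ps) = linepath a b +++ polyline (b # c # ps)"

text \<open>Simple connectedness need not be required: it follows for the inside of a closed Jordan
  curve. Degenerate vertex lists are ruled out by the simplicity of the path.\<close>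

definition polygonal_domain :: "plane set \<Rightarrow> bool" where
  "polygonal_domain \<Omega> \<longleftrightarrow>
     (\<exists>ps. ps \<noteq> [] \<and> simple_path (polyline (ps @ [hd ps])) \<and>
           \<Omega> = inside (path_image (polyline (ps @ [hd ps]))))"

text \<open>Conformity is the library's face condition: for distinct 2-simplices \<open>T\<close>, \<open>T'\<close> the set
  \<open>T \<inter> T'\<close> is a proper face of both, that is, empty, a common vertex or a common side.\<close>

definition macro_mesh :: "plane set \<Rightarrow> plane set set \<Rightarrow> bool" where
  "macro_mesh \<Omega> \<tau> \<longleftrightarrow> triangulation \<tau> \<and> (\<forall>T\<in>\<tau>. 2 simplex T) \<and> \<Union>\<tau> = closure \<Omega>"

definition mesh_vertices :: "plane set set \<Rightarrow> plane set" where
  "mesh_vertices \<tau> = {z. \<exists>T\<in>\<tau>. z extreme_point_of T}"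

definition mesh_edges :: "plane set set \<Rightarrow> plane set set" where
  "mesh_edges \<tau> = {e. \<exists>T\<in>\<tau>. e edge_of T}"

definition exterior_vertices :: "plane set \<Rightarrow> plane set set \<Rightarrow> plane set" where
  "exterior_vertices \<Omega> \<tau> = {z \<in> mesh_vertices \<tau>. z \<in> frontier \<Omega>}"

definition interior_vertices :: "plane set \<Rightarrow> plane set set \<Rightarrow> plane set" where
  "interior_vertices \<Omega> \<tau> = mesh_vertices \<tau> - exterior_vertices \<Omega> \<tau>"

definition exterior_edges :: "plane set \<Rightarrow> plane set set \<Rightarrow> plane set set" where
  "exterior_edges \<Omega> \<tau> = {e \<in> mesh_edges \<tau>. e \<subseteq> frontier \<Omega>}"


text \<open>The incenter is the point of the triangle having equal distance to the three lines
  that carry its sides.\<close>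

definition incenter :: "plane set \<Rightarrow> plane" where
  "incenter T = (THE p. p \<in> T \<and> (\<exists>r. \<forall>e. e edge_of T \<longrightarrow> infdist p (affine hull e) = r))"

definition singular_vertex :: "plane set \<Rightarrow> plane set set \<Rightarrow> plane set \<Rightarrow> plane \<Rightarrow> bool" where
  "singular_vertex \<Omega> \<tau> e s \<longleftrightarrow>
     (\<exists>T\<in>\<tau>. \<exists>T'\<in>\<tau>. T \<noteq> T' \<and> e edge_of T \<and> e edge_of T' \<and>
        s \<in> e \<inter> closed_segment (incenter T) (incenter T')) \<or>
     (e \<in> exterior_edges \<Omega> \<tau> \<and> (\<exists>a b. e = closed_segment a b \<and> s = midpoint a b))"

text \<open>Each side \<open>e\<close> of \<open>T\<close> with its singular vertex \<open>s\<close> contributes two of the six triangles,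
  one for each endpoint \<open>v\<close> of \<open>e\<close>.\<close>

definition powell_sabin :: "plane set \<Rightarrow> plane set set \<Rightarrow> plane set set" where
  "powell_sabin \<Omega> \<tau> =
     {convex hull {incenter T, v, s} | T e v s.
        T \<in> \<tau> \<and> e edge_of T \<and> v extreme_point_of e \<and> singular_vertex \<Omega> \<tau> e s}"


text \<open>A function on the closure of \<open>\<Omega>\<close> is represented by its extension by zero to the plane, so
  that equality and linear combinations only depend on the values on the closure.\<close>

definition X_h :: "plane set \<Rightarrow> plane set set \<Rightarrow> (plane \<Rightarrow> plane) set" where
  "X_h \<Omega> \<tau> =
     {v. continuous_on (closure \<Omega>) v \<and> (\<forall>x. x \<notin> closure \<Omega> \<longrightarrow> v x = 0) \<and>
         (\<forall>T \<in> powell_sabin \<Omega> \<tau>. \<exists>(A :: real^2^2) b. \<forall>x\<in>T. v x = A *v x + b)}"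

definition X_h0 :: "plane set \<Rightarrow> plane set set \<Rightarrow> (plane \<Rightarrow> plane) set" where
  "X_h0 \<Omega> \<tau> = {v \<in> X_h \<Omega> \<tau>. \<forall>x \<in> frontier \<Omega>. v x = 0}"

text \<open>\<open>\<phi>\<close> is a \<open>C\<^sup>1\<close> function with compact support in \<open>\<Omega>\<close> and gradient \<open>\<phi>'\<close>.\<close>

definition test_function :: "plane set \<Rightarrow> (plane \<Rightarrow> real) \<Rightarrow> (plane \<Rightarrow> plane) \<Rightarrow> bool" where
  "test_function \<Omega> \<phi> \<phi>' \<longleftrightarrow>
     (\<forall>x. GDERIV \<phi> x :> \<phi>' x) \<and> continuous_on UNIV \<phi>' \<and>
     (\<exists>K. compact K \<and> K \<subseteq> \<Omega> \<and> (\<forall>x. x \<notin> K \<longrightarrow> \<phi> x = 0))"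

definition has_weak_divergence :: "plane set \<Rightarrow> (plane \<Rightarrow> plane) \<Rightarrow> (plane \<Rightarrow> real) \<Rightarrow> bool" where
  "has_weak_divergence \<Omega> v g \<longleftrightarrow>
     (\<forall>\<phi> \<phi>'. test_function \<Omega> \<phi> \<phi>' \<longrightarrow>
        (LINT x:\<Omega>|lborel. v x \<bullet> \<phi>' x) = - (LINT x:\<Omega>|lborel. g x * \<phi> x))"

definition V_h :: "plane set \<Rightarrow> plane set set \<Rightarrow> (plane \<Rightarrow> plane) set" where
  "V_h \<Omega> \<tau> = {v \<in> X_h \<Omega> \<tau>. has_weak_divergence \<Omega> v (\<lambda>x. 0)}"

definition V_h0 :: "plane set \<Rightarrow> plane set set \<Rightarrow> (plane \<Rightarrow> plane) set" where
  "V_h0 \<Omega> \<tau> = V_h \<Omega> \<tau> \<inter> X_h0 \<Omega> \<tau>"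

definition V_local :: "plane set \<Rightarrow> plane set set \<Rightarrow> plane \<Rightarrow> (plane \<Rightarrow> plane) set" where
  "V_local \<Omega> \<tau> z =
     {v \<in> V_h \<Omega> \<tau>.
        (\<forall>T\<in>\<tau>. \<not> z extreme_point_of T \<longrightarrow> (\<forall>x\<in>T. v x = 0)) \<and>
        (\<forall>T\<in>\<tau>. z extreme_point_of T \<longrightarrow>
           (\<forall>e. e edge_of T \<and> z \<notin> e \<longrightarrow> (\<forall>x\<in>e. v x = 0)))}"

text \<open>The unit normal of the segment from \<open>z\<close> to \<open>w\<close> in the direction of counter-clockwise
  rotation around \<open>z\<close> is the unit vector from \<open>z\<close> to \<open>w\<close> rotated by a positive right angle.\<close>

definition ccw_normal :: "plane \<Rightarrow> plane \<Rightarrow> plane" where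
  "ccw_normal z w = (1 / norm (w - z)) *\<^sub>R vector [- (w - z) $ 2, (w - z) $ 1]"

definition segment_integral :: "plane \<Rightarrow> plane \<Rightarrow> (plane \<Rightarrow> real) \<Rightarrow> real" where
  "segment_integral a b f = integral {0..1} (\<lambda>t. f (linepath a b t) * norm (b - a))"

definition local_basis_function ::
    "plane set \<Rightarrow> plane set set \<Rightarrow> plane \<Rightarrow> real \<Rightarrow> real \<Rightarrow> real \<Rightarrow> (plane \<Rightarrow> plane) \<Rightarrow> bool" where
  "local_basis_function \<Omega> \<tau> z \<alpha> \<beta> \<delta> \<phi> \<longleftrightarrow>
     \<phi> \<in> V_local \<Omega> \<tau> z \<and> \<phi> z = vector [\<alpha>, \<beta>] \<and>
     (\<forall>w. closed_segment z w \<in> mesh_edges \<tau> \<longrightarrow>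
        segment_integral z w (\<lambda>x. \<phi> x \<bullet> ccw_normal z w) = \<delta>)"

definition is_basis :: "'a::real_vector set \<Rightarrow> 'a set \<Rightarrow> bool" where
  "is_basis B V \<longleftrightarrow> independent B \<and> span B = V"

end

theory Submission
  imports Defs "HOL-Analysis.Kronecker_Approximation_Theorem"
begin

text \<open>
  A field in \<^term>\<open>V_h \<Omega> \<tau>\<close> is determined by its values at the macro-vertices and its fluxes through
  the macro-edges (\<open>V_h_unisolvent\<close>), and the fluxes of the field form a cocycle: they are
  antisymmetric in the endpoints of the edge and cancel around each macro-triangle, because the field
  is divergence free. Everything else is a comparison of these data with those of the local functions.
  At a vertex \<open>z\<^sub>k\<close> the first two functions take the values \<open>(1, 0)\<close> and \<open>(0, 1)\<close> and have no
  flux; all local functions of other vertices vanish there. The third one has flux \<open>1\<close> through each edge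
  leaving \<open>z\<^sub>k\<close>, so that a combination with coefficients \<open>\<psi>(z\<^sub>k)\<close> has flux \<open>\<psi>(a) - \<psi>(b)\<close> from \<open>a\<close> to
  \<open>b\<close>. Spanning therefore amounts to the statement that each cocycle of fluxes has a potential \<open>\<psi>\<close>
  (\<open>real_cocycle_potential\<close>). Linear independence amounts to its uniqueness up to a constant, which holds
  since the graph of edges is connected (\<open>mesh_vertex_induct\<close>). Dropping the third function of \<open>z\<^sub>0\<close>
  fixes the constant.

  For a field that vanishes on the boundary, the values at the exterior vertices are zero and the
  potential is constant along the exterior edges. These edges make up the boundary, which is
  connected (\<open>exterior_vertex_induct\<close>), and \<open>\<psi>(z\<^sub>0) = 0\<close> at the exterior vertex \<open>z\<^sub>0\<close>; so
  only functions of interior vertices occur, and those vanish on the boundary.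

  Unisolvence is local. On each of the six pieces of a macro-triangle the field is affine, and its
  linear part \<open>A\<close> has trace zero, which is shown by testing the weak divergence with a bump function
  (\<open>affine_weakly_solenoidal_imp_tracefree\<close>). A planar matrix has trace zero exactly if the bilinear form
  \<open>(A x) \<bullet> rot y\<close> is symmetric, where \<open>rot\<close> is the rotation by a right angle. This symmetry applied to the
  two pieces along an edge with zero data makes the field vanish at the singular vertex and makes
  its value at the incenter parallel to the edge (\<open>solenoidal_split_edge_zero\<close>). Two edges together make the
  value at the incenter zero.

  The existence of potentials is where the topology of the domain enters. For integer
  cocycles the local affine potentials \<open>p\<^sub>T\<close> differ by integers on common faces, so \<open>exp (2 \<pi> i p\<^sub>T)\<close> is a
  continuous map from the closed domain to the circle. The closed domain does not separate the
  plane, hence the map has a continuous logarithm; divided by \<open>2 \<pi> i\<close> it is the potential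
  (\<open>integral_cocycle_potential\<close>). Real cocycles are reduced to integer ones by simultaneous Diophantine
  approximation: a good enough rounding of a large multiple of a cocycle is again a cocycle.
\<close>

section \<open>Fluxes of affine fields with zero divergence\<close>

definition rot :: "plane \<Rightarrow> plane" where
  "rot w = vector [- (w $ 2), w $ 1]"

lemma rot_nth [simp]: "rot w $ 1 = - (w $ 2)" "rot w $ 2 = w $ 1"
  by (simp_all add: rot_def)

lemma inner_plane: "(u::plane) \<bullet> w = u $ 1 * w $ 1 + u $ 2 * w $ 2"
  by (simp add: inner_vec_def sum_2)

lemma plane_eq_iff: "(u::plane) = w \<longleftrightarrow> u $ 1 = w $ 1 \<and> u $ 2 = w $ 2"
  by (simp add: vec_eq_iff forall_2)

lemma matrix_vector_plane:
  "((A::real^2^2) *v x) $ 1 = A $ 1 $ 1 * x $ 1 + A $ 1 $ 2 * x $ 2"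
  "((A::real^2^2) *v x) $ 2 = A $ 2 $ 1 * x $ 1 + A $ 2 $ 2 * x $ 2"
  by (simp_all add: matrix_vector_mult_def sum_2)

lemmas plane_simps = inner_plane matrix_vector_plane

lemma rot_diff: "rot (u - w) = rot u - rot w"
  and rot_scaleR: "rot (r *\<^sub>R u) = r *\<^sub>R rot u"
  and rot_minus: "rot (- u) = - rot u"
  by (simp_all add: plane_eq_iff rot_def)

lemma norm_rot: "norm (rot u) = norm u"
  by (simp add: norm_eq_sqrt_inner inner_plane add.commute)

text \<open>The algebraic source of all flux identities: the matrix of the form \<open>(A x) \<bullet> rot y\<close> is \<open>A\<close> multiplied by
  a rotation, and the difference of its off-diagonal entries is the trace of \<open>A\<close>.\<close>

lemma tracefree_symmetric:
  fixes A :: "real^2^2"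
  assumes "A $ 1 $ 1 + A $ 2 $ 2 = 0"
  shows "(A *v x) \<bullet> rot y = (A *v y) \<bullet> rot x"
proof -
  have "A $ 2 $ 2 = - A $ 1 $ 1" using assms by simp
  then show ?thesis by (simp add: plane_simps algebra_simps)
qed

lemma orthogonal_to_independent_pair:
  assumes "u \<bullet> rot x = 0" "u \<bullet> rot y = 0" "x \<bullet> rot y \<noteq> 0"
  shows "u = 0"
proof -
  have "(x \<bullet> rot y) * u $ 1 = (u \<bullet> rot y) * x $ 1 - (u \<bullet> rot x) * y $ 1"
       "(x \<bullet> rot y) * u $ 2 = (u \<bullet> rot y) * x $ 2 - (u \<bullet> rot x) * y $ 2"
    by (simp_all add: plane_simps algebra_simps)
  then show ?thesis using assms by (simp add: plane_eq_iff)
qed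

text \<open>On a set with interior, these are the affine fields with divergence zero.\<close>

definition solenoidal_on :: "plane set \<Rightarrow> (plane \<Rightarrow> plane) \<Rightarrow> bool" where
  "solenoidal_on S v \<longleftrightarrow>
     (\<exists>(A :: real^2^2) b. A $ 1 $ 1 + A $ 2 $ 2 = 0 \<and> (\<forall>x\<in>S. v x = A *v x + b))"

text \<open>The trapezoidal rule for the flux through the segment from \<open>p\<close> to \<open>q\<close>; it is exact for a field that
  is affine on the segment, and always linear in the field.\<close>

definition chord_flux :: "(plane \<Rightarrow> plane) \<Rightarrow> plane \<Rightarrow> plane \<Rightarrow> real" where
  "chord_flux v p q = (v p + v q) \<bullet> rot (q - p) / 2"

lemma chord_flux_commute: "chord_flux v q p = - chord_flux v p q"
  by (simp add: chord_flux_def plane_simps field_simps)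

text \<open>The divergence theorem for an affine field on a triangle.\<close>

lemma chord_flux_triangle:
  assumes "solenoidal_on S v" "p \<in> S" "q \<in> S" "r \<in> S"
  shows "chord_flux v p q + chord_flux v q r + chord_flux v r p = 0"
proof -
  obtain A :: "real^2^2" and b where A: "A $ 1 $ 1 + A $ 2 $ 2 = 0" "\<forall>x\<in>S. v x = A *v x + b"
    using assms(1) unfolding solenoidal_on_def by blast
  have "A $ 2 $ 2 = - A $ 1 $ 1" using A(1) by simp
  then show ?thesis
    using A(2) assms(2-4) by (simp add: chord_flux_def plane_simps algebra_simps add_divide_distrib diff_divide_distrib)
qed

text \<open>The flux that the local basis functions are normalized by.\<close>

definition edge_flux :: "(plane \<Rightarrow> plane) \<Rightarrow> plane \<Rightarrow> plane \<Rightarrow> real" where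
  "edge_flux v a b = segment_integral a b (\<lambda>x. v x \<bullet> ccw_normal a b)"

lemma has_integral_linear_function:
  fixes p q l r :: real
  assumes "l \<le> r"
  shows "((\<lambda>t. p + q * t) has_integral ((r - l) * (p + q * ((l + r) / 2)))) {l..r}"
proof -
  have "((\<lambda>t. p + q * t) has_integral ((p * r + q * r\<^sup>2 / 2) - (p * l + q * l\<^sup>2 / 2))) {l..r}"
    by (rule fundamental_theorem_of_calculus[OF assms])
       (auto intro!: derivative_eq_intros simp flip: has_real_derivative_iff_has_vector_derivative)
  moreover have "(p * r + q * r\<^sup>2 / 2) - (p * l + q * l\<^sup>2 / 2) = (r - l) * (p + q * ((l + r) / 2))"
    by (simp add: power2_eq_square algebra_simps add_divide_distrib diff_divide_distrib)
  ultimately show ?thesis by simp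
qed

text \<open>On a macro-edge the field has a kink at the singular vertex \<open>s\<close>, so the trapezoidal rule applies to
  the two halves.\<close>

lemma edge_flux_eq_chord_flux:
  assumes "a \<noteq> b" and s: "s \<in> open_segment a b"
    and v1: "\<And>x. x \<in> closed_segment a s \<Longrightarrow> v x = (A1::real^2^2) *v x + b1"
    and v2: "\<And>x. x \<in> closed_segment s b \<Longrightarrow> v x = (A2::real^2^2) *v x + b2"
  shows "edge_flux v a b = chord_flux v a s + chord_flux v s b"
proof -
  obtain \<theta> where th: "0 < \<theta>" "\<theta> < 1" and s_eq: "s = (1 - \<theta>) *\<^sub>R a + \<theta> *\<^sub>R b"
    using s by (auto simp: in_segment)
  define w where "w = rot (b - a)"
  define g where "g = (\<lambda>t. v (linepath a b t) \<bullet> w)"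
  have n0: "norm (b - a) \<noteq> 0" using assms(1) by simp
  have flux: "edge_flux v a b = integral {0..1} g"
    unfolding edge_flux_def segment_integral_def ccw_normal_def g_def w_def rot_def[symmetric]
    using n0 by (simp add: inner_scaleR_right)
  have seg1: "linepath a b t \<in> closed_segment a s" if "0 \<le> t" "t \<le> \<theta>" for t
  proof -
    have "linepath a b t = (1 - t / \<theta>) *\<^sub>R a + (t / \<theta>) *\<^sub>R s"
      using th by (simp add: linepath_def s_eq plane_eq_iff field_simps)
    then show ?thesis using th that by (auto simp: in_segment intro!: exI[of _ "t / \<theta>"])
  qed
  have seg2: "linepath a b t \<in> closed_segment s b" if "\<theta> \<le> t" "t \<le> 1" for t
  proof -
    define u where "u = (t - \<theta>) / (1 - \<theta>)"
    have "u * (1 - \<theta>) = t - \<theta>" using th by (simp add: u_def)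
    then have t_eq: "t = u + \<theta> - u * \<theta>" by (simp add: algebra_simps)
    have "linepath a b t = (1 - u) *\<^sub>R s + u *\<^sub>R b"
      unfolding t_eq by (simp add: linepath_def s_eq plane_eq_iff algebra_simps)
    then show ?thesis using th that by (auto simp: in_segment u_def intro!: exI[of _ "u"])
  qed
  have g1: "g t = (A1 *v a + b1) \<bullet> w + (A1 *v (b - a)) \<bullet> w * t" if "t \<in> {0..\<theta>}" for t
  proof -
    have "g t = (A1 *v linepath a b t + b1) \<bullet> w"
      using v1[OF seg1[of t]] that by (simp add: g_def)
    then show ?thesis by (simp add: linepath_def plane_simps algebra_simps)
  qed
  have g2: "g t = (A2 *v a + b2) \<bullet> w + (A2 *v (b - a)) \<bullet> w * t" if "t \<in> {\<theta>..1}" for t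
  proof -
    have "g t = (A2 *v linepath a b t + b2) \<bullet> w"
      using v2[OF seg2[of t]] that by (simp add: g_def)
    then show ?thesis by (simp add: linepath_def plane_simps algebra_simps)
  qed
  have va: "v a = A1 *v a + b1" "v s = A1 *v s + b1" "v s = A2 *v s + b2" "v b = A2 *v b + b2"
    by (rule v1 v2, simp)+
  have i1: "(g has_integral chord_flux v a s) {0..\<theta>}"
  proof (rule has_integral_eq_rhs[OF has_integral_eq[OF _ has_integral_linear_function]])
    show "chord_flux v a s = (\<theta> - 0) * ((A1 *v a + b1) \<bullet> w + (A1 *v (b - a)) \<bullet> w * ((0 + \<theta>) / 2))"
      unfolding chord_flux_def va(1) va(2)
      by (simp add: s_eq w_def plane_simps algebra_simps add_divide_distrib diff_divide_distrib)
  qed (use g1 th in auto)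
  have i2: "(g has_integral chord_flux v s b) {\<theta>..1}"
  proof (rule has_integral_eq_rhs[OF has_integral_eq[OF _ has_integral_linear_function]])
    show "chord_flux v s b = (1 - \<theta>) * ((A2 *v a + b2) \<bullet> w + (A2 *v (b - a)) \<bullet> w * ((\<theta> + 1) / 2))"
      unfolding chord_flux_def va(3) va(4)
      by (simp add: s_eq w_def plane_simps algebra_simps add_divide_distrib diff_divide_distrib)
  qed (use g2 th in auto)
  show ?thesis
    unfolding flux by (rule integral_unique, rule has_integral_combine[OF _ _ i1 i2]) (use th in auto)
qed

text \<open>Two pieces of a split triangle that share the half edges at \<open>s\<close>, with the incenter in the
  role of \<open>c\<close>. By the divergence theorem in both pieces the flux through the edge is carried by the
  two spokes at \<open>c\<close>; this form no longer mentions \<open>s\<close>.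

  For the second claim, zero flux leaves \<open>v s\<close> only a tangential part. Each piece computes the
  normal part of \<open>v c\<close> from that tangential part through the symmetry of the trace-free form, and the
  two results have opposite signs since \<open>a\<close> and \<open>b\<close> lie on different sides of \<open>s\<close>. So both parts vanish.\<close>

lemma
  assumes "solenoidal_on (convex hull {c, a, s}) v" "solenoidal_on (convex hull {c, b, s}) v"
    and s: "s \<in> open_segment a b" and "a \<noteq> b"
  shows edge_flux_eq_spoke_flux: "edge_flux v a b = chord_flux v a c - chord_flux v b c"
    and solenoidal_split_edge_zero: "\<lbrakk>v a = 0; v b = 0; edge_flux v a b = 0; (c - a) \<bullet> rot (b - a) \<noteq> 0\<rbrakk>
           \<Longrightarrow> v s = 0 \<and> v c \<bullet> rot (b - a) = 0"
proof -
  obtain A1 :: "real^2^2" and b1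
    where A1: "A1 $ 1 $ 1 + A1 $ 2 $ 2 = 0" "\<And>x. x \<in> convex hull {c, a, s} \<Longrightarrow> v x = A1 *v x + b1"
    using assms(1) unfolding solenoidal_on_def by blast
  obtain A2 :: "real^2^2" and b2
    where A2: "A2 $ 1 $ 1 + A2 $ 2 $ 2 = 0" "\<And>x. x \<in> convex hull {c, b, s} \<Longrightarrow> v x = A2 *v x + b2"
    using assms(2) unfolding solenoidal_on_def by blast
  have sub: "closed_segment a s \<subseteq> convex hull {c, a, s}" "closed_segment s b \<subseteq> convex hull {c, b, s}"
    unfolding segment_convex_hull by (intro hull_mono; simp)+
  have mem: "c \<in> convex hull {c, a, s}" "a \<in> convex hull {c, a, s}" "s \<in> convex hull {c, a, s}"
    "c \<in> convex hull {c, b, s}" "b \<in> convex hull {c, b, s}" "s \<in> convex hull {c, b, s}"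
    by (auto intro: hull_inc)
  have f: "edge_flux v a b = chord_flux v a s + chord_flux v s b"
    by (rule edge_flux_eq_chord_flux[OF \<open>a \<noteq> b\<close> s, of v A1 b1 A2 b2])
       (simp_all add: A1(2)[OF subsetD[OF sub(1)]] A2(2)[OF subsetD[OF sub(2)]])
  show "edge_flux v a b = chord_flux v a c - chord_flux v b c"
    using f chord_flux_triangle[OF assms(1) mem(2,3,1)] chord_flux_triangle[OF assms(2) mem(6,5,4)]
      chord_flux_commute[of v c s] chord_flux_commute[of v c a] by simp
  assume v0: "v a = 0" "v b = 0" and f0: "edge_flux v a b = 0" and nc: "(c - a) \<bullet> rot (b - a) \<noteq> 0"
  obtain \<theta> where th: "0 < \<theta>" "\<theta> < 1" and s_eq: "s = (1 - \<theta>) *\<^sub>R a + \<theta> *\<^sub>R b"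
    using s by (auto simp: in_segment)
  have sa: "s - a = \<theta> *\<^sub>R (b - a)" and sb: "b - s = (1 - \<theta>) *\<^sub>R (b - a)"
    by (simp_all add: s_eq algebra_simps)
  \<comment> \<open>Only the value at \<open>s\<close> contributes to the flux, so its normal component is zero.\<close>
  have normal: "v s \<bullet> rot (b - a) = 0"
  proof -
    have "chord_flux v a s = \<theta> * (v s \<bullet> rot (b - a) / 2)"
      "chord_flux v s b = (1 - \<theta>) * (v s \<bullet> rot (b - a) / 2)"
      unfolding chord_flux_def sa sb v0 rot_scaleR inner_scaleR_right by simp_all
    then have "chord_flux v a s + chord_flux v s b = v s \<bullet> rot (b - a) / 2"
      by (simp only: left_diff_distrib)
    then show ?thesis using f f0 by simp
  qed
  have "v c - v a = A1 *v (c - a)" "v s - v a = A1 *v (s - a)"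
    unfolding A1(2)[OF mem(1)] A1(2)[OF mem(2)] A1(2)[OF mem(3)]
    by (simp_all add: matrix_vector_mult_diff_distrib)
  then have lin1: "v c = A1 *v (c - a)" "v s = A1 *v (s - a)" by (simp_all add: v0)
  have "v c - v b = A2 *v (c - b)" "v s - v b = A2 *v (s - b)"
    unfolding A2(2)[OF mem(4)] A2(2)[OF mem(5)] A2(2)[OF mem(6)]
    by (simp_all add: matrix_vector_mult_diff_distrib)
  then have lin2: "v c = A2 *v (c - b)" "v s = A2 *v (s - b)" by (simp_all add: v0)
  \<comment> \<open>The symmetry in the piece at \<open>a\<close>, where \<open>s - a\<close> is a positive multiple of \<open>b - a\<close>.\<close>
  have e1: "\<theta> * (v c \<bullet> rot (b - a)) = v s \<bullet> rot (c - a)"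
    using tracefree_symmetric[OF A1(1), of "c - a" "s - a"]
    unfolding lin1[symmetric] by (simp add: sa rot_scaleR)
  \<comment> \<open>In the piece at \<open>b\<close>, the vector \<open>s - b\<close> is a negative multiple of \<open>b - a\<close>.\<close>
  have "v c \<bullet> rot (s - b) = v s \<bullet> rot (c - b)"
    unfolding lin2 by (rule tracefree_symmetric[OF A2(1)])
  moreover have "rot (s - b) = - ((1 - \<theta>) *\<^sub>R rot (b - a))" "rot (c - b) = rot (c - a) - rot (b - a)"
    unfolding sb rot_scaleR[symmetric] rot_minus[symmetric] rot_diff[symmetric]
    by (simp_all flip: sb)
  ultimately have e2: "(\<theta> - 1) * (v c \<bullet> rot (b - a)) = v s \<bullet> rot (c - a)"
    using normal by (simp add: inner_diff_right left_diff_distrib)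
  have vc: "v c \<bullet> rot (b - a) = 0" using e1 e2 by (simp add: algebra_simps)
  then have "v s \<bullet> rot (c - a) = 0" using e1 by simp
  then have "v s = 0" using orthogonal_to_independent_pair[OF _ normal nc] by blast
  with vc show "v s = 0 \<and> v c \<bullet> rot (b - a) = 0" by simp
qed

lemma solenoidal_on_hull_zero:
  assumes "solenoidal_on (convex hull S) v" "\<And>x. x \<in> S \<Longrightarrow> v x = 0" "x \<in> convex hull S"
  shows "v x = 0"
proof -
  obtain A :: "real^2^2" and b where A: "\<And>x. x \<in> convex hull S \<Longrightarrow> v x = A *v x + b"
    using assms(1) unfolding solenoidal_on_def by blast
  have "convex {x. A *v x + b = 0}"
  proof (rule convexI, clarify)
    fix x y and u w :: real
    assume "0 \<le> u" "0 \<le> w" and uw: "u + w = 1" and x: "A *v x + b = 0" and y: "A *v y + b = 0"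
    have "A *v (u *\<^sub>R x + w *\<^sub>R y) + b = u *\<^sub>R (A *v x + b) + w *\<^sub>R (A *v y + b)"
      using uw by (simp add: matrix_vector_right_distrib matrix_vector_mult_scaleR scaleR_add_right
          flip: scaleR_left_distrib)
    then show "A *v (u *\<^sub>R x + w *\<^sub>R y) + b = 0" by (simp add: x y)
  qed
  moreover have "S \<subseteq> {x. A *v x + b = 0}" 
  proof
    fix y assume "y \<in> S"
    then show "y \<in> {x. A *v x + b = 0}" using A[OF hull_inc] assms(2) by fastforce
  qed
  ultimately have "convex hull S \<subseteq> {x. A *v x + b = 0}" by (rule hull_minimal[rotated])
  then show ?thesis using A assms(3) by auto
qed

section \<open>Triangles and their incenters\<close>

text \<open>Twice the signed area of the triangle, positive for counter-clockwise order.\<close>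

definition area2 :: "plane \<Rightarrow> plane \<Rightarrow> plane \<Rightarrow> real" where
  "area2 a b c = (c - a) \<bullet> rot (b - a)"

lemma area2_rotate: "area2 b c a = area2 a b c"
  and area2_swap: "area2 b a c = - area2 a b c"
  by (simp_all add: area2_def plane_simps algebra_simps)

text \<open>Barycentric coordinates are ratios of signed areas.\<close>

lemma area2_convex_combination:
  assumes "u + v + w = 1"
  shows "area2 a b (u *\<^sub>R a + v *\<^sub>R b + w *\<^sub>R c) = w * area2 a b c"
proof -
  have "u = 1 - v - w" using assms by simp
  then show ?thesis by (simp only: area2_def plane_simps) (simp add: algebra_simps)
qed

lemma area2_eq_0_iff_on_line:
  assumes "a \<noteq> b"
  shows "area2 a b x = 0 \<longleftrightarrow> (\<exists>t. x = (1 - t) *\<^sub>R a + t *\<^sub>R b)"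
proof
  assume 0: "area2 a b x = 0"
  define d where "d = b - a"
  define t where "t = ((x - a) \<bullet> d) / (d \<bullet> d)"
  have "d \<bullet> d \<noteq> 0" using assms by (simp add: d_def)
  have "(d \<bullet> d) *\<^sub>R (x - a) = ((x - a) \<bullet> d) *\<^sub>R d + ((x - a) \<bullet> rot d) *\<^sub>R rot d"
    by (simp add: plane_eq_iff plane_simps algebra_simps)
  also have "(x - a) \<bullet> rot d = 0" using 0 by (simp add: area2_def d_def)
  finally have "x - a = t *\<^sub>R d"
    unfolding t_def using \<open>d \<bullet> d \<noteq> 0\<close>
    by (simp add: divide_inverse_commute flip: scaleR_scaleR)
       (metis \<open>d \<bullet> d \<noteq> 0\<close> inverse_eq_divide scaleR_one scaleR_scaleR left_inverse)
  then have "x = (1 - t) *\<^sub>R a + t *\<^sub>R b"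
    by (simp add: d_def algebra_simps) 
  then show "\<exists>t. x = (1 - t) *\<^sub>R a + t *\<^sub>R b" by blast
next
  assume "\<exists>t. x = (1 - t) *\<^sub>R a + t *\<^sub>R b"
  then show "area2 a b x = 0"
    using area2_convex_combination[of _ _ 0 a b 0] by (metis add.right_neutral diff_add_cancel mult_zero_left scaleR_zero_left)
qed

text \<open>The vertices are listed in either orientation, so that an edge shared by two triangles can be
  listed in the same order in both.\<close>

definition is_triangle :: "plane set \<Rightarrow> plane \<Rightarrow> plane \<Rightarrow> plane \<Rightarrow> bool" where
  "is_triangle T a b c \<longleftrightarrow> area2 a b c \<noteq> 0 \<and> T = convex hull {a, b, c}"

lemma is_triangle_distinct: "is_triangle T a b c \<Longrightarrow> a \<noteq> b \<and> b \<noteq> c \<and> c \<noteq> a"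
proof -
  have "area2 x x y = 0" "area2 x y y = 0" "area2 x y x = 0" for x y
    by (simp_all add: area2_def plane_simps algebra_simps)
  then show "is_triangle T a b c \<Longrightarrow> a \<noteq> b \<and> b \<noteq> c \<and> c \<noteq> a"
    unfolding is_triangle_def by metis
qed

lemma is_triangle_rotate: "is_triangle T a b c \<Longrightarrow> is_triangle T b c a"
  and is_triangle_swap: "is_triangle T a b c \<Longrightarrow> is_triangle T b a c"
  unfolding is_triangle_def using area2_rotate[of b c a] area2_swap[of b a c]
  by (simp_all add: insert_commute)

lemma two_simplex_is_triangle:
  assumes "2 simplex (T :: plane set)"
  obtains a b c where "is_triangle T a b c"
proof -
  obtain C where C: "\<not> affine_dependent C" "int (card C) = 2 + 1" "T = convex hull C"
    using assms by (auto simp: simplex_def)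
  then have "card C = 3" by simp
  then obtain a b c where abc: "C = {a, b, c}" "a \<noteq> b" "a \<noteq> c" "b \<noteq> c"
    by (auto simp: card_3_iff)
  have nc: "\<not> collinear {a, b, c}"
    using C(1) abc by (simp add: collinear_3_eq_affine_dependent)
  have "area2 a b c \<noteq> 0"
  proof
    assume "area2 a b c = 0"
    then obtain t where "c = (1 - t) *\<^sub>R a + t *\<^sub>R b"
      using area2_eq_0_iff_on_line abc by blast
    then have "c \<in> affine hull {a, b}"
      unfolding affine_hull_2 by (intro CollectI exI[of _ "1 - t"] exI[of _ t]) simp
    then have "collinear {a, b, c}"
      by (metis collinear_3_affine_hull abc(2) insert_commute)
    with nc show False by simp
  qed
  then show thesis using that C abc by (auto simp: is_triangle_def)
qed

lemma is_triangle_affine_independent: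
  assumes "is_triangle T a b c"
  shows "\<not> affine_dependent {a, b, c}"
proof
  assume "affine_dependent {a, b, c}"
  then have "collinear {a, b, c}" by (simp add: collinear_3_eq_affine_dependent)
  then have "c \<in> affine hull {a, b}"
    using collinear_3_affine_hull is_triangle_distinct[OF assms] by metis
  then obtain u v where "c = u *\<^sub>R a + v *\<^sub>R b" "u + v = 1" by (auto simp: affine_hull_2)
  then have "c = (1 - v) *\<^sub>R a + v *\<^sub>R b" by (simp add: eq_diff_eq[symmetric])
  then have "area2 a b c = 0" using area2_eq_0_iff_on_line is_triangle_distinct[OF assms] by metis
  then show False using assms by (simp add: is_triangle_def)
qed

lemma is_triangle_vertex_iff:
  "is_triangle T a b c \<Longrightarrow> x extreme_point_of T \<longleftrightarrow> x \<in> {a, b, c}"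
  using extreme_point_of_convex_hull_affine_independent[OF is_triangle_affine_independent]
  by (simp add: is_triangle_def)

lemma is_triangle_edge_iff:
  assumes T: "is_triangle T a b c"
  shows "e edge_of T \<longleftrightarrow> e \<in> {closed_segment a b, closed_segment b c, closed_segment c a}"
proof
  assume "e edge_of T"
  then have e: "e face_of convex hull {a, b, c}" "aff_dim e = 1"
    using T by (auto simp: edge_of_def is_triangle_def)
  then obtain C where C: "C \<subseteq> {a, b, c}" "e = convex hull C"
    using face_of_convex_hull_affine_independent[OF is_triangle_affine_independent[OF T]] by auto
  have "\<not> affine_dependent C"
    using C is_triangle_affine_independent[OF T] affine_independent_subset by blast
  then have "int (card C) = 2"
    using aff_dim_affine_independent[of C] e(2) unfolding C(2) aff_dim_convex_hull by simp
  then have c2: "card C = 2" by simp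
  then obtain x y where "C = {x, y}" "x \<noteq> y" by (auto simp: card_2_iff)
  then show "e \<in> {closed_segment a b, closed_segment b c, closed_segment c a}"
    using C by (auto simp: segment_convex_hull insert_commute)
next
  have f: "closed_segment x y edge_of T" if "{x, y} \<subseteq> {a, b, c}" "x \<noteq> y" for x y
  proof -
    have "closed_segment x y face_of T"
      using face_of_convex_hull_affine_independent[OF is_triangle_affine_independent[OF T]] T that(1)
      unfolding is_triangle_def segment_convex_hull by blast
    moreover have "aff_dim (closed_segment x y) = 1"
      using that(2) unfolding segment_convex_hull aff_dim_convex_hull by simp
    ultimately show ?thesis by (simp add: edge_of_def)
  qed
  assume "e \<in> {closed_segment a b, closed_segment b c, closed_segment c a}"
  then show "e edge_of T" using is_triangle_distinct[OF T] f by auto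
qed

lemma is_triangle_barycentric:
  assumes "is_triangle T a b c"
  shows "x \<in> T \<longleftrightarrow> (\<exists>u v w. 0 \<le> u \<and> 0 \<le> v \<and> 0 \<le> w \<and> u + v + w = 1 \<and>
            x = u *\<^sub>R a + v *\<^sub>R b + w *\<^sub>R c)"
  using assms by (auto simp: is_triangle_def convex_hull_3)

lemma convex_hull_3_I:
  "\<lbrakk>x = u *\<^sub>R a + v *\<^sub>R b + w *\<^sub>R c; u + v + w = 1; 0 \<le> u; 0 \<le> v; 0 \<le> w\<rbrakk> \<Longrightarrow> x \<in> convex hull {a, b, c}"
  unfolding convex_hull_3 by blast

lemma infdist_line:
  assumes "a \<noteq> b"
  shows "infdist p (affine hull {a, b}) = \<bar>area2 a b p\<bar> / norm (b - a)"
proof -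
  define d where "d = b - a"
  have d: "norm d > 0" "d \<bullet> d = (norm d)\<^sup>2" using assms by (simp_all add: d_def power2_norm_eq_inner)
  have lb: "\<bar>area2 a b p\<bar> / norm d \<le> dist p y" if y: "y \<in> affine hull {a, b}" for y
  proof -
    obtain u v where y_eq: "y = u *\<^sub>R a + v *\<^sub>R b" and "u + v = 1"
      using y unfolding affine_hull_2 by blast
    then have u_eq: "u = 1 - v" by simp
    have "area2 a b p = (p - y) \<bullet> rot d"
      unfolding y_eq u_eq by (simp add: area2_def d_def plane_simps algebra_simps)
    then have "\<bar>area2 a b p\<bar> \<le> norm (p - y) * norm d"
      using Cauchy_Schwarz_ineq2[of "p - y" "rot d"] by (simp add: norm_rot)
    then show ?thesis using d by (simp add: dist_norm divide_le_eq)
  qed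
  define t where "t = ((p - a) \<bullet> d) / (d \<bullet> d)"
  define f where "f = a + t *\<^sub>R d"
  have fl: "f \<in> affine hull {a, b}"
    unfolding affine_hull_2 f_def d_def
    by (intro CollectI exI[of _ "1 - t"] exI[of _ t]) (simp add: algebra_simps)
  have "(d \<bullet> d) *\<^sub>R (p - a) = ((p - a) \<bullet> d) *\<^sub>R d + ((p - a) \<bullet> rot d) *\<^sub>R rot d"
    by (simp add: plane_eq_iff plane_simps algebra_simps)
  moreover have "((p - a) \<bullet> d) = t * (d \<bullet> d)" using d by (simp add: t_def)
  ultimately have "(d \<bullet> d) *\<^sub>R (p - f) = area2 a b p *\<^sub>R rot d"
    by (simp add: f_def algebra_simps area2_def d_def[symmetric])
  then have "norm ((d \<bullet> d) *\<^sub>R (p - f)) = norm (area2 a b p *\<^sub>R rot d)" by simp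
  then have "norm d * (norm d * dist p f) = norm d * \<bar>area2 a b p\<bar>"
    unfolding norm_scaleR norm_rot d(2) dist_norm by (simp add: power2_eq_square)
  then have "dist p f = \<bar>area2 a b p\<bar> / norm d"
    using d by (simp add: field_simps)
  then have "infdist p (affine hull {a, b}) \<le> \<bar>area2 a b p\<bar> / norm d"
    using infdist_le[OF fl, of p] by simp
  moreover have "\<bar>area2 a b p\<bar> / norm d \<le> infdist p (affine hull {a, b})"
    using lb fl by (auto simp: infdist_def intro!: cINF_greatest)
  ultimately show ?thesis by (simp add: d_def)
qed

lemma is_triangle_edge_distances:
  assumes T: "is_triangle T a b c" and uvw: "0 \<le> u" "0 \<le> v" "0 \<le> w" "u + v + w = 1"
    and p: "p = u *\<^sub>R a + v *\<^sub>R b + w *\<^sub>R c"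
  shows "infdist p (affine hull closed_segment b c) = u * \<bar>area2 a b c\<bar> / norm (c - b)"
    "infdist p (affine hull closed_segment c a) = v * \<bar>area2 a b c\<bar> / norm (a - c)"
    "infdist p (affine hull closed_segment a b) = w * \<bar>area2 a b c\<bar> / norm (b - a)"
proof -
  note d = is_triangle_distinct[OF T]
  have e: "affine hull closed_segment x y = affine hull {x, y}" for x y :: plane
    by (simp add: segment_convex_hull)
  have p': "p = v *\<^sub>R b + w *\<^sub>R c + u *\<^sub>R a" "p = w *\<^sub>R c + u *\<^sub>R a + v *\<^sub>R b"
    by (simp_all add: p algebra_simps)
  have "area2 a b p = w * area2 a b c"
    unfolding p by (rule area2_convex_combination) (use uvw in simp)
  moreover have "area2 b c p = u * area2 b c a"
    unfolding p' by (rule area2_convex_combination) (use uvw in simp)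
  moreover have "area2 c a p = v * area2 c a b"
    unfolding p'(2) by (rule area2_convex_combination) (use uvw in simp)
  ultimately show "infdist p (affine hull closed_segment b c) = u * \<bar>area2 a b c\<bar> / norm (c - b)"
    "infdist p (affine hull closed_segment c a) = v * \<bar>area2 a b c\<bar> / norm (a - c)"
    "infdist p (affine hull closed_segment a b) = w * \<bar>area2 a b c\<bar> / norm (b - a)"
    using d uvw area2_rotate[of c a b] area2_rotate[of a b c] by (simp_all add: e infdist_line abs_mult)
qed

text \<open>The distance to a side is the barycentric coordinate of the opposite vertex times the doubled
  area divided by the length of the side. Equal distances thus mean coordinates proportional to the
  lengths of the opposite sides, which proves existence and uniqueness at once.\<close>

lemma incenter_barycentric:
  assumes T: "is_triangle T a b c"
  obtains u v w where "0 < u" "0 < v" "0 < w" "u + v + w = 1"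
    "incenter T = u *\<^sub>R a + v *\<^sub>R b + w *\<^sub>R c"
    "u * norm (b - a) = w * norm (c - b)" "v * norm (b - a) = w * norm (c - a)"
proof -
  define la lb lc where "la = norm (c - b)" and "lb = norm (a - c)" and "lc = norm (b - a)"
  have l: "la > 0" "lb > 0" "lc > 0"
    using is_triangle_distinct[OF T] by (auto simp: la_def lb_def lc_def)
  define P where "P = la + lb + lc"
  have P: "P > 0" using l by (simp add: P_def)
  define u v w where "u = la / P" and "v = lb / P" and "w = lc / P"
  have uvw: "0 < u" "0 < v" "0 < w" "u + v + w = 1"
    using l P by (simp_all add: u_def v_def w_def flip: add_divide_distrib) (simp add: P_def)
  define I where "I = u *\<^sub>R a + v *\<^sub>R b + w *\<^sub>R c"
  have D: "\<bar>area2 a b c\<bar> > 0" using T by (simp add: is_triangle_def)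
  have "incenter T = I"
    unfolding incenter_def
  proof (rule the_equality)
    have "infdist I (affine hull e) = \<bar>area2 a b c\<bar> / P" if "e edge_of T" for e
    proof -
      note * = is_triangle_edge_distances[OF T _ _ _ uvw(4) I_def]
      have "infdist I (affine hull closed_segment b c) = \<bar>area2 a b c\<bar> / P"
        "infdist I (affine hull closed_segment c a) = \<bar>area2 a b c\<bar> / P"
        "infdist I (affine hull closed_segment a b) = \<bar>area2 a b c\<bar> / P"
        using * uvw l P by (simp_all add: u_def v_def w_def la_def[symmetric] lb_def[symmetric] lc_def[symmetric])
      then show ?thesis using that is_triangle_edge_iff[OF T] by auto
    qed
    moreover have "I \<in> T" unfolding is_triangle_barycentric[OF T] using uvw I_def by (blast intro: less_imp_le)
    ultimately show "I \<in> T \<and> (\<exists>r. \<forall>e. e edge_of T \<longrightarrow> infdist I (affine hull e) = r)" by blast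
  next
    fix p assume p: "p \<in> T \<and> (\<exists>r. \<forall>e. e edge_of T \<longrightarrow> infdist p (affine hull e) = r)"
    then obtain u' v' w' where b: "0 \<le> u'" "0 \<le> v'" "0 \<le> w'" "u' + v' + w' = 1"
      "p = u' *\<^sub>R a + v' *\<^sub>R b + w' *\<^sub>R c" using is_triangle_barycentric[OF T] by auto
    from p obtain r where r: "\<And>e. e edge_of T \<Longrightarrow> infdist p (affine hull e) = r" by blast
    note * = is_triangle_edge_distances[OF T b, folded la_def lb_def lc_def]
    have "u' * \<bar>area2 a b c\<bar> / la = r" "v' * \<bar>area2 a b c\<bar> / lb = r" "w' * \<bar>area2 a b c\<bar> / lc = r"
      unfolding *[symmetric] by (rule r, simp add: is_triangle_edge_iff[OF T])+
    then have uvw': "u' = r / \<bar>area2 a b c\<bar> * la" "v' = r / \<bar>area2 a b c\<bar> * lb" "w' = r / \<bar>area2 a b c\<bar> * lc"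
      using D l by (auto simp: field_simps)
    with b(4) have "r / \<bar>area2 a b c\<bar> * P = 1" by (simp add: P_def distrib_left)
    then have "r / \<bar>area2 a b c\<bar> = 1 / P" using P by (metis less_irrefl nonzero_eq_divide_eq)
    then show "p = I" unfolding b(5) I_def uvw' u_def v_def w_def by simp
  qed
  moreover have "u * norm (b - a) = w * norm (c - b)" "v * norm (b - a) = w * norm (c - a)"
    by (simp_all add: u_def v_def w_def la_def lb_def lc_def norm_minus_commute)
  ultimately show thesis using that uvw I_def by blast
qed

lemma strict_Cauchy_Schwarz_triangle:
  assumes "area2 a b c \<noteq> 0"
  shows "norm (c - a) * norm (b - a) + (c - a) \<bullet> (b - a) > 0"
proof -
  define x y where "x = c - a" and "y = b - a"
  have "(norm x * norm y)\<^sup>2 = (x \<bullet> y)\<^sup>2 + (x \<bullet> rot y)\<^sup>2"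
    unfolding power_mult_distrib power2_norm_eq_inner by (simp add: plane_simps power2_eq_square algebra_simps)
  moreover have "x \<bullet> rot y \<noteq> 0" using assms by (simp add: area2_def x_def y_def)
  ultimately have "\<bar>x \<bullet> y\<bar> < norm x * norm y"
    by (metis abs_norm_cancel abs_mult less_add_same_cancel1 power2_abs power_less_imp_less_base
        abs_ge_zero zero_less_power2)
  then show ?thesis by (simp add: x_def y_def)
qed

text \<open>The angle at \<open>a\<close> between the edge and the direction to the incenter is half of the angle of the
  triangle, hence acute. Algebraically this is the strict Cauchy-Schwarz inequality for the sides at
  \<open>a\<close>. Together with the same fact at \<open>b\<close>, the foot of the incenter on the edge lies strictly between
  \<open>a\<close> and \<open>b\<close>.\<close>

lemma incenter_foot_inside:
  assumes T: "is_triangle T a b c"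
  shows "(incenter T - a) \<bullet> (b - a) > 0" 
proof -
  obtain u v w where i: "0 < u" "0 < v" "0 < w" "u + v + w = 1"
    "incenter T = u *\<^sub>R a + v *\<^sub>R b + w *\<^sub>R c"
    "v * norm (b - a) = w * norm (c - a)" using incenter_barycentric[OF T] by metis
  have "u = 1 - v - w" using i by simp
  then have "incenter T - a = v *\<^sub>R (b - a) + w *\<^sub>R (c - a)"
    unfolding i(5) \<open>u = 1 - v - w\<close> by (simp add: plane_eq_iff algebra_simps)
  then have "(incenter T - a) \<bullet> (b - a) = v * (norm (b - a))\<^sup>2 + w * ((c - a) \<bullet> (b - a))"
    by (simp add: inner_add_left power2_norm_eq_inner)
  also have "v * (norm (b - a))\<^sup>2 = w * (norm (c - a) * norm (b - a))"
    using i(6) by (simp add: power2_eq_square)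
  finally have "(incenter T - a) \<bullet> (b - a) = w * (norm (c - a) * norm (b - a) + (c - a) \<bullet> (b - a))"
    by (simp add: algebra_simps)
  then show ?thesis using strict_Cauchy_Schwarz_triangle T i by (simp add: is_triangle_def)
qed

lemma incenter_side:
  assumes T: "is_triangle T a b c"
  obtains r where "r > 0" "area2 a b (incenter T) = r * area2 a b c"
  using incenter_barycentric[OF T] area2_convex_combination by metis

text \<open>The point where the segment of the incenters crosses the line \<open>a b\<close> is a convex combination of the
  incenters, so its position on the line is a convex combination of the feet of the incenters, and
  those lie strictly inside the edge.\<close>

lemma incenter_segment_crosses_edge:
  assumes T: "is_triangle T a b c" and T': "is_triangle T' a b c'"
    and opp: "area2 a b c * area2 a b c' < 0"
  obtains s where "s \<in> open_segment a b" "s \<in> closed_segment (incenter T) (incenter T')"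
proof -
  define p q where "p = incenter T" and "q = incenter T'"
  define \<alpha> \<beta> where "\<alpha> = area2 a b p" and "\<beta> = area2 a b q"
  obtain r r' where "r > 0" "\<alpha> = r * area2 a b c" "r' > 0" "\<beta> = r' * area2 a b c'"
    using incenter_side[OF T] incenter_side[OF T'] unfolding \<alpha>_def \<beta>_def p_def q_def by metis
  then have ab: "\<alpha> * \<beta> < 0" using opp by (metis mult.commute mult.left_commute mult_pos_neg)
  \<comment> \<open>The parameter at which the signed distance to the line \<open>a b\<close> changes sign.\<close>
  define t where "t = \<alpha> / (\<alpha> - \<beta>)"
  have t: "0 < t" "t < 1" and ne: "\<alpha> - \<beta> \<noteq> 0"
    using ab by (auto simp: t_def mult_less_0_iff field_simps)
  define s where "s = (1 - t) *\<^sub>R p + t *\<^sub>R q"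
  have "area2 a b s = (1 - t) * \<alpha> + t * \<beta>"
    by (simp add: area2_def s_def \<alpha>_def \<beta>_def plane_simps algebra_simps)
  also have "\<dots> = \<alpha> - t * (\<alpha> - \<beta>)" by (simp add: algebra_simps)
  also have "\<dots> = 0" using ne by (simp add: t_def)
  finally obtain \<theta> where th: "s = (1 - \<theta>) *\<^sub>R a + \<theta> *\<^sub>R b"
    using area2_eq_0_iff_on_line is_triangle_distinct[OF T] by metis
  have ne_ab: "(b - a) \<bullet> (b - a) > 0" using is_triangle_distinct[OF T] by auto
  have "(s - a) \<bullet> (b - a) = (1 - t) * ((p - a) \<bullet> (b - a)) + t * ((q - a) \<bullet> (b - a))"
    by (simp add: s_def plane_simps algebra_simps)
  also have "\<dots> > 0"
    using incenter_foot_inside[OF T] incenter_foot_inside[OF T'] t by (simp add: p_def q_def add_pos_pos)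
  also have "s - a = \<theta> *\<^sub>R (b - a)" by (simp add: th algebra_simps)
  finally have "\<theta> > 0" using ne_ab by (simp add: zero_less_mult_iff)
  have "(s - b) \<bullet> (a - b) = (1 - t) * ((p - b) \<bullet> (a - b)) + t * ((q - b) \<bullet> (a - b))"
    by (simp add: s_def plane_simps algebra_simps)
  also have "\<dots> > 0"
    using incenter_foot_inside[OF is_triangle_swap[OF T]] incenter_foot_inside[OF is_triangle_swap[OF T']] t 
    by (simp add: p_def q_def add_pos_pos)
  also have "s - b = (1 - \<theta>) *\<^sub>R (a - b)" by (simp add: th algebra_simps)
  also have "((1 - \<theta>) *\<^sub>R (a - b)) \<bullet> (a - b) = (1 - \<theta>) * ((b - a) \<bullet> (b - a))"
    by (simp add: plane_simps algebra_simps)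
  finally have "\<theta> < 1" using ne_ab by (simp add: zero_less_mult_iff)
  have "s \<in> open_segment a b"
    using \<open>\<theta> > 0\<close> \<open>\<theta> < 1\<close> th is_triangle_distinct[OF T] by (auto simp: in_segment)
  moreover have "s \<in> closed_segment p q" using t by (auto simp: in_segment s_def intro!: exI[of _ t])
  ultimately show thesis using that by (simp add: p_def q_def)
qed

text \<open>A point slightly off the midpoint of \<open>a b\<close> in the direction of \<open>c\<close> belongs to both triangles.\<close>

lemma same_side_triangles_overlap:
  assumes T: "is_triangle T a b c" and T': "is_triangle T' a b c'"
    and same: "area2 a b c * area2 a b c' > 0"
  shows "\<exists>x \<in> T \<inter> T'. area2 a b x \<noteq> 0"
proof -
  define w where "w = area2 a b c / area2 a b c'"
  have w: "w > 0" "area2 a b c = w * area2 a b c'"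
    using same by (auto simp: w_def zero_less_mult_iff zero_less_divide_iff)
  have "area2 a b (c - w *\<^sub>R (c' - a)) = 0"
    using w(2) by (simp add: area2_def plane_simps algebra_simps)
  then obtain y where y: "c - w *\<^sub>R (c' - a) = (1 - y) *\<^sub>R a + y *\<^sub>R b"
    using area2_eq_0_iff_on_line is_triangle_distinct[OF T] by metis
  then have c_eq: "c = (1 - y - w) *\<^sub>R a + y *\<^sub>R b + w *\<^sub>R c'"
    by (simp add: algebra_simps diff_eq_eq)
  define M where "M = 1 + \<bar>y\<bar> + \<bar>1 - y - w\<bar>"
  \<comment> \<open>With this choice the correction of the coordinates \<open>(1 - \<epsilon>) / 2\<close> is at most a quarter.\<close>
  define \<epsilon> where "\<epsilon> = 1 / (4 * M)"
  have M: "M \<ge> 1" "\<bar>y\<bar> \<le> M" "\<bar>1 - y - w\<bar> \<le> M" by (simp_all add: M_def)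
  have eps: "\<epsilon> > 0" "\<epsilon> \<le> 1 / 4" using M by (auto simp: \<epsilon>_def field_simps)
  have eM: "\<epsilon> * M = 1 / 4" using M by (simp add: \<epsilon>_def)
  have small: "\<bar>\<epsilon> * y\<bar> \<le> 1 / 4" "\<bar>\<epsilon> * (1 - y - w)\<bar> \<le> 1 / 4"
    using mult_left_mono[OF M(2), of \<epsilon>] mult_left_mono[OF M(3), of \<epsilon>] eps eM by (simp_all add: abs_mult)
  define x where "x = ((1 - \<epsilon>) / 2) *\<^sub>R a + ((1 - \<epsilon>) / 2) *\<^sub>R b + \<epsilon> *\<^sub>R c"
  have x': "x = ((1 - \<epsilon>) / 2 + \<epsilon> * (1 - y - w)) *\<^sub>R a + ((1 - \<epsilon>) / 2 + \<epsilon> * y) *\<^sub>R b + (\<epsilon> * w) *\<^sub>R c'"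
    unfolding x_def c_eq by (simp add: algebra_simps)
  have half: "0 \<le> (1 - e) / 2 + k" if "- k \<le> 1 / 4" "e \<le> 1 / 4" for e k :: real
    using that by (simp add: field_simps)
  have "x \<in> T"
    unfolding is_triangle_barycentric[OF T] x_def using eps by (intro exI conjI; simp)
  moreover have "x \<in> T'"
    unfolding is_triangle_barycentric[OF T']
  proof (intro exI conjI)
    show "x = ((1 - \<epsilon>) / 2 + \<epsilon> * (1 - y - w)) *\<^sub>R a + ((1 - \<epsilon>) / 2 + \<epsilon> * y) *\<^sub>R b + (\<epsilon> * w) *\<^sub>R c'"
      by (rule x')
    show "0 \<le> (1 - \<epsilon>) / 2 + \<epsilon> * (1 - y - w)"
      using abs_le_D2[OF small(2)] eps(2) by (rule half)
    show "0 \<le> (1 - \<epsilon>) / 2 + \<epsilon> * y"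
      using abs_le_D2[OF small(1)] eps(2) by (rule half)
    show "0 \<le> \<epsilon> * w" using eps w by simp
    show "(1 - \<epsilon>) / 2 + \<epsilon> * (1 - y - w) + ((1 - \<epsilon>) / 2 + \<epsilon> * y) + \<epsilon> * w = 1"
      by (simp add: field_simps)
  qed
  moreover have "area2 a b x = \<epsilon> * area2 a b c"
    unfolding x_def by (rule area2_convex_combination) simp
  moreover have "\<epsilon> * area2 a b c \<noteq> 0" using eps T by (simp add: is_triangle_def)
  ultimately show ?thesis by (intro bexI[of _ x]) auto
qed

lemma triangle_split_at_incenter:
  assumes T: "is_triangle T a b c" and x: "x \<in> T"
  shows "x \<in> convex hull {incenter T, a, b} \<or> x \<in> convex hull {incenter T, b, c} \<or>
         x \<in> convex hull {incenter T, c, a}"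
proof -
  \<comment> \<open>Subtract from \<open>x\<close> as large a multiple of \<open>p\<close> as the coordinates allow; the coordinate with the
    smallest ratio then becomes zero.\<close>
  have *: "x \<in> convex hull {p, a, b}"
    if "0 < i" "0 < j" "0 < k" "i + j + k = 1" "p = i *\<^sub>R a + j *\<^sub>R b + k *\<^sub>R c"
       "0 \<le> w" "u + v + w = 1" "x = u *\<^sub>R a + v *\<^sub>R b + w *\<^sub>R c" 
       "w / k \<le> u / i" "w / k \<le> v / j" for p a b c x :: plane and i j k u v w :: real
  proof -
    define m where "m = w / k"
    have "m * k = w" using that by (simp add: m_def)
    then have "x = m *\<^sub>R p + (u - m * i) *\<^sub>R a + (v - m * j) *\<^sub>R b"
      by (simp add: that(5,8) algebra_simps)
    moreover have "m + (u - m * i) + (v - m * j) = 1 - m * (i + j + k - 1)"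
      using \<open>m * k = w\<close> that(7) by (simp add: algebra_simps)
    moreover have "0 \<le> m" "0 \<le> u - m * i" "0 \<le> v - m * j"
      using that by (simp_all add: m_def field_simps)
    ultimately show ?thesis using that(4) by (auto intro: convex_hull_3_I)
  qed
  obtain i j k where i: "0 < i" "0 < j" "0 < k" "i + j + k = 1" "incenter T = i *\<^sub>R a + j *\<^sub>R b + k *\<^sub>R c"
    using incenter_barycentric[OF T] by metis
  obtain u v w where u: "0 \<le> u" "0 \<le> v" "0 \<le> w" "u + v + w = 1" "x = u *\<^sub>R a + v *\<^sub>R b + w *\<^sub>R c"
    using x is_triangle_barycentric[OF T] by auto
  consider "w / k \<le> u / i" "w / k \<le> v / j" | "u / i \<le> v / j" "u / i \<le> w / k" | "v / j \<le> w / k" "v / j \<le> u / i"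
    by linarith
  then show ?thesis
  proof cases
    case 1 then show ?thesis using *[OF i u(3,4,5)] by blast
  next
    case 2 then show ?thesis
      using *[of j k i "incenter T" b c a u v w x] i u by (simp add: algebra_simps)
  next
    case 3 then show ?thesis
      using *[of k i j "incenter T" c a b v w u x] i u by (simp add: algebra_simps)
  qed
qed

lemma triangle_split_at_edge_point:
  fixes a b c s x :: plane
  assumes s: "s \<in> open_segment a b" and x: "x \<in> convex hull {c, a, b}"
  shows "x \<in> convex hull {c, a, s} \<or> x \<in> convex hull {c, b, s}"
proof -
  obtain \<theta> where th: "0 < \<theta>" "\<theta> < 1" and s_eq: "s = (1 - \<theta>) *\<^sub>R a + \<theta> *\<^sub>R b"
    using s by (auto simp: in_segment)
  obtain m p q where m: "0 \<le> m" "0 \<le> p" "0 \<le> q" "m + p + q = 1" and x: "x = m *\<^sub>R c + p *\<^sub>R a + q *\<^sub>R b"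
    using x by (auto simp: convex_hull_3)
  consider "q / \<theta> \<le> p / (1 - \<theta>)" | "p / (1 - \<theta>) \<le> q / \<theta>" by linarith
  then show ?thesis
  proof cases
    case 1
    define k where "k = q / \<theta>"
    have q: "q = k * \<theta>" using th by (simp add: k_def)
    have "x = m *\<^sub>R c + (p - k * (1 - \<theta>)) *\<^sub>R a + k *\<^sub>R s"
      by (simp add: x s_eq q algebra_simps)
    moreover have "0 \<le> k" "0 \<le> p - k * (1 - \<theta>)" using 1 th m by (simp_all add: k_def field_simps)
    moreover have "m + (p - k * (1 - \<theta>)) + k = 1" using m(4) q by (simp add: algebra_simps)
    ultimately show ?thesis using m by (auto intro: convex_hull_3_I)
  next
    case 2
    define k where "k = p / (1 - \<theta>)"
    have p: "p = k * (1 - \<theta>)" using th by (simp add: k_def)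
    have "x = m *\<^sub>R c + (q - k * \<theta>) *\<^sub>R b + k *\<^sub>R s"
      by (simp add: x s_eq p algebra_simps)
    moreover have "0 \<le> k" "0 \<le> q - k * \<theta>" using 2 th m by (simp_all add: k_def field_simps)
    moreover have "m + (q - k * \<theta>) + k = 1" using m(4) p by (simp add: algebra_simps)
    ultimately show ?thesis using m by (auto intro: convex_hull_3_I)
  qed
qed

lemma is_triangle_mem_iff:
  assumes T: "is_triangle T a b c"
  shows "x \<in> T \<longleftrightarrow> 0 \<le> area2 b c x / area2 a b c \<and> 0 \<le> area2 c a x / area2 a b c \<and> 0 \<le> area2 a b x / area2 a b c"
proof -
  define D where "D = area2 a b c"
  have D: "D \<noteq> 0" using T by (simp add: is_triangle_def D_def)
  have rot_D: "area2 b c a = D" "area2 c a b = D"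
    using area2_rotate[of b c a] area2_rotate[of c a b] by (simp_all add: D_def)
  have "area2 b c x + area2 c a x + area2 a b x = D"
    by (simp add: D_def area2_def plane_simps algebra_simps)
  then have sum: "area2 b c x / D + area2 c a x / D + area2 a b x / D = 1"
    using D by (simp flip: add_divide_distrib)
  have "D *\<^sub>R x = area2 b c x *\<^sub>R a + area2 c a x *\<^sub>R b + area2 a b x *\<^sub>R c"
    by (simp add: plane_eq_iff D_def area2_def plane_simps algebra_simps)
  then have "(1 / D) *\<^sub>R (D *\<^sub>R x) = (1 / D) *\<^sub>R (area2 b c x *\<^sub>R a + area2 c a x *\<^sub>R b + area2 a b x *\<^sub>R c)"
    by simp
  then have x: "x = (area2 b c x / D) *\<^sub>R a + (area2 c a x / D) *\<^sub>R b + (area2 a b x / D) *\<^sub>R c"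
    using D by (simp add: scaleR_add_right)
  show ?thesis
  proof
    assume "x \<in> T"
    then obtain u v w where uvw: "0 \<le> u" "0 \<le> v" "0 \<le> w" "u + v + w = 1"
      and x: "x = u *\<^sub>R a + v *\<^sub>R b + w *\<^sub>R c" using is_triangle_barycentric[OF T] by auto
    have x': "x = v *\<^sub>R b + w *\<^sub>R c + u *\<^sub>R a" "x = w *\<^sub>R c + u *\<^sub>R a + v *\<^sub>R b"
      by (simp_all add: x algebra_simps)
    have "area2 a b x = w * D" unfolding x D_def by (rule area2_convex_combination) (use uvw in simp)
    moreover have "area2 b c x = u * D"
      unfolding x' rot_D(1)[symmetric] by (rule area2_convex_combination) (use uvw in simp)
    moreover have "area2 c a x = v * D"
      unfolding x'(2) rot_D(2)[symmetric] by (rule area2_convex_combination) (use uvw in simp)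
    ultimately show "0 \<le> area2 b c x / area2 a b c \<and> 0 \<le> area2 c a x / area2 a b c \<and> 0 \<le> area2 a b x / area2 a b c"
      using D uvw by (simp flip: D_def)
  next
    assume "0 \<le> area2 b c x / area2 a b c \<and> 0 \<le> area2 c a x / area2 a b c \<and> 0 \<le> area2 a b x / area2 a b c"
    then show "x \<in> T"
      unfolding is_triangle_barycentric[OF T] D_def[symmetric] using sum x by blast
  qed
qed

lemma continuous_on_area2 [continuous_intros]: "continuous_on S (area2 a b)"
  unfolding area2_def by (intro continuous_intros)

text \<open>Near an inner point of the edge \<open>a b\<close> only the sign of the third barycentric coordinate decides
  about membership in the triangle.\<close>

lemma is_triangle_interior_edge_neighbourhood:
  assumes T: "is_triangle T a b c" and x: "x \<in> open_segment a b"
  obtains U where "open U" "x \<in> U" "\<And>y. y \<in> U \<Longrightarrow> 0 \<le> area2 a b y / area2 a b c \<Longrightarrow> y \<in> T"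
proof -
  define D where "D = area2 a b c"
  have D: "D \<noteq> 0" using T by (simp add: is_triangle_def D_def)
  have rot_D: "area2 b c a = D" "area2 c a b = D"
    using area2_rotate[of b c a] area2_rotate[of c a b] by (simp_all add: D_def)
  obtain \<theta> where th: "0 < \<theta>" "\<theta> < 1" and x_eq: "x = (1 - \<theta>) *\<^sub>R a + \<theta> *\<^sub>R b"
    using x by (auto simp: in_segment)
  have "x = \<theta> *\<^sub>R b + 0 *\<^sub>R c + (1 - \<theta>) *\<^sub>R a" "x = 0 *\<^sub>R c + (1 - \<theta>) *\<^sub>R a + \<theta> *\<^sub>R b"
    by (simp_all add: x_eq)
  then have "area2 b c x = (1 - \<theta>) * D" "area2 c a x = \<theta> * D"
    using area2_convex_combination[of \<theta> 0 "1 - \<theta>" b c a]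
      area2_convex_combination[of 0 "1 - \<theta>" \<theta> c a b] by (simp_all add: rot_D add.commute)
  then have pos: "0 < area2 b c x / D" "0 < area2 c a x / D" using D th by simp_all
  define U where "U = {y. 0 < area2 b c y / D} \<inter> {y. 0 < area2 c a y / D}"
  have "open U" unfolding U_def
    by (intro open_Int open_Collect_less continuous_intros) (use D in auto)
  moreover have "x \<in> U" using pos by (simp add: U_def)
  moreover have "y \<in> T" if "y \<in> U" "0 \<le> area2 a b y / area2 a b c" for y
    using that unfolding is_triangle_mem_iff[OF T] by (simp add: U_def less_imp_le flip: D_def)
  ultimately show thesis using that by blast
qed

lemma affine_interpolation:
  assumes "is_triangle T a b c"
  obtains \<gamma> :: plane and \<kappa> where "\<gamma> \<bullet> a + \<kappa> = \<alpha>" "\<gamma> \<bullet> b + \<kappa> = \<beta>" "\<gamma> \<bullet> c + \<kappa> = \<delta>"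
proof -
  define D where "D = area2 a b c"
  have D: "D \<noteq> 0" using assms by (simp add: is_triangle_def D_def)
  define \<gamma> where "\<gamma> = (1 / D) *\<^sub>R ((\<delta> - \<alpha>) *\<^sub>R rot (b - a) - (\<beta> - \<alpha>) *\<^sub>R rot (c - a))"
  have "D * (\<gamma> \<bullet> (b - a)) = D * (\<beta> - \<alpha>)" "D * (\<gamma> \<bullet> (c - a)) = D * (\<delta> - \<alpha>)"
    using D by (simp_all add: \<gamma>_def inner_diff_left) 
      (simp_all add: D_def area2_def plane_simps algebra_simps)
  then have "\<gamma> \<bullet> b - \<gamma> \<bullet> a = \<beta> - \<alpha>" "\<gamma> \<bullet> c - \<gamma> \<bullet> a = \<delta> - \<alpha>"
    using D by (simp_all add: inner_diff_right)
  then show thesis using that[of \<gamma> "\<alpha> - \<gamma> \<bullet> a"] by simp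
qed

lemma is_triangle_edge: "is_triangle T a b c \<Longrightarrow> closed_segment a b edge_of T"
  by (simp add: is_triangle_edge_iff)

section \<open>Affine fields with zero weak divergence\<close>

lemma lborel_integral_translation:
  fixes f :: "'a::euclidean_space \<Rightarrow> real"
  assumes "f \<in> borel_measurable borel"
  shows "(LINT x|lborel. f (e + x)) = (LINT x|lborel. f x)"
proof -
  have "(LINT x|lborel. f x) = (LINT x|distr lborel borel ((+) e). f x)"
    by (simp add: lborel_distr_plus)
  also have "\<dots> = (LINT x|lborel. f (e + x))"
    by (rule integral_distr) (use assms in auto)
  finally show ?thesis by simp
qed

lemma integrable_compact_support:
  fixes f :: "'a::euclidean_space \<Rightarrow> real"
  assumes "continuous_on UNIV f" "compact K" "\<And>x. x \<notin> K \<Longrightarrow> f x = 0"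
  shows "integrable lborel f"
proof -
  have "integrable lborel (\<lambda>x. indicator K x *\<^sub>R f x)"
    by (rule borel_integrable_compact) (use assms(1,2) continuous_on_subset in blast)+
  moreover have "(\<lambda>x. indicator K x *\<^sub>R f x) = f"
    using assms(3) by (auto simp: fun_eq_iff indicator_def)
  ultimately show ?thesis by simp
qed

text \<open>Integration by parts without iterated integrals: by translation invariance all difference quotients
  of \<open>f\<close> have integral zero, and they converge to the directional derivative. The dominating
  function is a bound of the derivative on a ball that contains the supports of all of them.\<close>

lemma integral_gradient_eq_0:
  fixes f :: "'a::euclidean_space \<Rightarrow> real" and g :: "'a \<Rightarrow> 'a"
  assumes der: "\<And>x. GDERIV f x :> g x" and cont: "continuous_on UNIV g"
    and K: "compact K" "\<And>x. x \<notin> K \<Longrightarrow> f x = 0" "\<And>x. x \<notin> K \<Longrightarrow> g x = 0"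
  shows "(LINT x|lborel. g x \<bullet> e) = 0"
proof -
  define G where "G = (\<lambda>x. g x \<bullet> e)"
  have fd: "(f has_derivative (\<lambda>h. h \<bullet> g x)) (at x)" for x
    using der unfolding gderiv_def by blast
  have contf: "continuous_on UNIV f"
    by (rule has_derivative_continuous_on) (rule fd)
  have contG: "continuous_on UNIV G" unfolding G_def by (intro continuous_intros cont)
  have line: "((\<lambda>t. f (x + t *\<^sub>R e)) has_real_derivative G (x + t *\<^sub>R e)) (at t)" for x t
  proof -
    have "((\<lambda>t. f (x + t *\<^sub>R e)) has_derivative (\<lambda>h. (0 + h *\<^sub>R e) \<bullet> g (x + t *\<^sub>R e))) (at t)"
      by (rule has_derivative_compose[OF _ fd]) (auto intro!: derivative_eq_intros)
    then show ?thesis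
      by (simp add: has_field_derivative_def G_def inner_commute mult_commute_abs)
  qed
  have "compact (G ` K)" using K(1) contG by (intro compact_continuous_image continuous_on_subset[OF contG]) auto
  then obtain M where M: "\<And>x. x \<in> K \<Longrightarrow> \<bar>G x\<bar> \<le> M"
    using compact_imp_bounded bounded_iff by (metis image_eqI real_norm_def)
  define M' where "M' = \<bar>M\<bar>"
  have M': "\<bar>G x\<bar> \<le> M'" for x
    using M[of x] K(3)[of x] by (cases "x \<in> K") (auto simp: M'_def G_def)
  obtain R where R: "\<And>x. x \<in> K \<Longrightarrow> norm x \<le> R"
    using compact_imp_bounded[OF K(1)] bounded_iff by blast
  define S where "S = cball (0::'a) (R + norm e)"
  define h where "h = (\<lambda>n. inverse (real (Suc n)))"
  have h: "h n > 0" "h n \<le> 1" for n by (auto simp: h_def field_simps)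
  define q where "q = (\<lambda>n x. (f (h n *\<^sub>R e + x) - f x) / h n)"
  have intf: "integrable lborel f" by (rule integrable_compact_support[OF contf K(1,2)])
  have mf: "f \<in> borel_measurable borel" using contf by (rule borel_measurable_continuous_onI)
  have mG: "G \<in> borel_measurable borel" using contG by (rule borel_measurable_continuous_onI)
  have int_shift: "integrable lborel (\<lambda>x. f (c + x))" for c
  proof -
    have "integrable (distr lborel borel ((+) c)) f" using intf by (simp add: lborel_distr_plus)
    then show ?thesis by (subst (asm) integrable_distr_eq) (use mf in auto)
  qed
  have "(LINT x|lborel. q n x) = 0" for n
    using int_shift[of "h n *\<^sub>R e"] intf lborel_integral_translation[OF mf, of "h n *\<^sub>R e"]
    by (simp add: q_def)
  moreover have "(\<lambda>n. LINT x|lborel. q n x) \<longlonglongrightarrow> (LINT x|lborel. G x)"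
  proof (rule integral_dominated_convergence[where w = "\<lambda>x. indicator S x *\<^sub>R M'"])
    show "G \<in> borel_measurable lborel" using mG by simp
    show "q n \<in> borel_measurable lborel" for n unfolding q_def using mf by measurable
    show "integrable lborel (\<lambda>x. indicator S x *\<^sub>R M')"
      by (rule borel_integrable_compact) (auto simp: S_def)
    show "AE x in lborel. (\<lambda>n. q n x) \<longlonglongrightarrow> G x"
    proof (rule AE_I2)
      fix x
      have "((\<lambda>t. f (x + t *\<^sub>R e)) has_real_derivative G x) (at 0)" using line[of x 0] by simp
      then have lim: "(\<lambda>t. (f (x + t *\<^sub>R e) - f x) / t) \<midarrow>0\<rightarrow> G x" by (simp add: DERIV_def)
      have "h \<longlonglongrightarrow> 0" unfolding h_def by (rule LIMSEQ_inverse_real_of_nat)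
      then have "(\<lambda>n. (f (x + h n *\<^sub>R e) - f x) / h n) \<longlonglongrightarrow> G x"
        using h(1) lim unfolding LIMSEQ_SEQ_conv[symmetric] by (metis less_irrefl)
      then show "(\<lambda>n. q n x) \<longlonglongrightarrow> G x" by (simp add: q_def add.commute)
    qed
    show "AE x in lborel. norm (q n x) \<le> indicator S x *\<^sub>R M'" for n
    proof (rule AE_I2)
      fix x
      have "\<exists>z. 0 < z \<and> z < h n \<and> f (x + h n *\<^sub>R e) - f (x + 0 *\<^sub>R e) = (h n - 0) * G (x + z *\<^sub>R e)"
        by (rule MVT2) (use h line in auto)
      then obtain z where z: "0 < z" "z < h n" "f (x + h n *\<^sub>R e) - f x = h n * G (x + z *\<^sub>R e)" by auto
      then have q: "q n x = G (x + z *\<^sub>R e)" using h(1)[of n] by (simp add: q_def add.commute)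
      show "norm (q n x) \<le> indicator S x *\<^sub>R M'"
      proof (cases "x \<in> S")
        case True then show ?thesis using M' q by simp
      next
        case False
        have "norm (z *\<^sub>R e) \<le> norm e" using z h(2)[of n] by (simp add: mult_left_le_one_le)
        moreover have "norm x > R + norm e" using False by (simp add: S_def)
        moreover have "norm x \<le> norm (x + z *\<^sub>R e) + norm (z *\<^sub>R e)" by (metis add_diff_cancel_right' norm_triangle_ineq4)
        ultimately have "norm (x + z *\<^sub>R e) > R" by linarith
        then have "x + z *\<^sub>R e \<notin> K" using R by force
        then show ?thesis using q K(3) False by (simp add: G_def)
      qed
    qed
  qed
  ultimately have "(\<lambda>n. 0) \<longlonglongrightarrow> (LINT x|lborel. G x)" by simp
  then have "(LINT x|lborel. G x) = 0" by (simp add: LIMSEQ_const_iff)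
  then show ?thesis by (simp add: G_def)
qed

lemma has_real_derivative_max_0_square:
  "((\<lambda>t. (max 0 t)\<^sup>2) has_real_derivative 2 * max 0 t) (at (t::real))"
proof -
  consider "t < 0" | "t = 0" | "t > 0" by linarith
  then show ?thesis
  proof cases
    case 1
    have "((\<lambda>t. (max 0 t)\<^sup>2) has_real_derivative 0) (at t)"
      by (rule has_field_derivative_transform_within_open[of "\<lambda>t. 0" _ _ "{..<0}"]) (use 1 in auto)
    then show ?thesis using 1 by simp
  next
    case 2
    have "(\<lambda>h::real. ((max 0 h)\<^sup>2) / h) \<midarrow>0\<rightarrow> 0"
    proof (rule Lim_null_comparison)
      show "\<forall>\<^sub>F h in at 0. norm ((max 0 h)\<^sup>2 / h) \<le> \<bar>h\<bar>" 
        by (rule always_eventually) (auto simp: max_def power2_eq_square)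
      show "(\<lambda>h::real. \<bar>h\<bar>) \<midarrow>0\<rightarrow> 0" by (rule tendsto_rabs_zero) simp
    qed
    then show ?thesis using 2 by (simp add: DERIV_def)
  next
    case 3
    have "((\<lambda>t. t\<^sup>2) has_real_derivative 2 * t) (at t)" by (auto intro!: derivative_eq_intros)
    then have "((\<lambda>t. (max 0 t)\<^sup>2) has_real_derivative 2 * t) (at t)"
      by (rule has_field_derivative_transform_within_open[of _ _ _ "{0<..}"]) (use 3 in auto)
    then show ?thesis using 3 by simp
  qed
qed

text \<open>A continuously differentiable function that is positive exactly on the ball of radius \<open>sqrt k\<close>, if
  \<open>k > 0\<close>.\<close>

lemma GDERIV_bump:
  fixes p :: "'a::real_inner"
  shows "GDERIV (\<lambda>x. (max 0 (k - (x - p) \<bullet> (x - p)))\<^sup>2) x :> (- 4 * max 0 (k - (x - p) \<bullet> (x - p))) *\<^sub>R (x - p)"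
proof -
  define s where "s = (\<lambda>x. k - (x - p) \<bullet> (x - p))"
  have 1: "(s has_derivative (\<lambda>h. - 2 * (h \<bullet> (x - p)))) (at x)"
    unfolding s_def by (auto intro!: derivative_eq_intros simp: inner_commute)
  have 2: "((\<lambda>t. (max 0 t)\<^sup>2) has_derivative (\<lambda>h. 2 * max 0 (s x) * h)) (at (s x))"
    using has_real_derivative_max_0_square[of "s x"] unfolding has_field_derivative_def .
  have "((\<lambda>x. (max 0 (s x))\<^sup>2) has_derivative (\<lambda>h. 2 * max 0 (s x) * (- 2 * (h \<bullet> (x - p))))) (at x)"
    by (rule has_derivative_compose[OF 1 2])
  then show ?thesis by (simp add: gderiv_def s_def mult.assoc mult.left_commute)
qed

text \<open>Test with a bump function \<open>\<phi>\<close> supported in \<open>U\<close>: integration by parts turns the weak divergence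
  into the trace of \<open>A\<close> times the integral of \<open>\<phi>\<close>, which is positive.\<close>

lemma affine_weakly_solenoidal_imp_tracefree:
  fixes A :: "real^2^2"
  assumes U: "open U" "U \<subseteq> \<Omega>" "U \<noteq> {}" and v: "\<And>x. x \<in> U \<Longrightarrow> v x = A *v x + b"
    and weak: "has_weak_divergence \<Omega> v (\<lambda>x. 0)"
  shows "A $ 1 $ 1 + A $ 2 $ 2 = 0"
proof -
  obtain p r where "r > 0" and r: "cball p r \<subseteq> U"
    using U open_contains_cball by blast
  define s where "s = (\<lambda>x. max 0 (r\<^sup>2 - (x - p) \<bullet> (x - p)))"
  define \<phi> where "\<phi> = (\<lambda>x. (s x)\<^sup>2)"
  define \<phi>' where "\<phi>' = (\<lambda>x. (- 4 * s x) *\<^sub>R (x - p))"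
  have s0: "s x = 0" if "x \<notin> cball p r" for x
  proof -
    have "r\<^sup>2 \<le> (norm (x - p))\<^sup>2"
      using that \<open>r > 0\<close> by (intro power_mono) (auto simp: dist_norm norm_minus_commute)
    then show ?thesis by (simp add: s_def power2_norm_eq_inner)
  qed
  have conts: "continuous_on UNIV s" unfolding s_def by (intro continuous_intros)
  have cont: "continuous_on UNIV \<phi>" "continuous_on UNIV \<phi>'"
    unfolding \<phi>_def \<phi>'_def by (intro continuous_intros conts)+
  have grad: "GDERIV \<phi> x :> \<phi>' x" for x
    unfolding \<phi>_def \<phi>'_def s_def by (rule GDERIV_bump)
  have off: "\<phi> x = 0" "\<phi>' x = 0" if "x \<notin> cball p r" for x
    using s0[OF that] by (simp_all add: \<phi>_def \<phi>'_def)
  have "test_function \<Omega> \<phi> \<phi>'"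
    unfolding test_function_def using grad cont off r U by (auto intro!: exI[of _ "cball p r"])
  then have "(LINT x:\<Omega>|lborel. v x \<bullet> \<phi>' x) = 0"
    using weak unfolding has_weak_divergence_def by simp
  moreover have "(\<lambda>x. indicator \<Omega> x *\<^sub>R (v x \<bullet> \<phi>' x)) = (\<lambda>x. (A *v x + b) \<bullet> \<phi>' x)"
  proof
    fix x
    show "indicator \<Omega> x *\<^sub>R (v x \<bullet> \<phi>' x) = (A *v x + b) \<bullet> \<phi>' x"
    proof (cases "x \<in> cball p r")
      case True
      then have "x \<in> U" "x \<in> \<Omega>" using r U(2) by blast+
      then show ?thesis using v by simp
    qed (simp add: off)
  qed
  ultimately have weak0: "(LINT x|lborel. (A *v x + b) \<bullet> \<phi>' x) = 0"
    by (simp add: set_lebesgue_integral_def)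
  \<comment> \<open>The partial derivative in direction \<open>i\<close> of the \<open>i\<close>-th component of \<open>(A x + b) \<phi>(x)\<close>.\<close>
  define F where "F = (\<lambda>i x. (A *v x + b) $ i * \<phi>' x $ i + \<phi> x * A $ i $ i)"
  have cA: "continuous_on UNIV (\<lambda>x. A *v x + b)"
    by (intro continuous_intros linear_continuous_on) simp
  have contF: "continuous_on UNIV (F i)" for i
    unfolding F_def by (intro continuous_intros cont cA)
  have intF: "integrable lborel (F i)" for i
    by (rule integrable_compact_support[OF contF compact_cball[of p r]]) (simp add: F_def off)
  have F0: "(LINT x|lborel. F i x) = 0" for i
  proof -
    define f where "f = (\<lambda>x. (A *v x + b) $ i * \<phi> x)"
    define g where "g = (\<lambda>x. (A *v x + b) $ i *\<^sub>R \<phi>' x + \<phi> x *\<^sub>R (A $ i))"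
    have "GDERIV (\<lambda>x. (A *v x + b) $ i) x :> A $ i" for x
      unfolding gderiv_def
      by (auto simp: matrix_vector_mul_component inner_commute intro!: derivative_eq_intros)
    then have "GDERIV f x :> g x" for x
      unfolding f_def g_def by (rule GDERIV_mult[OF _ grad])
    moreover have "continuous_on UNIV g"
      unfolding g_def by (intro continuous_intros cont cA)
    ultimately have "(LINT x|lborel. g x \<bullet> axis i 1) = 0"
      by (rule integral_gradient_eq_0[OF _ _ compact_cball[of p r]]) (simp_all add: f_def g_def off)
    then show ?thesis by (simp add: g_def F_def inner_axis)
  qed
  have int\<phi>: "integrable lborel \<phi>"
    by (rule integrable_compact_support[OF cont(1) compact_cball[of p r]]) (simp add: off)
  have intv: "integrable lborel (\<lambda>x. (A *v x + b) \<bullet> \<phi>' x)"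
    by (rule integrable_compact_support[OF _ compact_cball[of p r]]) (intro continuous_intros cont cA, simp add: off)
  have "(\<lambda>x. F 1 x + F 2 x) = (\<lambda>x. (A *v x + b) \<bullet> \<phi>' x + (A $ 1 $ 1 + A $ 2 $ 2) * \<phi> x)"
    by (simp add: F_def inner_plane algebra_simps)
  then have "(LINT x|lborel. (A *v x + b) \<bullet> \<phi>' x + (A $ 1 $ 1 + A $ 2 $ 2) * \<phi> x) = 0"
    using F0[of 1] F0[of 2] Bochner_Integration.integral_add[OF intF[of 1] intF[of 2]] by simp
  then have "(A $ 1 $ 1 + A $ 2 $ 2) * (LINT x|lborel. \<phi> x) = 0"
    using weak0 Bochner_Integration.integral_add[OF intv integrable_mult_right[OF int\<phi>, of "A $ 1 $ 1 + A $ 2 $ 2"]]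
    by simp
  moreover have "(LINT x|lborel. \<phi> x) \<noteq> 0"
  proof
    assume "(LINT x|lborel. \<phi> x) = 0"
    then have "AE x in lborel. \<phi> x = 0"
      using integral_nonneg_eq_0_iff_AE[OF int\<phi>] by (simp add: \<phi>_def)
    then have "AE x in lborel. x \<notin> ball p r"
    proof eventually_elim
      case (elim x)
      then have "(norm (x - p))\<^sup>2 \<ge> r\<^sup>2" by (auto simp: \<phi>_def s_def power2_norm_eq_inner max_def split: if_splits)
      then show ?case using \<open>r > 0\<close> abs_le_square_iff[of r "norm (x - p)"] 
        by (auto simp: dist_norm norm_minus_commute)
    qed
    then have "ball p r \<in> null_sets lborel"
      by (subst AE_iff_null_sets) auto
    then have "measure lborel (ball p r) = 0" by (simp add: measure_def null_sets_def)
    then show False using content_ball_pos[OF \<open>r > 0\<close>, of p] by simp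
  qed
  ultimately show ?thesis by simp
qed

section \<open>The topology of a polygonal domain\<close>

lemma pathstart_polyline: "pathstart (polyline (a # ps)) = a"
  by (induction "a # ps" arbitrary: a ps rule: polyline.induct) simp_all

lemma pathfinish_polyline: "pathfinish (polyline (ps @ [b])) = b"
proof -
  have "qs \<noteq> [] \<Longrightarrow> pathfinish (polyline qs) = last qs" for qs
    by (induction qs rule: polyline.induct) simp_all
  then show ?thesis by simp
qed

text \<open>The identification with the complex plane, which is the setting of the Jordan curve theorem and of
  the characterization of the compact sets that do not separate the plane.\<close>

definition to_complex :: "plane \<Rightarrow> complex" where
  "to_complex x = Complex (x $ 1) (x $ 2)"

lemma linear_to_complex: "linear to_complex"
  by (rule linearI) (simp_all add: to_complex_def complex_eq_iff)

lemma inj_to_complex: "inj to_complex"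
  by (rule injI) (simp add: to_complex_def plane_eq_iff)

lemma surj_to_complex: "surj to_complex"
  by (rule surjI[of _ "\<lambda>z. vector [Re z, Im z]"]) (simp add: to_complex_def complex_eq_iff)

lemma bij_to_complex: "bij to_complex"
  by (simp add: bij_def inj_to_complex surj_to_complex)

lemma to_complex_inside: "inside (to_complex ` S) = to_complex ` inside S"
proof -
  obtain h where h: "homeomorphism (to_complex ` (- S)) (- S) h to_complex"
    using linear_homeomorphism_image[OF linear_to_complex inj_to_complex] by blast
  have compl: "to_complex ` (- S) = - to_complex ` S"
    by (rule bij_image_Compl_eq[OF bij_to_complex])
  have "bounded_linear to_complex" using linear_to_complex by (simp add: linear_conv_bounded_linear)
  obtain k where k: "linear k" "k \<circ> to_complex = id"
    using linear_injective_left_inverse[OF linear_to_complex inj_to_complex] by blast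
  have k': "bounded_linear k" "\<And>S. k ` to_complex ` S = S"
    using k by (simp_all add: linear_conv_bounded_linear image_comp)
  have bdd: "bounded (to_complex ` S) \<longleftrightarrow> bounded S" for S
    using bounded_linear_image[OF _ \<open>bounded_linear to_complex\<close>, of S]
      bounded_linear_image[OF _ k'(1), of "to_complex ` S"] k'(2) by auto
  have "to_complex x \<in> inside (to_complex ` S) \<longleftrightarrow> x \<in> inside S" for x
  proof (cases "x \<in> S")
    case False
    then have "connected_component_set (- to_complex ` S) (to_complex x) =
        to_complex ` connected_component_set (- S) x"
      using connected_component_set_homeomorphism[OF homeomorphism_symD[OF h], of x] by (simp add: compl)
    then show ?thesis using False by (simp add: inside_def bdd inj_image_mem_iff[OF inj_to_complex])
  qed (auto simp: inside_def)
  then show ?thesis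
    using surj_to_complex by (metis (no_types) equalityI image_subset_iff subsetI surjD inj_image_mem_iff[OF inj_to_complex])
qed

lemma to_complex_frontier: "frontier (to_complex ` S) = to_complex ` frontier S"
proof -
  have "- to_complex ` S = to_complex ` (- S)"
    by (rule bij_image_Compl_eq[OF bij_to_complex, symmetric])
  then show ?thesis
    unfolding frontier_closures
    by (simp add: closure_injective_linear_image[OF linear_to_complex inj_to_complex, symmetric]
        image_Int[OF inj_to_complex])
qed

text \<open>All properties are transported from the Jordan curve theorem. The closed domain is Borsukian
  since it is compact and its complement, the outside of the curve, is connected; its boundary has no
  isolated points since it is connected and not a single point.\<close>

lemma Jordan_domain_topology:
  fixes g :: "real \<Rightarrow> plane"
  assumes g: "simple_path g" "pathfinish g = pathstart g" and \<Omega>: "\<Omega> = inside (path_image g)"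
  shows "open \<Omega>" "connected \<Omega>" "bounded \<Omega>" "connected (frontier \<Omega>)"
    "x \<in> frontier \<Omega> \<Longrightarrow> x islimpt frontier \<Omega>"
    "frontier \<Omega> \<subseteq> closure (- closure \<Omega>)" "Borsukian (closure \<Omega>)"
proof -
  note lin = linear_to_complex inj_to_complex bij_to_complex
  define P where "P = path_image g"
  define c where "c = to_complex \<circ> g"
  have c: "simple_path c" "pathfinish c = pathstart c"
    using g by (simp_all add: c_def simple_path_linear_image_eq[OF lin(1,2)] pathstart_def pathfinish_def)
  have C: "path_image c = to_complex ` P" unfolding c_def P_def by (rule path_image_linear_image[OF lin(1)])
  have ins: "inside (to_complex ` P) = to_complex ` \<Omega>" by (simp add: to_complex_inside \<Omega> P_def)
  have out: "outside (to_complex ` P) = to_complex ` outside P"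
    unfolding outside_inside ins \<Omega> P_def[symmetric]
    by (simp only: bij_image_Compl_eq[OF lin(3)] image_Un to_complex_inside)
  have J: "open (to_complex ` \<Omega>)" "connected (to_complex ` \<Omega>)"
    "connected (to_complex ` outside P)"
    "to_complex ` frontier \<Omega> = to_complex ` P" "to_complex ` frontier (outside P) = to_complex ` P"
    using Jordan_inside_outside[OF c] unfolding C out ins to_complex_frontier by simp_all
  have img: "A = B" if "to_complex ` A = to_complex ` B" for A B
    using that inj_image_eq_iff[OF lin(2)] by blast
  have hom: "connected S \<longleftrightarrow> connected (to_complex ` S)" for S
    by (rule homeomorphic_connectedness[OF linear_homeomorphic_image[OF lin(1,2)]])
  show "open \<Omega>" using J(1) by (simp add: open_bijective_linear_image_eq[OF lin(1,3)])
  show "connected \<Omega>" using J(2) hom by simp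
  have fr: "frontier \<Omega> = P" "frontier (outside P) = P" by (rule img, rule J)+
  show "bounded \<Omega>"
    unfolding \<Omega> by (intro bounded_inside compact_imp_bounded compact_simple_path_image[OF g(1)])
  show conF: "connected (frontier \<Omega>)"
    unfolding fr P_def by (rule connected_simple_path_image[OF g(1)])
  have "frontier \<Omega> \<noteq> {a}" for a
  proof
    assume "frontier \<Omega> = {a}"
    then have "g t = a" if "t \<in> {0..1}" for t using that by (auto simp: fr P_def path_image_def)
    then have "g 0 = g (1 / 2)" by simp
    then show False using g(1) unfolding simple_path_def loop_free_def by fastforce
  qed
  then show "x \<in> frontier \<Omega> \<Longrightarrow> x islimpt frontier \<Omega>"
    using connected_imp_perfect[OF conF] by blast
  have "closure \<Omega> = P \<union> \<Omega>"
    using closure_Un_frontier[of \<Omega>] fr(1) by (simp add: Un_commute)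
  then have ext: "- closure \<Omega> = outside P" by (simp add: outside_inside \<Omega> P_def)
  then show "frontier \<Omega> \<subseteq> closure (- closure \<Omega>)"
    using fr by (metis frontier_closures Int_lower1)
  have "closed (to_complex ` closure \<Omega>)"
    by (simp add: closed_injective_linear_image_eq[OF lin(1,2)])
  moreover have "bounded (to_complex ` closure \<Omega>)"
    using \<open>bounded \<Omega>\<close> lin(1) by (intro bounded_linear_image bounded_closure) (simp_all add: linear_conv_bounded_linear)
  ultimately have "compact (to_complex ` closure \<Omega>)" by (simp add: compact_eq_bounded_closed)
  moreover have "connected (- to_complex ` closure \<Omega>)"
    using J(3) ext by (simp flip: bij_image_Compl_eq[OF lin(3)])
  ultimately have "Borsukian (to_complex ` closure \<Omega>)" using Borsukian_separation_compact by blast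
  then show "Borsukian (closure \<Omega>)" using Borsukian_injective_linear_image[OF lin(1,2)] by blast
qed

lemma polygonal_domain_Jordan:
  assumes "polygonal_domain \<Omega>"
  obtains g where "simple_path g" "pathfinish g = pathstart g" "\<Omega> = inside (path_image g)"
proof -
  obtain ps where ps: "ps \<noteq> []" "simple_path (polyline (ps @ [hd ps]))"
    "\<Omega> = inside (path_image (polyline (ps @ [hd ps])))"
    using assms unfolding polygonal_domain_def by blast
  have "pathstart (polyline (ps @ [hd ps])) = hd ps"
    using ps(1) pathstart_polyline by (cases ps) simp_all
  then show thesis using that ps pathfinish_polyline[of ps "hd ps"] by metis
qed

section \<open>The macro-mesh\<close>

locale polygonal_mesh =
  fixes \<Omega> :: "plane set" and \<tau> :: "plane set set"
  assumes polygonal: "polygonal_domain \<Omega>" and mesh: "macro_mesh \<Omega> \<tau>"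
begin

lemma
  shows open_domain: "open \<Omega>" and connected_domain: "connected \<Omega>"
    and bounded_domain: "bounded \<Omega>" and connected_boundary: "connected (frontier \<Omega>)"
    and boundary_perfect: "x \<in> frontier \<Omega> \<Longrightarrow> x islimpt frontier \<Omega>"
    and boundary_accessible: "frontier \<Omega> \<subseteq> closure (- closure \<Omega>)"
    and Borsukian_closure: "Borsukian (closure \<Omega>)"
proof -
  obtain g where g: "simple_path g" "pathfinish g = pathstart g" "\<Omega> = inside (path_image g)"
    using polygonal_domain_Jordan[OF polygonal] .
  show "open \<Omega>" "connected \<Omega>" "bounded \<Omega>" "connected (frontier \<Omega>)"
    "frontier \<Omega> \<subseteq> closure (- closure \<Omega>)" "Borsukian (closure \<Omega>)"
    by (rule Jordan_domain_topology[OF g])+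
  show "x \<in> frontier \<Omega> \<Longrightarrow> x islimpt frontier \<Omega>" by (rule Jordan_domain_topology[OF g])
qed

lemma boundary_not_interior: "x \<in> frontier \<Omega> \<Longrightarrow> x \<notin> interior (closure \<Omega>)"
  using boundary_accessible by (auto simp: closure_interior)

lemma interior_closure_subset: "interior (closure \<Omega>) \<subseteq> \<Omega>"
proof
  fix x assume x: "x \<in> interior (closure \<Omega>)"
  then have "x \<in> closure \<Omega>" using interior_subset by blast
  moreover have "x \<notin> frontier \<Omega>" using x boundary_not_interior by blast
  ultimately show "x \<in> \<Omega>" using closure_Un_frontier by blast
qed

lemma finite_mesh: "finite \<tau>" and Union_mesh: "\<Union>\<tau> = closure \<Omega>"
  using mesh by (simp_all add: macro_mesh_def triangulation_def)

lemma mesh_triangle: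
  assumes "T \<in> \<tau>" obtains a b c where "is_triangle T a b c"
  using mesh assms two_simplex_is_triangle unfolding macro_mesh_def by blast

lemma mesh_triangle_subset: "T \<in> \<tau> \<Longrightarrow> T \<subseteq> closure \<Omega>"
  using Union_mesh by blast

lemma inter_face: "T \<in> \<tau> \<Longrightarrow> T' \<in> \<tau> \<Longrightarrow> (T \<inter> T') face_of T"
  using mesh by (simp add: macro_mesh_def triangulation_def)

lemma inter_face': "T \<in> \<tau> \<Longrightarrow> T' \<in> \<tau> \<Longrightarrow> (T \<inter> T') face_of T'"
  using inter_face[of T' T] by (simp add: Int_commute)

lemma closed_mesh_triangle: "T \<in> \<tau> \<Longrightarrow> closed T"
  by (metis mesh_triangle is_triangle_def finite.emptyI finite_insert finite_imp_compact_convex_hull compact_imp_closed)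

lemma convex_mesh_triangle: "T \<in> \<tau> \<Longrightarrow> convex T"
  by (metis mesh_triangle is_triangle_def convex_convex_hull)

lemma interior_mesh_triangle: "T \<in> \<tau> \<Longrightarrow> interior T \<subseteq> \<Omega>"
  using interior_mono[OF mesh_triangle_subset] interior_closure_subset by blast

lemma triangle_through:
  assumes "T \<in> \<tau>" "a extreme_point_of T" "b extreme_point_of T" "a \<noteq> b"
  obtains c where "is_triangle T a b c"
proof -
  obtain p q r where T: "is_triangle T p q r" using mesh_triangle[OF assms(1)] .
  note T1 = is_triangle_rotate[OF T]
  note T2 = is_triangle_rotate[OF T1]
  have "a \<in> {p, q, r}" "b \<in> {p, q, r}" using assms is_triangle_vertex_iff[OF T] by blast+
  then show thesis
    using assms(4) that T T1 T2 is_triangle_swap[OF T] is_triangle_swap[OF T1] is_triangle_swap[OF T2] by blast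
qed

lemma is_triangle_vertices:
  assumes "is_triangle T a b c"
  shows "a extreme_point_of T" "b extreme_point_of T" "c extreme_point_of T" "a \<in> T" "b \<in> T" "c \<in> T"
proof -
  show "a extreme_point_of T" "b extreme_point_of T" "c extreme_point_of T"
    using is_triangle_vertex_iff[OF assms] by blast+
  then show "a \<in> T" "b \<in> T" "c \<in> T" by (simp_all add: extreme_point_of_def)
qed

lemma mesh_vertices_of_triangle: "T \<in> \<tau> \<Longrightarrow> z extreme_point_of T \<Longrightarrow> z \<in> mesh_vertices \<tau>"
  by (auto simp: mesh_vertices_def)

text \<open>There are no hanging vertices: an extreme point of one triangle is extreme in the
  common face and hence in the other triangle.\<close>

lemma mesh_vertex_in_triangle:
  assumes "z \<in> mesh_vertices \<tau>" "T \<in> \<tau>" "z \<in> T"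
  shows "z extreme_point_of T"
proof -
  obtain T' where T': "T' \<in> \<tau>" "z extreme_point_of T'" using assms(1) by (auto simp: mesh_vertices_def)
  have "z \<in> T'" using T'(2) by (simp add: extreme_point_of_def)
  then have "z extreme_point_of (T \<inter> T')"
    using extreme_point_of_face[OF inter_face'[OF assms(2) T'(1)]] T'(2) assms(3) by blast
  then show ?thesis using extreme_point_of_face[OF inter_face[OF assms(2) T'(1)]] by blast
qed

lemma finite_mesh_vertices: "finite (mesh_vertices \<tau>)"
proof -
  have "finite {z. z extreme_point_of T}" if "T \<in> \<tau>" for T
    using mesh_triangle[OF that] is_triangle_vertex_iff by (metis (no_types, lifting) Collect_mem_eq finite.emptyI finite_insert Collect_cong)
  moreover have "mesh_vertices \<tau> = (\<Union>T\<in>\<tau>. {z. z extreme_point_of T})" by (auto simp: mesh_vertices_def)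
  ultimately show ?thesis using finite_mesh by simp
qed

lemma segment_in_mesh_edges_iff:
  "closed_segment a b \<in> mesh_edges \<tau> \<longleftrightarrow> (\<exists>T\<in>\<tau>. \<exists>c. is_triangle T a b c)"
proof
  assume "closed_segment a b \<in> mesh_edges \<tau>"
  then obtain T where T: "T \<in> \<tau>" "closed_segment a b edge_of T" by (auto simp: mesh_edges_def)
  then have "a extreme_point_of T" "b extreme_point_of T"
    using extreme_point_of_face[of "closed_segment a b" T] by (auto simp: edge_of_def extreme_point_of_segment)
  moreover have "a \<noteq> b" using T(2) by (auto simp: edge_of_def)
  ultimately show "\<exists>T\<in>\<tau>. \<exists>c. is_triangle T a b c" using T(1) triangle_through by metis
next
  assume "\<exists>T\<in>\<tau>. \<exists>c. is_triangle T a b c"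
  then show "closed_segment a b \<in> mesh_edges \<tau>"
    unfolding mesh_edges_def using is_triangle_edge by blast
qed

lemma mesh_edge_segment:
  assumes "e \<in> mesh_edges \<tau>" 
  obtains a b where "e = closed_segment a b" "a \<noteq> b" "a \<in> mesh_vertices \<tau>" "b \<in> mesh_vertices \<tau>"
proof -
  obtain T where T: "T \<in> \<tau>" "e edge_of T" using assms by (auto simp: mesh_edges_def)
  obtain p q r where tri: "is_triangle T p q r" using mesh_triangle[OF T(1)] .
  then have "e \<in> {closed_segment p q, closed_segment q r, closed_segment r p}"
    using T(2) is_triangle_edge_iff by blast
  moreover have "p \<in> mesh_vertices \<tau>" "q \<in> mesh_vertices \<tau>" "r \<in> mesh_vertices \<tau>"
    using is_triangle_vertices[OF tri] mesh_vertices_of_triangle[OF T(1)] by blast+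
  ultimately show thesis using that is_triangle_distinct[OF tri] by blast
qed

text \<open>A triangle that meets an edge in an inner point contains the edge, since the intersection of two
  triangles is a face.\<close>

lemma edge_meets_triangle:
  assumes "T \<in> \<tau>" "T' \<in> \<tau>" "is_triangle T a b c" "x \<in> open_segment a b" "x \<in> T'"
  obtains c' where "is_triangle T' a b c'"
proof -
  note v = is_triangle_vertices[OF assms(3)] and d = is_triangle_distinct[OF assms(3)]
  have seg: "closed_segment a b \<subseteq> T"
    using v convex_mesh_triangle[OF assms(1)] by (simp add: closed_segment_subset)
  have "x \<in> (T \<inter> T') \<inter> rel_interior (closed_segment a b)"
    using assms(4,5) seg d open_closed_segment[OF assms(4)] by (auto simp: rel_interior_closed_segment)
  then have "closed_segment a b \<subseteq> T \<inter> T'"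
    using subset_of_face_of[OF inter_face[OF assms(1,2)] seg] by blast
  then have "a \<in> T'" "b \<in> T'" by auto
  then have "a extreme_point_of T'" "b extreme_point_of T'"
    using mesh_vertex_in_triangle mesh_vertices_of_triangle assms(1,2) v by blast+
  then show thesis using triangle_through[OF assms(2)] d that by blast
qed

text \<open>Triangles on the same side of a common edge would overlap off the edge; a face that contains
  the edge and a point off its line is the whole triangle, so the two triangles would coincide.\<close>

lemma opposite_sides:
  assumes T: "T \<in> \<tau>" "T' \<in> \<tau>" "T \<noteq> T'" "is_triangle T a b c" "is_triangle T' a b c'"
  shows "area2 a b c * area2 a b c' < 0"
proof (rule ccontr)
  assume "\<not> area2 a b c * area2 a b c' < 0"
  then have "area2 a b c * area2 a b c' > 0"
    using T(4,5) by (simp add: is_triangle_def not_less order_less_le)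
  then obtain x where x: "x \<in> T \<inter> T'" "area2 a b x \<noteq> 0"
    using same_side_triangles_overlap[OF T(4,5)] by blast
  \<comment> \<open>A face that contains the edge and the point \<open>x\<close> off its line is the whole triangle.\<close>
  have full: "F = S"
    if S: "is_triangle S a b d" and F: "F face_of S" "a \<in> F" "b \<in> F" "x \<in> F" for F S d
  proof -
    obtain C where C: "C \<subseteq> {a, b, d}" "F = convex hull C"
      using F(1) S face_of_convex_hull_affine_independent[OF is_triangle_affine_independent[OF S]]
      by (auto simp: is_triangle_def)
    have "d \<in> C"
    proof (rule ccontr)
      assume "d \<notin> C"
      then have "F \<subseteq> closed_segment a b" using C by (auto simp: segment_convex_hull intro!: hull_mono)
      then have "x \<in> closed_segment a b" using F by blast
      then have "area2 a b x = 0"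
        using area2_eq_0_iff_on_line is_triangle_distinct[OF S] by (auto simp: in_segment)
      then show False using x by simp
    qed
    then have "d \<in> F" using C by (simp add: hull_inc)
    then have "S \<subseteq> F"
      using S F face_of_imp_convex[OF F(1)] unfolding is_triangle_def by (simp add: hull_minimal)
    then show "F = S" using face_of_imp_subset[OF F(1)] by blast
  qed
  have ab: "a \<in> T \<inter> T'" "b \<in> T \<inter> T'" using is_triangle_vertices[OF T(4)] is_triangle_vertices[OF T(5)] by auto
  have "T \<inter> T' = T" using full[OF T(4) inter_face[OF T(1,2)] ab] x by blast
  moreover have "T \<inter> T' = T'" using full[OF T(5) inter_face'[OF T(1,2)] ab] x by blast
  ultimately show False using T(3) by blast
qed

text \<open>If an inner point of the edge were in the open domain, a small disc around it would be covered by
  the only triangle at this edge; but the triangle lies on one side of the edge.\<close>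

lemma lone_edge_in_boundary:
  assumes T: "T \<in> \<tau>" "is_triangle T a b c" and lone: "\<And>T' c'. T' \<in> \<tau> \<Longrightarrow> is_triangle T' a b c' \<Longrightarrow> T' = T"
  shows "closed_segment a b \<subseteq> frontier \<Omega>"
proof -
  have seg: "closed_segment a b \<subseteq> T"
    using is_triangle_vertices[OF T(2)] convex_mesh_triangle[OF T(1)] by (simp add: closed_segment_subset)
  have "x \<in> frontier \<Omega>" if x: "x \<in> open_segment a b" for x
  proof (rule ccontr)
    assume nf: "x \<notin> frontier \<Omega>"
    have xT: "x \<in> T" using x seg open_closed_segment by blast
    then have "x \<in> \<Omega>" using nf mesh_triangle_subset[OF T(1)] closure_Un_frontier by blast
    define U where "U = \<Omega> - \<Union>(\<tau> - {T})"
    have "open U" unfolding U_def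
      using open_domain finite_mesh closed_mesh_triangle by (intro open_Diff closed_Union) auto
    moreover have "x \<notin> T'" if "T' \<in> \<tau> - {T}" for T'
      using edge_meets_triangle[OF T(1) _ T(2) x, of T'] lone that by blast
    then have "x \<in> U" using \<open>x \<in> \<Omega>\<close> by (auto simp: U_def)
    ultimately obtain e where e: "e > 0" "ball x e \<subseteq> U" using open_contains_ball by blast
    have "U \<subseteq> T" using Union_mesh closure_subset[of \<Omega>] by (auto simp: U_def)
    \<comment> \<open>The point \<open>y\<close> is moved from \<open>x\<close> by less than \<open>e\<close>, away from \<open>c\<close>.\<close>
    define n where "n = norm (c - a) + 1"
    have n: "n > 0" "norm (c - a) < n" by (simp_all add: n_def add_nonneg_pos)
    define y where "y = x - (e / n) *\<^sub>R (c - a)"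
    have "norm ((e / n) *\<^sub>R (c - a)) < e"
      using n e by (simp add: divide_less_eq mult.commute)
    then have "y \<in> ball x e" by (simp add: y_def dist_norm)
    then have "y \<in> T" using e \<open>U \<subseteq> T\<close> by blast
    then have "0 \<le> area2 a b y / area2 a b c" using is_triangle_mem_iff[OF T(2)] by blast
    moreover have "area2 a b x = 0"
      using x area2_eq_0_iff_on_line is_triangle_distinct[OF T(2)] by (auto simp: in_segment)
    then have "area2 a b y = - (e / n) * area2 a b c"
      by (simp add: y_def area2_def inner_diff_left algebra_simps)
    ultimately show False using e n T(2) by (simp add: is_triangle_def divide_le_0_iff not_less[symmetric] zero_le_divide_iff)
  qed
  then have "closure (open_segment a b) \<subseteq> frontier \<Omega>" by (intro closure_minimal) auto
  then show ?thesis using is_triangle_distinct[OF T(2)] by simp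
qed

text \<open>The two triangles lie on opposite sides of the edge and together cover a neighbourhood of
  \<open>x\<close>.\<close>

lemma shared_edge_not_in_boundary:
  assumes T: "T \<in> \<tau>" "T' \<in> \<tau>" "T \<noteq> T'" "is_triangle T a b c" "is_triangle T' a b c'"
    and x: "x \<in> open_segment a b"
  shows "x \<notin> frontier \<Omega>"
proof -
  obtain U where U: "open U" "x \<in> U" "\<And>y. y \<in> U \<Longrightarrow> 0 \<le> area2 a b y / area2 a b c \<Longrightarrow> y \<in> T"
    using is_triangle_interior_edge_neighbourhood[OF T(4) x] by blast
  obtain U' where U': "open U'" "x \<in> U'" "\<And>y. y \<in> U' \<Longrightarrow> 0 \<le> area2 a b y / area2 a b c' \<Longrightarrow> y \<in> T'"
    using is_triangle_interior_edge_neighbourhood[OF T(5) x] by blast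
  have "y \<in> closure \<Omega>" if "y \<in> U \<inter> U'" for y
  proof -
    have "0 \<le> area2 a b y / area2 a b c \<or> 0 \<le> area2 a b y / area2 a b c'"
      using opposite_sides[OF T] by (auto simp: zero_le_divide_iff mult_less_0_iff)
    then have "y \<in> T \<or> y \<in> T'" using U U' that by blast
    then show ?thesis using mesh_triangle_subset T by blast
  qed
  then have "U \<inter> U' \<subseteq> interior (closure \<Omega>)" using U U' by (intro interior_maximal) auto
  then show ?thesis using boundary_not_interior U U' by blast
qed

text \<open>An edge is either shared by two triangles, whose incenters then lie on opposite sides of it, or it
  belongs to the boundary and has its midpoint as singular vertex.\<close>

lemma singular_vertex_exists:
  assumes T: "T \<in> \<tau>" "is_triangle T a b c"
  obtains s where "s \<in> open_segment a b" "singular_vertex \<Omega> \<tau> (closed_segment a b) s"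
proof (cases "\<exists>T'\<in>\<tau>. \<exists>c'. T' \<noteq> T \<and> is_triangle T' a b c'")
  case True
  then obtain T' c' where T': "T' \<in> \<tau>" "T' \<noteq> T" "is_triangle T' a b c'" by blast
  obtain s where s: "s \<in> open_segment a b" "s \<in> closed_segment (incenter T) (incenter T')"
    using incenter_segment_crosses_edge[OF T(2) T'(3) opposite_sides[OF T(1) T'(1) T'(2)[symmetric] T(2) T'(3)]] .
  have "closed_segment a b edge_of T" "closed_segment a b edge_of T'"
    using is_triangle_edge T(2) T'(3) by blast+
  then have "singular_vertex \<Omega> \<tau> (closed_segment a b) s"
    unfolding singular_vertex_def
    using T(1) T'(1) T'(2)[symmetric] s(2) open_closed_segment[OF s(1)]
    by (intro disjI1 bexI[of _ T] bexI[of _ T'] conjI IntI)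
  then show thesis using that s by blast
next
  case False
  then have "closed_segment a b \<subseteq> frontier \<Omega>" using lone_edge_in_boundary[OF T] by blast
  then have "closed_segment a b \<in> exterior_edges \<Omega> \<tau>"
    using T by (auto simp: exterior_edges_def segment_in_mesh_edges_iff)
  then have "singular_vertex \<Omega> \<tau> (closed_segment a b) (midpoint a b)"
    unfolding singular_vertex_def by (intro disjI2 conjI exI[of _ a] exI[of _ b] refl)
  moreover have "midpoint a b \<in> open_segment a b" using is_triangle_distinct[OF T(2)] by simp
  ultimately show thesis using that by blast
qed

text \<open>Both pieces are nondegenerate, because \<open>s\<close> is an inner point of the edge and the incenter is off its
  line. Their interiors are open subsets of the domain on which the field is affine.\<close>

lemma V_h_solenoidal_pieces:
  assumes v: "v \<in> V_h \<Omega> \<tau>" and T: "T \<in> \<tau>" "is_triangle T a b c"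
  obtains s where "s \<in> open_segment a b" "solenoidal_on (convex hull {incenter T, a, s}) v"
    "solenoidal_on (convex hull {incenter T, b, s}) v"
proof -
  obtain s where s: "s \<in> open_segment a b" "singular_vertex \<Omega> \<tau> (closed_segment a b) s"
    using singular_vertex_exists[OF T] .
  obtain \<theta> where th: "0 < \<theta>" "\<theta> < 1" and s_eq: "s = (1 - \<theta>) *\<^sub>R a + \<theta> *\<^sub>R b"
    using s(1) by (auto simp: in_segment)
  define I where "I = incenter T"
  obtain r where r: "r > 0" "area2 a b I = r * area2 a b c" using incenter_side[OF T(2)] unfolding I_def by blast
  have nondeg: "area2 I w s \<noteq> 0" if "w \<in> {a, b}" for w
  proof -
    have "area2 I a s = \<theta> * area2 a b I" "area2 I b s = - (1 - \<theta>) * area2 a b I"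
      by (simp_all add: s_eq area2_def plane_simps algebra_simps)
    moreover have "area2 a b I \<noteq> 0" using r T(2) by (simp add: is_triangle_def)
    ultimately show ?thesis using th that by auto
  qed
  have "I \<in> T"
    using incenter_barycentric[OF T(2)] is_triangle_barycentric[OF T(2)] unfolding I_def by (metis less_imp_le)
  moreover have "closed_segment a b \<subseteq> T"
    using is_triangle_vertices[OF T(2)] convex_mesh_triangle[OF T(1)] by (simp add: closed_segment_subset)
  ultimately have sub: "convex hull {I, w, s} \<subseteq> T" if "w \<in> {a, b}" for w
    using that s(1) open_closed_segment convex_mesh_triangle[OF T(1)] by (intro hull_minimal) auto
  have "solenoidal_on (convex hull {I, w, s}) v" if w: "w \<in> {a, b}" for w
  proof -
    have "closed_segment a b edge_of T" by (rule is_triangle_edge[OF T(2)])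
    then have ps: "convex hull {I, w, s} \<in> powell_sabin \<Omega> \<tau>"
      unfolding powell_sabin_def I_def using T(1) s(2) w
      by (intro CollectI exI[of _ T] exI[of _ "closed_segment a b"] exI[of _ w] exI[of _ s])
         (auto simp: extreme_point_of_segment)
    obtain A :: "real^2^2" and d where A: "\<And>x. x \<in> convex hull {I, w, s} \<Longrightarrow> v x = A *v x + d"
      using v ps unfolding V_h_def X_h_def by blast
    have tri: "is_triangle (convex hull {I, w, s}) I w s" using nondeg[OF w] by (simp add: is_triangle_def)
    have "card {I, w, s} = 3" using is_triangle_distinct[OF tri] by auto
    then have "interior (convex hull {I, w, s}) \<noteq> {}"
      using is_triangle_affine_independent[OF tri] interior_convex_hull_eq_empty[of "{I, w, s}"] by simp
    moreover have "interior (convex hull {I, w, s}) \<subseteq> \<Omega>"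
      using interior_mono[OF sub[OF w]] interior_mesh_triangle[OF T(1)] by blast
    moreover have "has_weak_divergence \<Omega> v (\<lambda>x. 0)" using v by (simp add: V_h_def)
    ultimately have "A $ 1 $ 1 + A $ 2 $ 2 = 0"
      using affine_weakly_solenoidal_imp_tracefree[of "interior (convex hull {I, w, s})" \<Omega> v A d,
          OF open_interior] A[OF subsetD[OF interior_subset]] by simp
    then show ?thesis unfolding solenoidal_on_def using A by (intro exI[of _ A] exI[of _ d]) simp
  qed
  then show thesis using that[OF s(1)] by (simp add: I_def)
qed

section \<open>Unisolvence\<close>

lemma edge_flux_eq_spokes:
  assumes "v \<in> V_h \<Omega> \<tau>" "T \<in> \<tau>" "is_triangle T a b c"
  shows "edge_flux v a b = chord_flux v a (incenter T) - chord_flux v b (incenter T)"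
proof -
  obtain s where "s \<in> open_segment a b" "solenoidal_on (convex hull {incenter T, a, s}) v"
    "solenoidal_on (convex hull {incenter T, b, s}) v"
    using V_h_solenoidal_pieces[OF assms] .
  then show ?thesis using edge_flux_eq_spoke_flux is_triangle_distinct[OF assms(3)] by blast
qed

text \<open>Each edge flux is a difference of spoke fluxes at the common incenter, so the sum around
  the triangle telescopes.\<close>

lemma edge_flux_closed:
  assumes "v \<in> V_h \<Omega> \<tau>" "T \<in> \<tau>" "is_triangle T a b c"
  shows "edge_flux v b a = - edge_flux v a b"
    and "edge_flux v a b + edge_flux v b c + edge_flux v c a = 0"
  using edge_flux_eq_spokes[OF assms(1,2)] assms(3) is_triangle_rotate is_triangle_swap
  by (smt (verit))+

text \<open>On a macro-triangle, the field vanishes at the three vertices and the three singular vertices; its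
  value at the incenter is parallel to each of the three edges and hence zero. Affine
  fields that vanish at the corners of a piece vanish on the piece.\<close>

lemma V_h_unisolvent:
  assumes v: "v \<in> V_h \<Omega> \<tau>" and vertices: "\<And>z. z \<in> mesh_vertices \<tau> \<Longrightarrow> v z = 0"
    and fluxes: "\<And>a b. closed_segment a b \<in> mesh_edges \<tau> \<Longrightarrow> edge_flux v a b = 0"
  shows "v = 0"
proof
  fix x
  show "v x = 0 x"
  proof (cases "x \<in> closure \<Omega>")
    case False
    then show ?thesis using v by (simp add: V_h_def X_h_def)
  next
    case True
    then obtain T where T: "T \<in> \<tau>" "x \<in> T" using Union_mesh by blast
    obtain a b c where tri: "is_triangle T a b c" using mesh_triangle[OF T(1)] .
    define I where "I = incenter T"
    have edge: "\<exists>s. s \<in> open_segment p q \<and> v s = 0 \<and> v I \<bullet> rot (q - p) = 0 \<and> v p = 0 \<and> v q = 0 \<and>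
          solenoidal_on (convex hull {I, p, s}) v \<and> solenoidal_on (convex hull {I, q, s}) v"
      if pq: "is_triangle T p q r" for p q r
    proof -
      obtain s where s: "s \<in> open_segment p q" "solenoidal_on (convex hull {I, p, s}) v"
        "solenoidal_on (convex hull {I, q, s}) v"
        using V_h_solenoidal_pieces[OF v T(1) pq] unfolding I_def .
      have pv: "v p = 0" "v q = 0"
        using vertices mesh_vertices_of_triangle[OF T(1)] is_triangle_vertices[OF pq] by blast+
      have "edge_flux v p q = 0"
        using fluxes segment_in_mesh_edges_iff pq T(1) by blast
      moreover have "area2 p q I \<noteq> 0"
        using incenter_side[OF pq] pq unfolding I_def is_triangle_def by (metis less_irrefl mult_eq_0_iff)
      ultimately have "v s = 0 \<and> v I \<bullet> rot (q - p) = 0"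
        using solenoidal_split_edge_zero[OF s(2,3,1) _ pv] is_triangle_distinct[OF pq] by (simp add: area2_def)
      then show ?thesis using s pv by blast
    qed
    note bca = is_triangle_rotate[OF tri]
    have vI: "v I = 0"
    proof (rule orthogonal_to_independent_pair)
      show "v I \<bullet> rot (b - a) = 0" "v I \<bullet> rot (c - b) = 0" using edge[OF tri] edge[OF bca] by blast+
      have "(b - a) \<bullet> rot (c - b) = - area2 a b c" by (simp add: area2_def plane_simps algebra_simps)
      then show "(b - a) \<bullet> rot (c - b) \<noteq> 0" using tri by (simp add: is_triangle_def)
    qed
    have "v x = 0" if pq: "is_triangle T p q r" "x \<in> convex hull {I, p, q}" for p q r
    proof -
      obtain s where s: "s \<in> open_segment p q" "v s = 0" "v p = 0" "v q = 0"
          "solenoidal_on (convex hull {I, p, s}) v" "solenoidal_on (convex hull {I, q, s}) v"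
        using edge[OF pq(1)] by blast
      consider "x \<in> convex hull {I, p, s}" | "x \<in> convex hull {I, q, s}"
        using triangle_split_at_edge_point[OF s(1) pq(2)] by blast
      then show ?thesis
        by cases (use solenoidal_on_hull_zero s vI in blast)+
    qed
    then have "v x = 0"
      using triangle_split_at_incenter[OF tri T(2)] tri bca is_triangle_rotate[OF bca] unfolding I_def by blast
    then show ?thesis by simp
  qed
qed

section \<open>Connectedness of the vertex graphs\<close>

text \<open>All vertices of a triangle agree about \<open>P\<close>. The union of the triangles with \<open>P\<close> and the union of those
  without are closed, and disjoint since intersecting triangles share a vertex; they
  cover the connected set \<^term>\<open>closure \<Omega>\<close>.\<close>

lemma mesh_vertex_induct:
  assumes step: "\<And>a b. closed_segment a b \<in> mesh_edges \<tau> \<Longrightarrow> P a \<Longrightarrow> P b"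
    and z: "z \<in> mesh_vertices \<tau>" "P z" and w: "w \<in> mesh_vertices \<tau>"
  shows "P w"
proof (rule ccontr)
  assume "\<not> P w"
  define A where "A = \<Union>{T \<in> \<tau>. \<exists>u. u extreme_point_of T \<and> P u}"
  define B where "B = \<Union>{T \<in> \<tau>. \<exists>u. u extreme_point_of T \<and> \<not> P u}"
  have edge: "P u \<longleftrightarrow> P u'" if "T \<in> \<tau>" "u extreme_point_of T" "u' extreme_point_of T" for T u u'
  proof (cases "u = u'")
    case False
    have "closed_segment u u' \<in> mesh_edges \<tau>"
      unfolding segment_in_mesh_edges_iff using triangle_through[OF that False] that(1) by blast
    then show ?thesis using step[of u u'] step[of u' u] by (auto simp: closed_segment_commute)
  qed simp
  have "A \<inter> B = {}"
  proof (rule ccontr)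
    assume "A \<inter> B \<noteq> {}"
    then obtain x T T' u u' where x: "x \<in> T \<inter> T'" and T: "T \<in> \<tau>" "u extreme_point_of T" "P u"
      and T': "T' \<in> \<tau>" "u' extreme_point_of T'" "\<not> P u'"
      unfolding A_def B_def by blast
    have F: "(T \<inter> T') face_of T" by (rule inter_face[OF T(1) T'(1)])
    have "compact (T \<inter> T')"
      using bounded_domain bounded_subset[OF bounded_closure mesh_triangle_subset[OF T(1)]]
        closed_mesh_triangle T(1) T'(1) by (simp add: compact_eq_bounded_closed bounded_Int closed_Int)
    \<comment> \<open>A nonempty compact convex set has an extreme point, which is a common vertex here.\<close>
    then obtain d where "d extreme_point_of (T \<inter> T')"
      using extreme_point_exists_convex face_of_imp_convex[OF F] x by (metis empty_iff)
    then have "d extreme_point_of T" "d \<in> T'"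
      using extreme_point_of_face[OF F] by (auto simp: extreme_point_of_def)
    then have "d extreme_point_of T'"
      using mesh_vertex_in_triangle mesh_vertices_of_triangle T(1) T'(1) by blast
    then show False using edge T T' \<open>d extreme_point_of T\<close> by blast
  qed
  moreover have "closed A" "closed B"
    unfolding A_def B_def using finite_mesh closed_mesh_triangle by (intro closed_Union; auto)+
  moreover have "closure \<Omega> \<subseteq> A \<union> B"
  proof
    fix x assume "x \<in> closure \<Omega>"
    then obtain T where T: "T \<in> \<tau>" "x \<in> T" using Union_mesh by blast
    obtain a b c where "is_triangle T a b c" using mesh_triangle[OF T(1)] .
    then have "a extreme_point_of T" by (rule is_triangle_vertices)
    then show "x \<in> A \<union> B" using T unfolding A_def B_def by blast
  qed
  moreover have "z \<in> A" "w \<in> B"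
    using z w \<open>\<not> P w\<close> unfolding mesh_vertices_def A_def B_def by (auto simp: extreme_point_of_def)
  moreover have "z \<in> closure \<Omega>" "w \<in> closure \<Omega>"
    using z w Union_mesh unfolding mesh_vertices_def by (auto simp: extreme_point_of_def)
  moreover have "connected (closure \<Omega>)" using connected_domain by (rule connected_imp_connected_closure)
  ultimately show False unfolding connected_closed by blast
qed

lemma finite_exterior_edges: "finite (exterior_edges \<Omega> \<tau>)"
proof (rule finite_subset)
  show "exterior_edges \<Omega> \<tau> \<subseteq> (\<lambda>(a, b). closed_segment a b) ` (mesh_vertices \<tau> \<times> mesh_vertices \<tau>)"
  proof
    fix e assume "e \<in> exterior_edges \<Omega> \<tau>"
    then have "e \<in> mesh_edges \<tau>" by (simp add: exterior_edges_def)
    then obtain a b where "e = closed_segment a b" "a \<in> mesh_vertices \<tau>" "b \<in> mesh_vertices \<tau>"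
      using mesh_edge_segment by metis
    then show "e \<in> (\<lambda>(a, b). closed_segment a b) ` (mesh_vertices \<tau> \<times> mesh_vertices \<tau>)" by force
  qed
qed (use finite_mesh_vertices in simp)

text \<open>A boundary point that is not a vertex lies on an edge, since the interiors of the triangles
  lie in the open domain, and this edge is not shared. Vertices on the boundary are limits of such points, as the
  boundary has no isolated points, and there are only finitely many exterior edges.\<close>

lemma boundary_point_on_exterior_edge:
  assumes "x \<in> frontier \<Omega>"
  shows "\<exists>e\<in>exterior_edges \<Omega> \<tau>. x \<in> e"
proof -
  define F where "F = \<Union>(exterior_edges \<Omega> \<tau>)"
  have non_vertex: "x \<in> F" if x: "x \<in> frontier \<Omega>" "x \<notin> mesh_vertices \<tau>" for x
  proof -
    have "x \<in> closure \<Omega>" using x(1) by (simp add: frontier_def)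
    then obtain T where T: "T \<in> \<tau>" "x \<in> T" using Union_mesh by blast
    obtain a b c where tri: "is_triangle T a b c" using mesh_triangle[OF T(1)] .
    define D where "D = area2 a b c"
    have D: "D \<noteq> 0" using tri by (simp add: is_triangle_def D_def)
    have on_edge: "x \<in> F" if pq: "is_triangle T p q r" "area2 p q x = 0" for p q r
    proof -
      obtain u v w where uvw: "0 \<le> u" "0 \<le> v" "0 \<le> w" "u + v + w = 1" "x = u *\<^sub>R p + v *\<^sub>R q + w *\<^sub>R r"
        using T(2) is_triangle_barycentric[OF pq(1)] by auto
      then have "w * area2 p q r = 0" using pq(2) area2_convex_combination by simp
      then have "w = 0" using pq(1) by (simp add: is_triangle_def)
      then have "x \<in> closed_segment p q" using uvw by (auto simp: in_segment intro!: exI[of _ v])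
      moreover have "x \<noteq> p" "x \<noteq> q"
        using x(2) mesh_vertices_of_triangle[OF T(1)] is_triangle_vertices[OF pq(1)] by blast+
      ultimately have xo: "x \<in> open_segment p q" by (simp add: open_segment_def)
      have "closed_segment p q \<subseteq> frontier \<Omega>"
      proof (rule lone_edge_in_boundary[OF T(1) pq(1)])
        fix T' c' assume "T' \<in> \<tau>" "is_triangle T' p q c'"
        then show "T' = T" using shared_edge_not_in_boundary[OF T(1) _ _ pq(1) _ xo] x(1) by blast
      qed
      moreover have "closed_segment p q \<in> mesh_edges \<tau>"
        using segment_in_mesh_edges_iff T(1) pq(1) by blast
      ultimately have "closed_segment p q \<in> exterior_edges \<Omega> \<tau>" by (simp add: exterior_edges_def)
      then show ?thesis using \<open>x \<in> closed_segment p q\<close> by (auto simp: F_def)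
    qed
    show ?thesis
    proof (cases "area2 b c x = 0 \<or> area2 c a x = 0 \<or> area2 a b x = 0")
      case True
      then show ?thesis using on_edge tri is_triangle_rotate by blast
    next
      case False
      define U where "U = {y. 0 < area2 b c y / D} \<inter> {y. 0 < area2 c a y / D} \<inter> {y. 0 < area2 a b y / D}"
      have "open U" unfolding U_def
        by (intro open_Int open_Collect_less continuous_intros) (use D in auto)
      moreover have "U \<subseteq> T" unfolding U_def D_def by (auto simp: is_triangle_mem_iff[OF tri] less_imp_le)
      moreover have "x \<in> U"
        using T(2) False D unfolding U_def is_triangle_mem_iff[OF tri] by (simp add: order_less_le flip: D_def)
      ultimately have "x \<in> interior T" using interior_maximal by blast
      then have "x \<in> \<Omega>" using interior_mesh_triangle[OF T(1)] by blast
      then show ?thesis using x(1) open_domain by (simp add: frontier_def interior_open)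
    qed
  qed
  have "finite (exterior_edges \<Omega> \<tau>)" by (rule finite_exterior_edges)
  moreover have "closed e" if e: "e \<in> exterior_edges \<Omega> \<tau>" for e
  proof -
    have "e \<in> mesh_edges \<tau>" using e by (simp add: exterior_edges_def)
    then obtain a b where "e = closed_segment a b" using mesh_edge_segment by metis
    then show ?thesis by simp
  qed
  ultimately have "closed F" unfolding F_def by (intro closed_Union) auto
  have "frontier \<Omega> = (frontier \<Omega> \<inter> mesh_vertices \<tau>) \<union> (frontier \<Omega> - mesh_vertices \<tau>)" by blast
  then have "x islimpt (frontier \<Omega> - mesh_vertices \<tau>)"
    using boundary_perfect[OF assms] islimpt_Un_finite[of "frontier \<Omega> \<inter> mesh_vertices \<tau>"] finite_mesh_vertices
    by (metis finite_Int)
  then have "x islimpt F" by (rule islimpt_subset) (use non_vertex in blast)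
  then have "x \<in> F" using \<open>closed F\<close> closed_limpt by blast
  then show ?thesis by (auto simp: F_def)
qed

lemma exterior_edge_segment:
  assumes "e \<in> exterior_edges \<Omega> \<tau>"
  obtains a b where "e = closed_segment a b" "a \<in> exterior_vertices \<Omega> \<tau>" "b \<in> exterior_vertices \<Omega> \<tau>"
proof -
  have e: "e \<in> mesh_edges \<tau>" "e \<subseteq> frontier \<Omega>" using assms by (auto simp: exterior_edges_def)
  obtain a b where ab: "e = closed_segment a b" "a \<in> mesh_vertices \<tau>" "b \<in> mesh_vertices \<tau>"
    using mesh_edge_segment[OF e(1)] by metis
  then have "a \<in> frontier \<Omega>" "b \<in> frontier \<Omega>" using e(2) by auto
  then show thesis using that ab by (simp add: exterior_vertices_def)
qed

text \<open>Inner points of an edge belong to no other edge, so a common point is an endpoint of both, or the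
  edges are equal.\<close>

lemma mesh_edges_meet_at_vertex:
  assumes e: "closed_segment a b \<in> mesh_edges \<tau>" and e': "closed_segment a' b' \<in> mesh_edges \<tau>"
    and x: "x \<in> closed_segment a b" "x \<in> closed_segment a' b'"
  shows "{a, b} \<inter> {a', b'} \<noteq> {}"
proof -
  have vertex: "x \<in> {p, q}" if pq: "closed_segment p q \<in> mesh_edges \<tau>" "x \<in> closed_segment p q" "x \<in> mesh_vertices \<tau>" for p q
  proof -
    obtain S d where S: "S \<in> \<tau>" "is_triangle S p q d" using pq(1) segment_in_mesh_edges_iff by blast
    have f: "closed_segment p q face_of S" using is_triangle_edge[OF S(2)] by (simp add: edge_of_def)
    then have "x \<in> S" using pq(2) face_of_imp_subset by blast
    then have "x extreme_point_of (closed_segment p q)"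
      using mesh_vertex_in_triangle[OF pq(3) S(1)] extreme_point_of_face[OF f] pq(2) by blast
    then show ?thesis by (simp add: extreme_point_of_segment)
  qed
  show ?thesis
  proof (cases "x \<in> mesh_vertices \<tau>")
    case True
    then show ?thesis using vertex[OF e x(1)] vertex[OF e' x(2)] by blast
  next
    case False
    obtain T c where T: "T \<in> \<tau>" "is_triangle T a b c" using e segment_in_mesh_edges_iff by blast
    obtain T' c' where T': "T' \<in> \<tau>" "is_triangle T' a' b' c'" using e' segment_in_mesh_edges_iff by blast
    have "x \<noteq> a" "x \<noteq> b" "x \<noteq> a'" "x \<noteq> b'"
      using False mesh_vertices_of_triangle T T' is_triangle_vertices(1,2) by metis+
    then have xo: "x \<in> open_segment a b" "x \<in> open_segment a' b'" using x by (auto simp: open_segment_def)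
    have f': "closed_segment a' b' face_of T'" using is_triangle_edge[OF T'(2)] by (simp add: edge_of_def)
    then have "x \<in> T'" using x(2) face_of_imp_subset by blast
    then obtain d where "is_triangle T' a b d" using edge_meets_triangle[OF T(1) T'(1) T(2) xo(1)] by blast
    then have f: "closed_segment a b face_of T'" using is_triangle_edge by (auto simp: edge_of_def)
    have "a \<noteq> b" "a' \<noteq> b'" using is_triangle_distinct[OF T(2)] is_triangle_distinct[OF T'(2)] by auto
    then have "closed_segment a b = closed_segment a' b'"
      using face_of_eq[OF f f'] xo by (auto simp: rel_interior_closed_segment)
    then show ?thesis by (auto simp: closed_segment_eq)
  qed
qed

text \<open>The same connectedness argument as for the triangles, applied to the exterior edges and the
  boundary of the domain, which is the image of a closed curve.\<close>

lemma exterior_vertex_induct: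
  assumes step: "\<And>a b. closed_segment a b \<in> exterior_edges \<Omega> \<tau> \<Longrightarrow> P a \<Longrightarrow> P b"
    and z: "z \<in> exterior_vertices \<Omega> \<tau>" "P z" and w: "w \<in> exterior_vertices \<Omega> \<tau>"
  shows "P w"
proof (rule ccontr)
  assume "\<not> P w"
  let ?E = "exterior_edges \<Omega> \<tau>"
  define A where "A = \<Union>{e \<in> ?E. \<exists>a b. e = closed_segment a b \<and> P a}"
  define B where "B = \<Union>{e \<in> ?E. \<exists>a b. e = closed_segment a b \<and> \<not> P a}"
  have step': "P a \<longleftrightarrow> P b" if "closed_segment a b \<in> ?E" for a b
    using step[of a b] step[of b a] that by (auto simp: closed_segment_commute)
  have "A \<inter> B = {}"
  proof (rule ccontr)
    assume "A \<inter> B \<noteq> {}"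
    then obtain x a b a' b' where x: "x \<in> closed_segment a b" "x \<in> closed_segment a' b'"
      and e: "closed_segment a b \<in> ?E" "closed_segment a' b' \<in> ?E" and P: "P a" "\<not> P a'"
      unfolding A_def B_def by blast
    have "{a, b} \<inter> {a', b'} \<noteq> {}"
      using mesh_edges_meet_at_vertex[OF _ _ x] e by (simp add: exterior_edges_def)
    then show False using step'[OF e(1)] step'[OF e(2)] P by auto
  qed
  moreover have "closed A" "closed B"
    unfolding A_def B_def using finite_exterior_edges by (intro closed_Union; auto)+
  moreover have "frontier \<Omega> \<subseteq> A \<union> B"
  proof
    fix x assume "x \<in> frontier \<Omega>"
    then obtain e where e: "e \<in> ?E" "x \<in> e" using boundary_point_on_exterior_edge by blast
    obtain a b where "e = closed_segment a b" using exterior_edge_segment[OF e(1)] by metis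
    then show "x \<in> A \<union> B" using e unfolding A_def B_def by blast
  qed
  moreover have end_point: "\<exists>b. closed_segment u b \<in> ?E" if u: "u \<in> exterior_vertices \<Omega> \<tau>" for u
  proof -
    have "u \<in> frontier \<Omega>" using u by (simp add: exterior_vertices_def)
    then obtain e where e: "e \<in> ?E" "u \<in> e" using boundary_point_on_exterior_edge by blast
    obtain a b where ab: "e = closed_segment a b" using exterior_edge_segment[OF e(1)] by metis
    have "closed_segment a b \<in> mesh_edges \<tau>" using e ab by (simp add: exterior_edges_def)
    then obtain T c where T: "T \<in> \<tau>" "is_triangle T a b c" using segment_in_mesh_edges_iff by blast
    have f: "e face_of T" using is_triangle_edge[OF T(2)] ab by (simp add: edge_of_def)
    then have "u \<in> T" using e(2) face_of_imp_subset by blast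
    then have "u extreme_point_of e"
      using mesh_vertex_in_triangle[OF _ T(1)] extreme_point_of_face[OF f] e(2) u by (auto simp: exterior_vertices_def)
    then have "u = a \<or> u = b" by (simp add: ab extreme_point_of_segment)
    then show ?thesis using e(1) ab by (metis closed_segment_commute)
  qed
  moreover have "z \<in> A" "w \<in> B"
    using end_point[OF z(1)] end_point[OF w] z(2) \<open>\<not> P w\<close> unfolding A_def B_def by auto
  moreover have "z \<in> frontier \<Omega>" "w \<in> frontier \<Omega>"
    using z w by (auto simp: exterior_vertices_def)
  ultimately show False using connected_boundary unfolding connected_closed by blast
qed

section \<open>Potentials of cocycles\<close>

text \<open>Only the values on pairs of adjacent vertices matter.\<close>

definition cocycle :: "(plane \<Rightarrow> plane \<Rightarrow> 'a::ab_group_add) \<Rightarrow> bool" where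
  "cocycle h \<longleftrightarrow>
     (\<forall>T\<in>\<tau>. \<forall>a b c. is_triangle T a b c \<longrightarrow> h b a = - h a b \<and> h a b + h b c + h c a = 0)"

text \<open>An affine potential on a single triangle, normalized to be zero at one of the vertices.\<close>

lemma integral_cocycle_local_potential:
  fixes h :: "plane \<Rightarrow> plane \<Rightarrow> int"
  assumes h: "cocycle h" and T: "T \<in> \<tau>"
  shows "\<exists>(\<gamma> :: plane) \<kappa> :: real. (\<forall>u. u extreme_point_of T \<longrightarrow> \<gamma> \<bullet> u + \<kappa> \<in> \<int>) \<and>
     (\<forall>u w. u extreme_point_of T \<longrightarrow> w extreme_point_of T \<longrightarrow> u \<noteq> w \<longrightarrow> \<gamma> \<bullet> w - \<gamma> \<bullet> u = of_int (h u w))"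
proof -
  obtain a b c where tri: "is_triangle T a b c" using mesh_triangle[OF T] .
  obtain \<gamma> \<kappa> where g: "\<gamma> \<bullet> a + \<kappa> = 0" "\<gamma> \<bullet> b + \<kappa> = of_int (h a b)" "\<gamma> \<bullet> c + \<kappa> = of_int (h a c)"
    using affine_interpolation[OF tri] by metis
  note bca = is_triangle_rotate[OF tri]
  note cab = is_triangle_rotate[OF bca]
  have alt: "h b a = - h a b" "h c b = - h b c" "h a c = - h c a" and sum: "h a b + h b c + h c a = 0"
    using h T tri bca cab unfolding cocycle_def by blast+
  have "h b c = h a c - h a b" using alt sum by simp
  then have "real_of_int (h b c) = real_of_int (h a c) - real_of_int (h a b)" by simp
  then have diff: "\<gamma> \<bullet> b - \<gamma> \<bullet> a = of_int (h a b)" "\<gamma> \<bullet> c - \<gamma> \<bullet> b = of_int (h b c)"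
    "\<gamma> \<bullet> c - \<gamma> \<bullet> a = of_int (h a c)" using g by simp_all
  then have "\<gamma> \<bullet> a - \<gamma> \<bullet> b = of_int (h b a)" "\<gamma> \<bullet> b - \<gamma> \<bullet> c = of_int (h c b)"
    "\<gamma> \<bullet> a - \<gamma> \<bullet> c = of_int (h c a)" using alt by simp_all
  moreover have "\<gamma> \<bullet> a + \<kappa> \<in> \<int>" "\<gamma> \<bullet> b + \<kappa> \<in> \<int>" "\<gamma> \<bullet> c + \<kappa> \<in> \<int>"
    unfolding g by simp_all
  ultimately show ?thesis
    unfolding is_triangle_vertex_iff[OF tri] using diff
    by (intro exI[of _ \<gamma>] exI[of _ \<kappa>]) blast
qed

text \<open>The local potentials \<open>l T\<close> differ by integers where triangles meet, so they define one continuous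
  map \<open>f\<close> from the closed domain to the circle. It has a continuous logarithm \<open>g\<close>, as the closed domain
  is Borsukian. On each triangle \<open>g / (2 \<pi>)\<close> differs from \<open>l T\<close> by a continuous integer-valued
  function, that is, by a constant, and so has the same differences between vertices.\<close>

lemma integral_cocycle_potential:
  fixes h :: "plane \<Rightarrow> plane \<Rightarrow> int"
  assumes h: "cocycle h"
  obtains q :: "plane \<Rightarrow> real"
    where "\<And>T a b c. T \<in> \<tau> \<Longrightarrow> is_triangle T a b c \<Longrightarrow> q b - q a = of_int (h a b)"
proof -
  obtain \<gamma> :: "plane set \<Rightarrow> plane" and \<kappa> :: "plane set \<Rightarrow> real" where
      int: "\<And>T u. T \<in> \<tau> \<Longrightarrow> u extreme_point_of T \<Longrightarrow> \<gamma> T \<bullet> u + \<kappa> T \<in> \<int>"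
    and diff: "\<And>T u w. T \<in> \<tau> \<Longrightarrow> u extreme_point_of T \<Longrightarrow> w extreme_point_of T \<Longrightarrow> u \<noteq> w
            \<Longrightarrow> \<gamma> T \<bullet> w - \<gamma> T \<bullet> u = of_int (h u w)"
    using integral_cocycle_local_potential[OF h] by metis
  define l where "l = (\<lambda>T x. \<gamma> T \<bullet> x + \<kappa> T)"
  \<comment> \<open>The difference of the two affine functions takes the same integer value at all vertices of the
    common face, and therefore on the face.\<close>
  have jump: "l T x - l T' x \<in> \<int>" if T: "T \<in> \<tau>" "T' \<in> \<tau>" and x: "x \<in> T" "x \<in> T'" for T T' x
  proof -
    obtain a b c where tri: "is_triangle T a b c" using mesh_triangle[OF T(1)] .
    obtain C where C: "C \<subseteq> {a, b, c}" "T \<inter> T' = convex hull C"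
      using inter_face[OF T] tri face_of_convex_hull_affine_independent[OF is_triangle_affine_independent[OF tri]]
      by (auto simp: is_triangle_def)
    have ex: "u extreme_point_of T" "u extreme_point_of T'" if "u \<in> C" for u
    proof -
      show "u extreme_point_of T" using that C is_triangle_vertex_iff[OF tri] by blast
      moreover have "u \<in> T'" using hull_inc[OF that, of convex] C by blast
      ultimately show "u extreme_point_of T'"
        using mesh_vertex_in_triangle mesh_vertices_of_triangle T by blast
    qed
    have "C \<noteq> {}" using x C by auto
    then obtain d where d: "d \<in> C" by blast
    have "C \<subseteq> {y. (\<gamma> T - \<gamma> T') \<bullet> y = (\<gamma> T - \<gamma> T') \<bullet> d}"
    proof
      fix u assume u: "u \<in> C"
      have "\<gamma> T \<bullet> u - \<gamma> T \<bullet> d = \<gamma> T' \<bullet> u - \<gamma> T' \<bullet> d"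
        using diff[OF T(1) ex(1)[OF d] ex(1)[OF u]] diff[OF T(2) ex(2)[OF d] ex(2)[OF u]] by (cases "u = d") auto
      then show "u \<in> {y. (\<gamma> T - \<gamma> T') \<bullet> y = (\<gamma> T - \<gamma> T') \<bullet> d}" by (simp add: inner_diff_left)
    qed
    then have "T \<inter> T' \<subseteq> {y. (\<gamma> T - \<gamma> T') \<bullet> y = (\<gamma> T - \<gamma> T') \<bullet> d}"
      unfolding C(2) by (rule hull_minimal) (rule convex_hyperplane)
    then have "(\<gamma> T - \<gamma> T') \<bullet> x = (\<gamma> T - \<gamma> T') \<bullet> d" using x by blast
    then have "l T x - l T' x = l T d - l T' d" by (simp add: l_def inner_diff_left)
    also have "\<dots> \<in> \<int>" unfolding l_def using int T ex[OF d] by (intro Ints_diff) blast+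
    finally show ?thesis .
  qed
  have cis_eq: "cis (2 * pi * r) = cis (2 * pi * s)" if "r - s \<in> \<int>" for r s :: real
  proof -
    have "cis (2 * pi * (r - s)) = 1" using that by (rule cis_multiple_2pi)
    then have "cis (2 * pi * s) * cis (2 * pi * (r - s)) = cis (2 * pi * s)" by simp
    then show ?thesis by (simp add: cis_mult algebra_simps)
  qed
  define f where "f = (\<lambda>x. cis (2 * pi * l (SOME T. T \<in> \<tau> \<and> x \<in> T) x))"
  have f_eq: "f x = cis (2 * pi * l T x)" if "T \<in> \<tau>" "x \<in> T" for T x
  proof -
    have "(SOME T. T \<in> \<tau> \<and> x \<in> T) \<in> \<tau> \<and> x \<in> (SOME T. T \<in> \<tau> \<and> x \<in> T)"
      by (rule someI[of "\<lambda>T. T \<in> \<tau> \<and> x \<in> T" T]) (use that in blast)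
    then show ?thesis unfolding f_def using that by (intro cis_eq jump) auto
  qed
  have cont_l: "continuous_on S (l T)" for S T unfolding l_def by (intro continuous_intros)
  have "continuous_on (\<Union>T\<in>\<tau>. T) f"
  proof (rule continuous_on_closed_Union)
    fix T assume T: "T \<in> \<tau>"
    have "continuous_on T (\<lambda>x. cis (2 * pi * l T x))" by (intro continuous_intros cont_l)
    then show "continuous_on T f"
      by (rule continuous_on_eq) (use f_eq[OF T] in simp)
  qed (use finite_mesh closed_mesh_triangle in auto)
  then have "continuous_on (closure \<Omega>) f" using Union_mesh by simp
  moreover have "f \<in> closure \<Omega> \<rightarrow> sphere 0 1" by (simp add: f_def)
  ultimately obtain g where g: "continuous_on (closure \<Omega>) (complex_of_real \<circ> g)"
    "\<And>x. x \<in> closure \<Omega> \<Longrightarrow> f x = exp (\<i> * of_real (g x))"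
    using Borsukian_closure unfolding Borsukian_continuous_logarithm_circle_real by blast
  have contg: "continuous_on (closure \<Omega>) g"
    using continuous_on_Re[OF g(1)] by (simp add: o_def)
  define q where "q = (\<lambda>x. g x / (2 * pi))"
  have "q b - q a = of_int (h a b)" if T: "T \<in> \<tau>" "is_triangle T a b c" for T a b c
  proof -
    note sub = mesh_triangle_subset[OF T(1)]
    define m where "m = (\<lambda>x. q x - l T x)"
    have "continuous_on T m" unfolding m_def q_def
      by (intro continuous_intros cont_l continuous_on_subset[OF contg sub]) simp
    have m_int: "m x \<in> \<int>" if x: "x \<in> T" for x
    proof -
      have "exp (\<i> * of_real (g x)) = exp (\<i> * of_real (2 * pi * l T x))"
        using g(2)[of x] f_eq[OF T(1) x] x sub by (metis cis_conv_exp subsetD)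
      then obtain n :: int where
        "\<i> * of_real (g x) = \<i> * of_real (2 * pi * l T x) + of_int (2 * n) * pi * \<i>"
        using exp_eq by blast
      then have "Im (\<i> * of_real (g x)) = Im (\<i> * of_real (2 * pi * l T x) + of_int (2 * n) * pi * \<i>)"
        by (rule arg_cong)
      then have "g x = 2 * pi * l T x + 2 * pi * of_int n" by simp
      then have "m x = of_int n" by (simp add: m_def q_def field_simps)
      then show ?thesis by simp
    qed
    have "m constant_on T"
    proof (rule continuous_discrete_range_constant)
      show "connected T" using convex_mesh_triangle[OF T(1)] by (rule convex_connected)
      show "\<exists>e>0. \<forall>y. y \<in> T \<and> m y \<noteq> m x \<longrightarrow> e \<le> norm (m y - m x)" if x: "x \<in> T" for x
      proof (intro exI[of _ 1] conjI allI impI)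
        fix y assume y: "y \<in> T \<and> m y \<noteq> m x"
        then have "m y - m x \<in> \<int>" "m y - m x \<noteq> 0" using m_int x by auto
        then show "1 \<le> norm (m y - m x)" using Ints_nonzero_abs_ge1 by fastforce
      qed simp
    qed fact
    then have "m a = m b" using is_triangle_vertices[OF T(2)] unfolding constant_on_def by metis
    moreover have "\<gamma> T \<bullet> b - \<gamma> T \<bullet> a = of_int (h a b)"
      using diff[OF T(1)] is_triangle_vertices[OF T(2)] is_triangle_distinct[OF T(2)] by blast
    ultimately show ?thesis by (simp add: m_def l_def)
  qed
  then show thesis using that by blast
qed

text \<open>Dirichlet's theorem provides a multiple \<open>k\<close> such that all values \<open>k c(a, b)\<close> are close to integers
  \<open>h a b\<close>. The cocycle equations hold exactly for \<open>h\<close>: their defects are integers and sums of at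
  most three errors below \<open>1 / 4\<close>. Dividing the potential of \<open>h\<close> by \<open>k\<close> gives the
  approximate potential of \<open>c\<close>; the shift by \<open>4\<close> in the bound makes the errors small for every \<open>n\<close>.\<close>

lemma real_cocycle_approximate_potential:
  fixes c :: "plane \<Rightarrow> plane \<Rightarrow> real"
  assumes c: "cocycle c"
  obtains \<psi> :: "plane \<Rightarrow> real"
    where "\<psi> z = 0"
      and "\<And>T a b d. T \<in> \<tau> \<Longrightarrow> is_triangle T a b d \<Longrightarrow> \<bar>\<psi> b - \<psi> a - c a b\<bar> \<le> 1 / real (n + 4)"
proof -
  define V where "V = mesh_vertices \<tau> \<times> mesh_vertices \<tau>"
  have "finite V" using finite_mesh_vertices by (simp add: V_def)
  then obtain e where e: "bij_betw e {0..<card V} V" using ex_bij_betw_nat_finite by blast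
  define j where "j = inv_into {0..<card V} e"
  have j: "j x < card V" "e (j x) = x" if "x \<in> V" for x
    using that e bij_betw_inv_into_right[OF e] inv_into_into[of x e "{0..<card V}"]
    by (auto simp: j_def bij_betw_def)
  obtain k p where k: "0 < k" "k \<le> int ((n + 4) ^ card V)" and p: "\<And>i. i < card V \<Longrightarrow>
      \<bar>of_int k * case_prod c (e i) - of_int (p i)\<bar> < 1 / real (n + 4)"
    by (rule Dirichlet_approx_simult[where N = "n + 4" and n = "card V" and \<theta> = "\<lambda>i. case_prod c (e i)"])
       (simp, blast)
  define h where "h = (\<lambda>a b. p (j (a, b)))"
  have h: "\<bar>of_int k * c a b - of_int (h a b)\<bar> < 1 / real (n + 4)" if "(a, b) \<in> V" for a b
    using p[OF j(1)[OF that]] j(2)[OF that] by (simp add: h_def)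
  have quarter: "1 / real (n + 4) \<le> 1 / 4" by (simp add: field_simps)
  have h4: "\<bar>of_int k * c a b - of_int (h a b)\<bar> < 1 / 4" if "(a, b) \<in> V" for a b
    using h[OF that] quarter by (rule less_le_trans)
  have near3: "\<bar>x' + y' + w'\<bar> < 1"
    if "x + y + w = 0" "\<bar>x - x'\<bar> < 1 / 4" "\<bar>y - y'\<bar> < 1 / 4" "\<bar>w - w'\<bar> < 1 / 4" for x y w x' y' w' :: real
    using that unfolding abs_less_iff by simp
  have near2: "\<bar>y' + x'\<bar> < 1"
    if "x = - y" "\<bar>x - x'\<bar> < 1 / 4" "\<bar>y - y'\<bar> < 1 / 4" for x y x' y' :: real
    using that unfolding abs_less_iff by simp
  have closed: "cocycle h"
    unfolding cocycle_def
  proof (intro ballI allI impI)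
    fix T a b d assume T: "T \<in> \<tau>" "is_triangle T a b d"
    have V: "(x, y) \<in> V" if "x \<in> {a, b, d}" "y \<in> {a, b, d}" for x y
      using that mesh_vertices_of_triangle[OF T(1)] is_triangle_vertices[OF T(2)] by (auto simp: V_def)
    have c0: "c b a = - c a b" "c a b + c b d + c d a = 0" using c T unfolding cocycle_def by blast+
    have "of_int k * c a b + of_int k * c b d + of_int k * c d a = 0"
      using c0(2) by (metis distrib_left mult_zero_right)
    then have "\<bar>real_of_int (h a b + h b d + h d a)\<bar> < 1"
      using near3[OF _ h4[OF V] h4[OF V] h4[OF V], of a b b d d a] unfolding of_int_add by simp
    then have "h a b + h b d + h d a = 0" by linarith
    moreover have "of_int k * c b a = - (of_int k * c a b)" using c0 by simp
    then have "\<bar>real_of_int (h a b + h b a)\<bar> < 1"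
      using near2[OF _ h4[OF V] h4[OF V], of b a a b] unfolding of_int_add by simp
    then have "h a b + h b a = 0" by linarith
    ultimately show "h b a = - h a b \<and> h a b + h b d + h d a = 0" by simp
  qed
  then obtain q :: "plane \<Rightarrow> real" where q: "\<And>T a b d. T \<in> \<tau> \<Longrightarrow> is_triangle T a b d \<Longrightarrow> q b - q a = of_int (h a b)"
    using integral_cocycle_potential by blast
  define \<psi> where "\<psi> = (\<lambda>x. (q x - q z) / of_int k)"
  have approx: "\<bar>\<psi> b - \<psi> a - c a b\<bar> \<le> 1 / real (n + 4)" if T: "T \<in> \<tau>" "is_triangle T a b d" for T a b d
  proof -
    have "(a, b) \<in> V"
      using mesh_vertices_of_triangle[OF T(1)] is_triangle_vertices[OF T(2)] by (auto simp: V_def)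
    have k1: "real_of_int k \<ge> 1" using k(1) by simp
    have "\<psi> b - \<psi> a = (q b - q a) / of_int k"
      unfolding \<psi>_def diff_divide_distrib[symmetric] by simp
    then have "of_int k * (\<psi> b - \<psi> a) = of_int (h a b)"
      unfolding q[OF T] using k1 by simp
    then have "of_int k * (\<psi> b - \<psi> a - c a b) = of_int (h a b) - of_int k * c a b"
      unfolding right_diff_distrib[of _ "\<psi> b - \<psi> a"] by simp
    then have "\<bar>of_int k * (\<psi> b - \<psi> a - c a b)\<bar> < 1 / real (n + 4)"
      using h[OF \<open>(a, b) \<in> V\<close>] by (simp add: abs_minus_commute)
    moreover have "1 * \<bar>\<psi> b - \<psi> a - c a b\<bar> \<le> of_int k * \<bar>\<psi> b - \<psi> a - c a b\<bar>"
      using k1 by (intro mult_right_mono) auto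
    ultimately show ?thesis using k1 by (simp add: abs_mult)
  qed
  have "\<psi> z = 0" by (simp add: \<psi>_def)
  then show thesis by (rule that) (rule approx)
qed

text \<open>The approximate potentials are normalized at \<open>z\<close> and their differences along edges converge.
  Since every vertex is reached from \<open>z\<close> along edges, the potentials converge at each vertex.\<close>

lemma real_cocycle_potential:
  fixes c :: "plane \<Rightarrow> plane \<Rightarrow> real"
  assumes c: "cocycle c" and z: "z \<in> mesh_vertices \<tau>"
  obtains \<psi> :: "plane \<Rightarrow> real"
    where "\<psi> z = 0" "\<And>a b. closed_segment a b \<in> mesh_edges \<tau> \<Longrightarrow> \<psi> b - \<psi> a = c a b"
proof -
  have "\<exists>\<psi>. \<psi> z = 0 \<and> (\<forall>T a b d. T \<in> \<tau> \<longrightarrow> is_triangle T a b d \<longrightarrow> \<bar>\<psi> b - \<psi> a - c a b\<bar> \<le> 1 / real (n + 4))" for n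
    by (rule real_cocycle_approximate_potential[OF c, of z n]) (intro exI conjI allI impI; assumption?; simp)
  then obtain \<psi> where \<psi>: "\<And>n. \<psi> n z = 0"
    "\<And>n T a b d. T \<in> \<tau> \<Longrightarrow> is_triangle T a b d \<Longrightarrow> \<bar>\<psi> n b - \<psi> n a - c a b\<bar> \<le> 1 / real (n + 4)"
    by metis
  have lim: "(\<lambda>n. \<psi> n b - \<psi> n a) \<longlonglongrightarrow> c a b" if ab: "closed_segment a b \<in> mesh_edges \<tau>" for a b
  proof -
    obtain T d where T: "T \<in> \<tau>" "is_triangle T a b d" using ab segment_in_mesh_edges_iff by blast
    have "(\<lambda>n. 1 / real (n + 4)) \<longlonglongrightarrow> 0" by (rule LIMSEQ_ignore_initial_segment) (rule lim_1_over_n)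
    then have "(\<lambda>n. \<psi> n b - \<psi> n a - c a b) \<longlonglongrightarrow> 0"
      by (rule Lim_null_comparison[rotated]) (use \<psi>(2)[OF T] in simp)
    then show ?thesis by (simp add: LIM_zero_iff)
  qed
  have conv: "convergent (\<lambda>n. \<psi> n w)" if "w \<in> mesh_vertices \<tau>" for w
  proof (rule mesh_vertex_induct[OF _ z _ that])
    show "convergent (\<lambda>n. \<psi> n z)" by (simp add: \<psi>(1) convergent_const)
    fix a b assume ab: "closed_segment a b \<in> mesh_edges \<tau>" "convergent (\<lambda>n. \<psi> n a)"
    have "convergent (\<lambda>n. \<psi> n a + (\<psi> n b - \<psi> n a))"
      using lim[OF ab(1)] by (intro convergent_add ab) (auto simp: convergent_def)
    then show "convergent (\<lambda>n. \<psi> n b)" by simp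
  qed
  define \<Psi> where "\<Psi> = (\<lambda>w. lim (\<lambda>n. \<psi> n w))"
  have "\<Psi> b - \<Psi> a = c a b" if ab: "closed_segment a b \<in> mesh_edges \<tau>" for a b
  proof -
    obtain T d where T: "T \<in> \<tau>" "is_triangle T a b d" using ab segment_in_mesh_edges_iff by blast
    then have "a \<in> mesh_vertices \<tau>" "b \<in> mesh_vertices \<tau>"
      using mesh_vertices_of_triangle is_triangle_vertices by blast+
    then have "(\<lambda>n. \<psi> n b - \<psi> n a) \<longlonglongrightarrow> \<Psi> b - \<Psi> a"
      unfolding \<Psi>_def using conv by (intro tendsto_diff) (simp_all add: convergent_LIMSEQ_iff)
    then show ?thesis using lim[OF ab] LIMSEQ_unique by blast
  qed
  moreover have "\<Psi> z = 0" by (simp add: \<Psi>_def \<psi>(1))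
  ultimately show thesis by (intro that[of \<Psi>])
qed

end

section \<open>Vector spaces of fields and the local functions\<close>

lemma linear_eval: "linear (\<lambda>v :: 'a \<Rightarrow> 'b::real_vector. v x)"
  by (rule linearI) (simp_all add: plus_fun_def scaleR_fun_def)

lemma linear_chord_flux: "linear (\<lambda>v. chord_flux v p q)"
  by (rule linearI)
     (simp_all add: chord_flux_def plus_fun_def scaleR_fun_def inner_add_left scaleR_add_right[symmetric]
        add_divide_distrib)

lemma edge_flux_vanish:
  assumes "\<And>x. x \<in> closed_segment a b \<Longrightarrow> v x = 0"
  shows "edge_flux v a b = 0"
proof -
  have "((\<lambda>t. (v (linepath a b t) \<bullet> ccw_normal a b) * norm (b - a)) has_integral 0) {0..1}"
    by (rule has_integral_is_0) (simp add: assms linepath_in_path)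
  then show ?thesis unfolding edge_flux_def segment_integral_def by (rule integral_unique)
qed

lemma independent_family_image:
  fixes \<Psi> :: "'i \<Rightarrow> 'a::real_vector"
  assumes "finite J" "inj_on \<Psi> J" 
    and "\<And>c p. (\<Sum>p\<in>J. c p *\<^sub>R \<Psi> p) = 0 \<Longrightarrow> p \<in> J \<Longrightarrow> c p = 0"
  shows "independent (\<Psi> ` J)"
proof (rule independent_if_scalars_zero)
  fix f x assume f: "(\<Sum>x\<in>\<Psi> ` J. f x *\<^sub>R x) = 0" and "x \<in> \<Psi> ` J"
  then obtain p where p: "p \<in> J" "x = \<Psi> p" by blast
  have "(\<Sum>p\<in>J. f (\<Psi> p) *\<^sub>R \<Psi> p) = 0" using f by (simp add: sum.reindex[OF assms(2)])
  then show "f x = 0" using assms(3)[of "\<lambda>p. f (\<Psi> p)" p] p by simp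
qed (use assms(1) in simp)

context polygonal_mesh begin

text \<open>The additivity of the integral in the weak divergence needs integrability.\<close>

lemma test_function_integrable:
  assumes v: "continuous_on (closure \<Omega>) v" and \<phi>: "test_function \<Omega> \<phi> \<phi>'"
  shows "set_integrable lborel \<Omega> (\<lambda>x. v x \<bullet> \<phi>' x)"
proof (rule set_integrable_subset)
  have "compact (closure \<Omega>)" using bounded_domain by simp
  moreover have "continuous_on (closure \<Omega>) (\<lambda>x. v x \<bullet> \<phi>' x)"
    using \<phi> unfolding test_function_def by (intro continuous_intros v) (auto intro: continuous_on_subset)
  ultimately show "set_integrable lborel (closure \<Omega>) (\<lambda>x. v x \<bullet> \<phi>' x)"
    unfolding set_integrable_def by (rule borel_integrable_compact)
qed (use open_domain closure_subset in auto)

lemma V_h_piecewise_affine: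
  assumes "v \<in> V_h \<Omega> \<tau>" "T \<in> powell_sabin \<Omega> \<tau>"
  shows "\<exists>(A :: real^2^2) b. \<forall>x\<in>T. v x = A *v x + b"
  using assms unfolding V_h_def X_h_def by blast

lemma subspace_V_h: "subspace (V_h \<Omega> \<tau>)"
proof (rule subspaceI)
  show "0 \<in> V_h \<Omega> \<tau>"
    by (auto simp: V_h_def X_h_def has_weak_divergence_def zero_fun_def set_lebesgue_integral_def intro!: exI[of _ 0])
next
  fix u v assume u: "u \<in> V_h \<Omega> \<tau>" and v: "v \<in> V_h \<Omega> \<tau>"
  have c: "continuous_on (closure \<Omega>) u" "continuous_on (closure \<Omega>) v" using u v by (auto simp: V_h_def X_h_def)
  have "\<exists>(A :: real^2^2) b. \<forall>x\<in>T. (u + v) x = A *v x + b" if T: "T \<in> powell_sabin \<Omega> \<tau>" for T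
  proof -
    obtain A1 :: "real^2^2" and b1 where 1: "\<forall>x\<in>T. u x = A1 *v x + b1" using V_h_piecewise_affine[OF u T] by blast
    obtain A2 :: "real^2^2" and b2 where 2: "\<forall>x\<in>T. v x = A2 *v x + b2" using V_h_piecewise_affine[OF v T] by blast
    show ?thesis using 1 2
      by (intro exI[of _ "A1 + A2"] exI[of _ "b1 + b2"]) (simp add: matrix_vector_mult_add_rdistrib)
  qed
  moreover have "has_weak_divergence \<Omega> (u + v) (\<lambda>x. 0)"
    unfolding has_weak_divergence_def
  proof (intro allI impI)
    fix \<phi> \<phi>' assume \<phi>: "test_function \<Omega> \<phi> \<phi>'"
    have "(LINT x:\<Omega>|lborel. u x \<bullet> \<phi>' x) = 0" "(LINT x:\<Omega>|lborel. v x \<bullet> \<phi>' x) = 0"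
      using u v \<phi> by (auto simp: V_h_def has_weak_divergence_def)
    then show "(LINT x:\<Omega>|lborel. (u + v) x \<bullet> \<phi>' x) = - (LINT x:\<Omega>|lborel. 0 * \<phi> x)"
      using set_integral_add(2)[OF test_function_integrable[OF c(1) \<phi>] test_function_integrable[OF c(2) \<phi>]]
      by (simp add: inner_add_left)
  qed
  ultimately show "u + v \<in> V_h \<Omega> \<tau>"
    using u v by (auto simp: V_h_def X_h_def plus_fun_def intro!: continuous_intros)
next
  fix k :: real and v assume v: "v \<in> V_h \<Omega> \<tau>"
  have "\<exists>(A :: real^2^2) b. \<forall>x\<in>T. (k *\<^sub>R v) x = A *v x + b" if T: "T \<in> powell_sabin \<Omega> \<tau>" for T
  proof -
    obtain A :: "real^2^2" and b where 1: "\<forall>x\<in>T. v x = A *v x + b" using V_h_piecewise_affine[OF v T] by blast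
    show ?thesis using 1
      by (intro exI[of _ "k *\<^sub>R A"] exI[of _ "k *\<^sub>R b"]) (simp add: scaleR_fun_def scaleR_matrix_vector_assoc scaleR_add_right)
  qed
  moreover have "has_weak_divergence \<Omega> (k *\<^sub>R v) (\<lambda>x. 0)"
    using v unfolding V_h_def has_weak_divergence_def scaleR_fun_def by simp
  ultimately show "k *\<^sub>R v \<in> V_h \<Omega> \<tau>"
    using v by (auto simp: V_h_def X_h_def scaleR_fun_def intro!: continuous_intros)
qed

lemma subspace_V_h0: "subspace (V_h0 \<Omega> \<tau>)"
proof -
  have "V_h0 \<Omega> \<tau> = V_h \<Omega> \<tau> \<inter> {v. \<forall>x\<in>frontier \<Omega>. v x = 0}"
    by (auto simp: V_h0_def X_h0_def V_h_def)
  moreover have "subspace {v :: plane \<Rightarrow> plane. \<forall>x\<in>frontier \<Omega>. v x = 0}"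
    by (rule subspaceI) (simp_all add: scaleR_fun_def)
  ultimately show ?thesis using subspace_V_h by (simp add: subspace_inter)
qed

text \<open>Through the spokes the edge flux is a linear functional of the field on \<^term>\<open>V_h \<Omega> \<tau>\<close>.\<close>

lemma edge_flux_sum:
  assumes "finite I" "\<And>i. i \<in> I \<Longrightarrow> \<phi> i \<in> V_h \<Omega> \<tau>" "closed_segment a b \<in> mesh_edges \<tau>"
  shows "edge_flux (\<Sum>i\<in>I. k i *\<^sub>R \<phi> i) a b = (\<Sum>i\<in>I. k i * edge_flux (\<phi> i) a b)"
proof -
  obtain T c where T: "T \<in> \<tau>" "is_triangle T a b c" using assms(3) segment_in_mesh_edges_iff by blast
  have "(\<Sum>i\<in>I. k i *\<^sub>R \<phi> i) \<in> V_h \<Omega> \<tau>"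
    by (intro subspace_sum[OF subspace_V_h] subspace_scale[OF subspace_V_h] assms(2))
  then show ?thesis
    using edge_flux_eq_spokes[OF _ T] assms(2)
    by (simp add: linear_sum[OF linear_chord_flux] linear_scale[OF linear_chord_flux] right_diff_distrib sum_subtractf)
qed

lemma edge_flux_diff:
  assumes "u \<in> V_h \<Omega> \<tau>" "v \<in> V_h \<Omega> \<tau>" "closed_segment a b \<in> mesh_edges \<tau>"
  shows "edge_flux (u - v) a b = edge_flux u a b - edge_flux v a b"
proof -
  obtain T c where T: "T \<in> \<tau>" "is_triangle T a b c" using assms(3) segment_in_mesh_edges_iff by blast
  show ?thesis
    using edge_flux_eq_spokes[OF _ T] assms(1,2) subspace_diff[OF subspace_V_h assms(1,2)]
    by (simp add: linear_diff[OF linear_chord_flux])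
qed

lemma V_local_vanishes_on_edge:
  assumes v: "v \<in> V_local \<Omega> \<tau> z" and ab: "closed_segment a b \<in> mesh_edges \<tau>" "z \<noteq> a" "z \<noteq> b"
    and x: "x \<in> closed_segment a b"
  shows "v x = 0"
proof -
  obtain T c where T: "T \<in> \<tau>" "is_triangle T a b c" using ab segment_in_mesh_edges_iff by blast
  have e: "closed_segment a b edge_of T" by (rule is_triangle_edge[OF T(2)])
  then have f: "closed_segment a b face_of T" by (simp add: edge_of_def)
  show ?thesis
  proof (cases "z extreme_point_of T")
    case True
    then have "z \<notin> closed_segment a b"
      using extreme_point_of_face[OF f, of z] ab by (auto simp: extreme_point_of_segment)
    then show ?thesis using v True T(1) e x unfolding V_local_def by blast
  next
    case False
    then show ?thesis using v T(1) x face_of_imp_subset[OF f] unfolding V_local_def by blast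
  qed
qed

text \<open>Two edges of a triangle start at \<open>w\<close>, and at least one of them does not contain \<open>z\<close>.\<close>

lemma V_local_vanishes_at_vertex:
  assumes v: "v \<in> V_local \<Omega> \<tau> z" and w: "w \<in> mesh_vertices \<tau>" "w \<noteq> z"
  shows "v w = 0"
proof -
  obtain T where T: "T \<in> \<tau>" "w extreme_point_of T" using w by (auto simp: mesh_vertices_def)
  obtain p q r where tri: "is_triangle T p q r" using mesh_triangle[OF T(1)] .
  have "w = p \<or> w = q \<or> w = r" using T(2) is_triangle_vertex_iff[OF tri] by simp
  then have "\<exists>b c. is_triangle T w b c"
    using tri is_triangle_rotate[OF tri] is_triangle_rotate[OF is_triangle_rotate[OF tri]] by blast
  then obtain b c where wbc: "is_triangle T w b c" by blast
  have "is_triangle T w c b"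
    by (rule is_triangle_swap[OF is_triangle_rotate[OF is_triangle_rotate[OF wbc]]])
  then have e: "closed_segment w b \<in> mesh_edges \<tau>" "closed_segment w c \<in> mesh_edges \<tau>"
    using wbc T(1) segment_in_mesh_edges_iff by blast+
  have "z \<noteq> b \<or> z \<noteq> c" using is_triangle_distinct[OF wbc] by auto
  then show ?thesis
    using V_local_vanishes_on_edge[OF v e(1)] V_local_vanishes_on_edge[OF v e(2)] w(2) by auto
qed

text \<open>Boundary points lie on exterior edges, and those have no interior vertex as an endpoint.\<close>

lemma V_local_vanishes_on_boundary:
  assumes v: "v \<in> V_local \<Omega> \<tau> z" and z: "z \<in> interior_vertices \<Omega> \<tau>" and x: "x \<in> frontier \<Omega>"
  shows "v x = 0"
proof -
  obtain e where e: "e \<in> exterior_edges \<Omega> \<tau>" "x \<in> e" using boundary_point_on_exterior_edge[OF x] by blast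
  obtain a b where ab: "e = closed_segment a b" "a \<in> exterior_vertices \<Omega> \<tau>" "b \<in> exterior_vertices \<Omega> \<tau>"
    using exterior_edge_segment[OF e(1)] .
  then have "z \<noteq> a" "z \<noteq> b" using z by (auto simp: interior_vertices_def)
  then show ?thesis
    using V_local_vanishes_on_edge[OF v, of a b x] e ab(1) by (simp add: exterior_edges_def)
qed

lemma local_basis_function_edge_flux:
  assumes \<phi>: "local_basis_function \<Omega> \<tau> z \<alpha> \<beta> \<delta> \<phi>" and ab: "closed_segment a b \<in> mesh_edges \<tau>"
  shows "edge_flux \<phi> a b = (if a = z then \<delta> else 0) - (if b = z then \<delta> else 0)"
proof -
  have loc: "\<phi> \<in> V_local \<Omega> \<tau> z" and flux: "\<And>w. closed_segment z w \<in> mesh_edges \<tau> \<Longrightarrow> edge_flux \<phi> z w = \<delta>"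
    using \<phi> by (simp_all add: local_basis_function_def edge_flux_def)
  obtain T c where T: "T \<in> \<tau>" "is_triangle T a b c" using ab segment_in_mesh_edges_iff by blast
  have "a \<noteq> b" using is_triangle_distinct[OF T(2)] by simp
  have "\<phi> \<in> V_h \<Omega> \<tau>" using loc by (simp add: V_local_def)
  then have swap: "edge_flux \<phi> b a = - edge_flux \<phi> a b" by (rule edge_flux_closed[OF _ T])
  consider "a = z" | "b = z" | "a \<noteq> z" "b \<noteq> z" by blast
  then show ?thesis
  proof cases
    case 1 then show ?thesis using flux ab \<open>a \<noteq> b\<close> by auto
  next
    case 2 then show ?thesis using flux[of a] ab swap \<open>a \<noteq> b\<close> by (auto simp: closed_segment_commute)
  next
    case 3 then show ?thesis using edge_flux_vanish V_local_vanishes_on_edge[OF loc ab] by (metis diff_zero)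
  qed
qed

end

section \<open>The global basis\<close>

locale local_bases = polygonal_mesh +
  fixes z :: "nat \<Rightarrow> plane" and \<Phi> :: "nat \<Rightarrow> nat \<Rightarrow> plane \<Rightarrow> plane"
  assumes enum: "bij_betw z {0..<card (mesh_vertices \<tau>)} (mesh_vertices \<tau>)"
    and first_exterior: "z 0 \<in> exterior_vertices \<Omega> \<tau>"
    and \<Phi>1: "k < card (mesh_vertices \<tau>) \<Longrightarrow> local_basis_function \<Omega> \<tau> (z k) 1 0 0 (\<Phi> k 1)"
    and \<Phi>2: "k < card (mesh_vertices \<tau>) \<Longrightarrow> local_basis_function \<Omega> \<tau> (z k) 0 1 0 (\<Phi> k 2)"
    and \<Phi>3: "k < card (mesh_vertices \<tau>) \<Longrightarrow> local_basis_function \<Omega> \<tau> (z k) 0 0 1 (\<Phi> k 3)"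
begin

abbreviation N :: nat where "N \<equiv> card (mesh_vertices \<tau>)"

text \<open>A pair \<open>(k, i)\<close> stands for the function \<open>\<Phi> k i\<close>.\<close>

definition indices :: "(nat \<times> nat) set" where
  "indices = {0..<N} \<times> {1, 2, 3}"

definition basis_fun :: "nat \<times> nat \<Rightarrow> plane \<Rightarrow> plane" where
  "basis_fun p = \<Phi> (fst p) (snd p)"

definition comb :: "(nat \<times> nat \<Rightarrow> real) \<Rightarrow> plane \<Rightarrow> plane" where
  "comb c = (\<Sum>p\<in>indices. c p *\<^sub>R basis_fun p)"

lemma finite_indices: "finite indices" by (simp add: indices_def)

lemma vertex_index:
  "k < N \<Longrightarrow> z k \<in> mesh_vertices \<tau>"
  "w \<in> mesh_vertices \<tau> \<Longrightarrow> \<exists>k<N. z k = w"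
  "k < N \<Longrightarrow> l < N \<Longrightarrow> z k = z l \<longleftrightarrow> k = l"
proof -
  show "k < N \<Longrightarrow> z k \<in> mesh_vertices \<tau>" using bij_betwE[OF enum] by simp
  show "w \<in> mesh_vertices \<tau> \<Longrightarrow> \<exists>k<N. z k = w"
    using bij_betw_imp_surj_on[OF enum] by (metis atLeastLessThan_iff imageE)
  show "k < N \<Longrightarrow> l < N \<Longrightarrow> z k = z l \<longleftrightarrow> k = l"
    using bij_betw_imp_inj_on[OF enum] by (auto dest: inj_onD)
qed

lemma N_pos: "0 < N"
  using first_exterior finite_mesh_vertices by (auto simp: exterior_vertices_def card_gt_0_iff)

lemma basis_fun_local:
  assumes "k < N" "i \<in> {1, 2, 3}"
  shows "basis_fun (k, i) \<in> V_local \<Omega> \<tau> (z k)"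
    and "basis_fun (k, i) (z k) = vector [of_bool (i = 1), of_bool (i = 2)]"
    and "closed_segment a b \<in> mesh_edges \<tau> \<Longrightarrow>
      edge_flux (basis_fun (k, i)) a b = of_bool (i = 3) * (of_bool (a = z k) - of_bool (b = z k))"
proof -
  have "local_basis_function \<Omega> \<tau> (z k) (of_bool (i = 1)) (of_bool (i = 2)) (of_bool (i = 3)) (basis_fun (k, i))"
    using assms(2) \<Phi>1[OF assms(1)] \<Phi>2[OF assms(1)] \<Phi>3[OF assms(1)] unfolding basis_fun_def by auto
  note L = this
  then show "basis_fun (k, i) \<in> V_local \<Omega> \<tau> (z k)"
    "basis_fun (k, i) (z k) = vector [of_bool (i = 1), of_bool (i = 2)]"
    by (simp_all add: local_basis_function_def)
  show "closed_segment a b \<in> mesh_edges \<tau> \<Longrightarrow>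
      edge_flux (basis_fun (k, i)) a b = of_bool (i = 3) * (of_bool (a = z k) - of_bool (b = z k))"
    using local_basis_function_edge_flux[OF L] by simp
qed

lemma basis_fun_V_h: "p \<in> indices \<Longrightarrow> basis_fun p \<in> V_h \<Omega> \<tau>"
  using basis_fun_local(1) by (auto simp: indices_def V_local_def)

lemma comb_V_h: "comb c \<in> V_h \<Omega> \<tau>"
  unfolding comb_def
  by (intro subspace_sum[OF subspace_V_h] subspace_scale[OF subspace_V_h] basis_fun_V_h)

lemma comb_at_vertex:
  assumes j: "j < N"
  shows "comb c (z j) = vector [c (j, 1), c (j, 2)]"
proof -
  have val: "basis_fun (k, i) (z j) = of_bool (k = j) *\<^sub>R vector [of_bool (i = 1), of_bool (i = 2)]"
    if "k < N" "i \<in> {1, 2, 3}" for k i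
  proof (cases "k = j")
    case False
    then have "z j \<noteq> z k" using vertex_index(3)[OF j that(1)] by simp
    then show ?thesis
      using V_local_vanishes_at_vertex[OF basis_fun_local(1)[OF that] vertex_index(1)[OF j]] False by simp
  qed (use basis_fun_local(2)[OF that] in simp)
  have "comb c (z j) = (\<Sum>p\<in>indices. c p *\<^sub>R basis_fun p (z j))"
    unfolding comb_def by (simp add: linear_sum[OF linear_eval] scaleR_fun_def)
  also have "\<dots> = (\<Sum>k\<in>{0..<N}. \<Sum>i\<in>{1, 2, 3}. c (k, i) *\<^sub>R basis_fun (k, i) (z j))"
    unfolding indices_def sum.cartesian_product by (rule sum.cong) auto
  also have "\<dots> = (\<Sum>k\<in>{0..<N}. if k = j then (\<Sum>i\<in>{1, 2, 3}. c (j, i) *\<^sub>R vector [of_bool (i = 1), of_bool (i = 2)]) else 0)"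
    by (intro sum.cong refl) (simp add: val)
  also have "\<dots> = vector [c (j, 1), c (j, 2)]"
    using j by (simp add: plane_eq_iff)
  finally show ?thesis .
qed

lemma comb_edge_flux:
  assumes j: "j < N" "l < N" and e: "closed_segment (z j) (z l) \<in> mesh_edges \<tau>"
  shows "edge_flux (comb c) (z j) (z l) = c (j, 3) - c (l, 3)"
proof -
  have "edge_flux (comb c) (z j) (z l) = (\<Sum>p\<in>indices. c p * edge_flux (basis_fun p) (z j) (z l))"
    unfolding comb_def by (rule edge_flux_sum[OF finite_indices basis_fun_V_h e])
  also have "\<dots> = (\<Sum>k\<in>{0..<N}. \<Sum>i\<in>{1, 2, 3}. c (k, i) * edge_flux (basis_fun (k, i)) (z j) (z l))"
    unfolding indices_def sum.cartesian_product by (rule sum.cong) auto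
  also have "\<dots> = (\<Sum>k\<in>{0..<N}. c (k, 3) * (of_bool (j = k) - of_bool (l = k)))"
  proof (rule sum.cong[OF refl])
    fix k assume "k \<in> {0..<N}"
    then have k: "k < N" by simp
    show "(\<Sum>i\<in>{1, 2, 3}. c (k, i) * edge_flux (basis_fun (k, i)) (z j) (z l)) = c (k, 3) * (of_bool (j = k) - of_bool (l = k))"
      using basis_fun_local(3)[OF k _ e] vertex_index(3)[OF j(1) k] vertex_index(3)[OF j(2) k]
      by simp
  qed
  also have "\<dots> = c (j, 3) - c (l, 3)"
    using j by (simp add: right_diff_distrib sum_subtractf of_bool_def if_distrib[of "(*) _"] cong: if_cong)
  finally show ?thesis .
qed

text \<open>Among the \<open>3 N\<close> local functions there is at most one linear relation up to scaling: a vanishing combination has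
  vanishing vertex values, and no fluxes, so its third coefficients form a constant function on the
  connected graph of edges.\<close>

lemma comb_eq_0:
  assumes "comb c = 0" and k: "k < N"
  shows "c (k, 1) = 0" "c (k, 2) = 0" "c (k, 3) = c (0, 3)"
proof -
  have "vector [c (k, 1), c (k, 2)] = (0 :: plane)"
    using comb_at_vertex[OF k, of c] assms(1) by simp
  then show "c (k, 1) = 0" "c (k, 2) = 0" by (simp_all add: plane_eq_iff)
  have "\<forall>l<N. z l = z k \<longrightarrow> c (l, 3) = c (0, 3)"
  proof (rule mesh_vertex_induct[where P = "\<lambda>w. \<forall>l<N. z l = w \<longrightarrow> c (l, 3) = c (0, 3)"])
    fix a b assume ab: "closed_segment a b \<in> mesh_edges \<tau>" and a: "\<forall>l<N. z l = a \<longrightarrow> c (l, 3) = c (0, 3)"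
    show "\<forall>l<N. z l = b \<longrightarrow> c (l, 3) = c (0, 3)"
    proof (intro allI impI)
      fix l assume l: "l < N" "z l = b"
      obtain T d where "T \<in> \<tau>" "is_triangle T a b d" using ab segment_in_mesh_edges_iff by blast
      then have "a \<in> mesh_vertices \<tau>" using mesh_vertices_of_triangle is_triangle_vertices by blast
      then obtain j where j: "j < N" "z j = a" using vertex_index(2) by blast
      have "edge_flux (0 :: plane \<Rightarrow> plane) a b = 0" by (rule edge_flux_vanish) simp
      then have "c (j, 3) - c (l, 3) = 0"
        using comb_edge_flux[OF j(1) l(1), of c] ab j(2) l(2) assms(1) by simp
      then show "c (l, 3) = c (0, 3)" using a j by simp
    qed
  next
    show "z 0 \<in> mesh_vertices \<tau>" "z k \<in> mesh_vertices \<tau>" using vertex_index(1) N_pos k by blast+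
    show "\<forall>l<N. z l = z 0 \<longrightarrow> c (l, 3) = c (0, 3)" using vertex_index(3)[OF _ N_pos] by blast
  qed
  then show "c (k, 3) = c (0, 3)" using k by blast
qed

text \<open>The coefficients are the vertex values of the field and the potential of its fluxes that
  is zero at \<open>z 0\<close>. The sign in the cocycle comes from the fluxes \<open>\<psi> a - \<psi> b\<close> of a combination. If
  the field vanishes on the boundary, the potential does not change along exterior edges and so is zero
  at all exterior vertices.\<close>

lemma V_h_eq_comb:
  assumes v: "v \<in> V_h \<Omega> \<tau>"
  obtains c where "v = comb c" "c (0, 3) = 0"
    "\<And>k i. \<lbrakk>v \<in> V_h0 \<Omega> \<tau>; k < N; z k \<in> exterior_vertices \<Omega> \<tau>; i \<in> {1, 2, 3}\<rbrakk> \<Longrightarrow> c (k, i) = 0"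
proof -
  have "cocycle (\<lambda>a b. - edge_flux v a b)"
    unfolding cocycle_def using edge_flux_closed[OF v] by fastforce
  moreover have "z 0 \<in> mesh_vertices \<tau>" using vertex_index(1) N_pos by blast
  ultimately obtain \<psi> where \<psi>: "\<psi> (z 0) = 0"
      "\<And>a b. closed_segment a b \<in> mesh_edges \<tau> \<Longrightarrow> \<psi> b - \<psi> a = - edge_flux v a b"
    using real_cocycle_potential by blast
  define c where "c = (\<lambda>(k, i :: nat). if i = 1 then v (z k) $ 1 else if i = 2 then v (z k) $ 2 else \<psi> (z k))"
  define u where "u = v - comb c"
  have "u = 0"
  proof (rule V_h_unisolvent)
    show "u \<in> V_h \<Omega> \<tau>" unfolding u_def by (rule subspace_diff[OF subspace_V_h v comb_V_h])
    fix w assume "w \<in> mesh_vertices \<tau>"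
    then obtain k where k: "k < N" "z k = w" using vertex_index(2) by blast
    have "comb c w = v w" using comb_at_vertex[OF k(1), of c] k(2) by (simp add: c_def plane_eq_iff)
    then show "u w = 0" by (simp add: u_def)
  next
    fix a b assume ab: "closed_segment a b \<in> mesh_edges \<tau>"
    obtain T d where T: "T \<in> \<tau>" "is_triangle T a b d" using ab segment_in_mesh_edges_iff by blast
    then have "a \<in> mesh_vertices \<tau>" "b \<in> mesh_vertices \<tau>"
      using mesh_vertices_of_triangle is_triangle_vertices by blast+
    then obtain j l where jl: "j < N" "z j = a" "l < N" "z l = b" using vertex_index(2) by metis
    have "edge_flux (comb c) a b = \<psi> a - \<psi> b"
      using comb_edge_flux[OF jl(1,3), of c] jl ab by (simp add: c_def)
    then show "edge_flux u a b = 0"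
      using edge_flux_diff[OF v comb_V_h ab] \<psi>(2)[OF ab] by (simp add: u_def)
  qed
  then have "v = comb c" by (simp add: u_def)
  moreover have "c (0, 3) = 0" by (simp add: c_def \<psi>)
  moreover have "c (k, i) = 0"
    if v0: "v \<in> V_h0 \<Omega> \<tau>" and k: "k < N" "z k \<in> exterior_vertices \<Omega> \<tau>" and i: "i \<in> {1, 2, 3}" for k i
  proof -
    have bd: "v x = 0" if "x \<in> frontier \<Omega>" for x using v0 that by (simp add: V_h0_def X_h0_def)
    have "\<psi> (z k) = 0"
    proof (rule exterior_vertex_induct[where P = "\<lambda>w. \<psi> w = 0", OF _ first_exterior \<psi>(1) k(2)])
      fix a b assume ab: "closed_segment a b \<in> exterior_edges \<Omega> \<tau>" "\<psi> a = 0"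
      then have "closed_segment a b \<in> mesh_edges \<tau>" "closed_segment a b \<subseteq> frontier \<Omega>"
        by (auto simp: exterior_edges_def)
      moreover from this have "edge_flux v a b = 0" by (intro edge_flux_vanish bd) blast
      ultimately show "\<psi> b = 0" using \<psi>(2)[of a b] ab(2) by simp
    qed
    moreover have "v (z k) = 0" using k(2) by (intro bd) (simp add: exterior_vertices_def)
    ultimately show ?thesis by (simp add: c_def)
  qed
  ultimately show thesis by (rule that)
qed

text \<open>Equal functions for different indices would be a relation with the two nonzero coefficients \<open>1\<close> and
  \<open>-1\<close>, which contradicts that the third coefficients agree and the others are zero.\<close>

lemma inj_basis_fun: "inj_on basis_fun indices"
proof (rule inj_onI, rule ccontr)
  fix p q assume p: "p \<in> indices" and q: "q \<in> indices" and eq: "basis_fun p = basis_fun q" and "p \<noteq> q"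
  define c where "c = (\<lambda>r. of_bool (r = p) - of_bool (r = q) :: real)"
  have "comb c = (\<Sum>r\<in>indices. of_bool (r = p) *\<^sub>R basis_fun r) - (\<Sum>r\<in>indices. of_bool (r = q) *\<^sub>R basis_fun r)"
    by (simp add: comb_def c_def scaleR_left_diff_distrib sum_subtractf)
  also have "\<dots> = basis_fun p - basis_fun q"
    using p q finite_indices by (simp add: of_bool_def if_distrib[of "\<lambda>t. t *\<^sub>R _"] cong: if_cong)
  finally have "comb c = 0" using eq by simp
  note zero = comb_eq_0[OF this]
  obtain k i l j where ki: "p = (k, i)" "k < N" "i \<in> {1, 2, 3}" and lj: "q = (l, j)" "l < N" "j \<in> {1, 2, 3}"
    using p q by (auto simp: indices_def)
  have cp: "c (k, i) = 1" "c (l, j) = -1" using \<open>p \<noteq> q\<close> by (auto simp: c_def ki lj)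
  have "i = 3" using zero(1,2)[OF ki(2)] cp(1) ki(3) by force
  moreover have "j = 3" using zero(1,2)[OF lj(2)] cp(2) lj(3) by force
  ultimately show False using cp zero(3)[OF ki(2)] zero(3)[OF lj(2)] by simp
qed

lemma independent_basis_funs: "independent (basis_fun ` (indices - {(0, 3)}))"
proof (rule independent_family_image)
  show "finite (indices - {(0, 3)})" "inj_on basis_fun (indices - {(0, 3)})"
    using finite_indices inj_basis_fun by (auto intro: inj_on_subset)
  fix c :: "nat \<times> nat \<Rightarrow> real" and p
  assume 0: "(\<Sum>p\<in>indices - {(0, 3)}. c p *\<^sub>R basis_fun p) = 0" and p: "p \<in> indices - {(0, 3)}"
  \<comment> \<open>The coefficient zero of the omitted function fixes the constant in the relation.\<close>
  define d where "d = c((0, 3) := 0)"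
  have "comb d = (\<Sum>p\<in>indices - {(0, 3)}. d p *\<^sub>R basis_fun p)"
    unfolding comb_def by (rule sum.mono_neutral_right) (use finite_indices in \<open>auto simp: d_def\<close>)
  also have "\<dots> = (\<Sum>p\<in>indices - {(0, 3)}. c p *\<^sub>R basis_fun p)"
    by (rule sum.cong) (auto simp: d_def)
  finally have "comb d = 0" using 0 by simp
  then have "d p = 0"
    using comb_eq_0[of d "fst p"] p by (cases p) (auto simp: indices_def d_def split: if_splits)
  then show "c p = 0" using p by (auto simp: d_def split: if_splits)
qed

lemma comb_in_span:
  assumes "\<And>p. p \<in> indices - J \<Longrightarrow> c p = 0"
  shows "comb c \<in> span (basis_fun ` J)"
  unfolding comb_def
proof (rule span_sum)
  fix p assume "p \<in> indices"
  then show "c p *\<^sub>R basis_fun p \<in> span (basis_fun ` J)"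
    using assms by (cases "p \<in> J") (auto intro: span_scale span_base span_zero)
qed

lemma V_h_basis: "is_basis (basis_fun ` (indices - {(0, 3)})) (V_h \<Omega> \<tau>)"
proof -
  have "span (basis_fun ` (indices - {(0, 3)})) \<subseteq> V_h \<Omega> \<tau>"
    by (rule span_minimal[OF _ subspace_V_h]) (auto intro: basis_fun_V_h)
  moreover have "v \<in> span (basis_fun ` (indices - {(0, 3)}))" if v: "v \<in> V_h \<Omega> \<tau>" for v
  proof -
    obtain c where c: "v = comb c" "c (0, 3) = 0" using V_h_eq_comb[OF v] by metis
    show ?thesis unfolding c(1) by (rule comb_in_span) (use c(2) in auto)
  qed
  ultimately show ?thesis using independent_basis_funs unfolding is_basis_def by blast
qed

lemma V_h0_basis: "is_basis (basis_fun ` {p \<in> indices. z (fst p) \<in> interior_vertices \<Omega> \<tau>}) (V_h0 \<Omega> \<tau>)"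
proof -
  let ?J = "{p \<in> indices. z (fst p) \<in> interior_vertices \<Omega> \<tau>}"
  have "(0, 3) \<notin> ?J" using first_exterior by (simp add: interior_vertices_def)
  then have "independent (basis_fun ` ?J)"
    using independent_basis_funs by (rule_tac independent_mono) auto
  moreover have "basis_fun p \<in> V_h0 \<Omega> \<tau>" if p: "p \<in> ?J" for p
  proof -
    obtain k i where ki: "p = (k, i)" "k < N" "i \<in> {1, 2, 3}" using p by (auto simp: indices_def)
    have "basis_fun p x = 0" if "x \<in> frontier \<Omega>" for x
      using V_local_vanishes_on_boundary[OF basis_fun_local(1)[OF ki(2,3)] _ that] p ki(1) by simp
    then show ?thesis using basis_fun_V_h[of p] p by (simp add: V_h0_def X_h0_def V_h_def)
  qed
  then have "span (basis_fun ` ?J) \<subseteq> V_h0 \<Omega> \<tau>"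
    by (intro span_minimal[OF _ subspace_V_h0]) blast
  moreover have "v \<in> span (basis_fun ` ?J)" if v: "v \<in> V_h0 \<Omega> \<tau>" for v
  proof -
    have "v \<in> V_h \<Omega> \<tau>" using v by (simp add: V_h0_def)
    then obtain c where c: "v = comb c"
        "\<And>k i. \<lbrakk>k < N; z k \<in> exterior_vertices \<Omega> \<tau>; i \<in> {1, 2, 3}\<rbrakk> \<Longrightarrow> c (k, i) = 0"
      using V_h_eq_comb v by metis
    show ?thesis unfolding c(1)
    proof (rule comb_in_span)
      fix p assume p: "p \<in> indices - ?J"
      then show "c p = 0"
        using c(2)[of "fst p" "snd p"] vertex_index(1) by (auto simp: indices_def interior_vertices_def)
    qed
  qed
  ultimately show ?thesis unfolding is_basis_def by blast
qed

end

theorem theorem1: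
  fixes \<Omega> :: "(real^2) set" and \<tau> :: "(real^2) set set"
    and z :: "nat \<Rightarrow> real^2" and \<Phi> :: "nat \<Rightarrow> nat \<Rightarrow> real^2 \<Rightarrow> real^2"
    and B B0 :: "(real^2 \<Rightarrow> real^2) set"
  assumes "polygonal_domain \<Omega>"
    and "macro_mesh \<Omega> \<tau>"
    and "bij_betw z {0..<card (mesh_vertices \<tau>)} (mesh_vertices \<tau>)"
    and "z 0 \<in> exterior_vertices \<Omega> \<tau>"
    and "\<And>k. k < card (mesh_vertices \<tau>) \<Longrightarrow> local_basis_function \<Omega> \<tau> (z k) 1 0 0 (\<Phi> k 1)"
    and "\<And>k. k < card (mesh_vertices \<tau>) \<Longrightarrow> local_basis_function \<Omega> \<tau> (z k) 0 1 0 (\<Phi> k 2)"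
    and "\<And>k. k < card (mesh_vertices \<tau>) \<Longrightarrow> local_basis_function \<Omega> \<tau> (z k) 0 0 1 (\<Phi> k 3)"
  defines "B \<equiv> {\<Phi> k i | k i. i \<in> {1..3} \<and> k < card (mesh_vertices \<tau>)} - {\<Phi> 0 3}"
    and "B0 \<equiv> {\<Phi> k i | k i. i \<in> {1..3} \<and> k < card (mesh_vertices \<tau>) \<and>
                 \<Phi> k i \<in> B \<and> z k \<in> interior_vertices \<Omega> \<tau>}"
  shows "is_basis B (V_h \<Omega> \<tau>) \<and> is_basis B0 (V_h0 \<Omega> \<tau>)"
proof -
  interpret local_bases \<Omega> \<tau> z \<Phi>
    by unfold_locales (fact assms)+
  have three: "{1..3} = {1, 2, 3 :: nat}" by auto
  have "{\<Phi> k i | k i. i \<in> {1..3} \<and> k < N} = basis_fun ` indices"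
    unfolding indices_def basis_fun_def three by force
  moreover have "\<Phi> 0 3 = basis_fun (0, 3)" by (simp add: basis_fun_def)
  moreover have "basis_fun ` (indices - {(0, 3)}) = basis_fun ` indices - basis_fun ` {(0, 3)}"
    by (rule inj_on_image_set_diff[OF inj_basis_fun]) (use N_pos in \<open>auto simp: indices_def\<close>)
  ultimately have B: "B = basis_fun ` (indices - {(0, 3)})" unfolding B_def by simp
  have in_B: "basis_fun p \<in> B" if "p \<in> indices" "z (fst p) \<in> interior_vertices \<Omega> \<tau>" for p
    using that first_exterior unfolding B by (intro imageI) (auto simp: interior_vertices_def)
  have "B0 = basis_fun ` {p \<in> indices. z (fst p) \<in> interior_vertices \<Omega> \<tau>}"
  proof (intro set_eqI iffI)
    fix f assume "f \<in> B0"
    then show "f \<in> basis_fun ` {p \<in> indices. z (fst p) \<in> interior_vertices \<Omega> \<tau>}"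
      unfolding B0_def indices_def basis_fun_def three by force
  next
    fix f assume "f \<in> basis_fun ` {p \<in> indices. z (fst p) \<in> interior_vertices \<Omega> \<tau>}"
    then obtain p where p: "p \<in> indices" "z (fst p) \<in> interior_vertices \<Omega> \<tau>" "f = basis_fun p" by blast
    then show "f \<in> B0"
      using in_B[OF p(1,2)] unfolding B0_def indices_def basis_fun_def three by force
  qed
  then show ?thesis using V_h_basis V_h0_basis B by simp
qed

end
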